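(* Let $\{X(t): t \in [0,\infty)\}$ be a centered stationary Gaussian process with almost surely continuous sample paths and covariance function $r(t) := \mathrm{Cov}(X(s), X(s+t))$ satisfying: (A1) $r(t) = 1 - C|t|^\alpha + o(|t|^\alpha)$ as $t \to 0$, for some $\alpha \in (0,2]$ and $C > 0$; (A2) $r(t) < 1$ for all $t > 0$. Let $T$ be a nonnegative random variable, independent of $\{X(t)\}$, with $\mathbb{E} T < \infty$. Then, as $u \to \infty$, \[ \mathbb{P}\Big(\sup_{s \in [0,T]} X(s) > u\Big) = \mathbb{E} T \; C^{1/\alpha} \mathcal{H}_\alpha \, u^{2/\alpha}\, \Psi(u)\,(1+o(1)). \]
   Context: $\Psi(u) := \mathbb{P}(\mathcal{N} > u)$, where $\mathcal{N}$ is a standard normal random variable. $\mathcal{H}_\alpha$ is Pickands' constant: $\mathcal{H}_\alpha = \lim_{S\to\infty} \mathcal{H}_\alpha(S)/S$, where $\mathcal{H}_\alpha(S) := \mathbb{E}\exp\big(\sup_{t\in[0,S]} (\sqrt{2} B_\alpha(t) - t^\alpha)\big)$ and $\{B_\alpha(t): t \ge 0\}$ is a standard fractional Brownian motion with Hurst parameter $\alpha/2$.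
   Formalization: The formal theorem also assumes E T > 0; if E T = 0 then T = 0 almost surely, the left side equals Ψ(u) > 0 and the right side is 0, so the claim as written fails in that case. *)

theory Defs
  imports "HOL-Probability.Probability" "HOL-Library.Landau_Symbols"
begin

definition Psi :: "real \<Rightarrow> real" where
  "Psi u = measure (density lborel std_normal_density) {u<..}"

definition covariance :: "'a measure \<Rightarrow> ('a \<Rightarrow> real) \<Rightarrow> ('a \<Rightarrow> real) \<Rightarrow> real" where
  "covariance M Y Z =
     (\<integral>\<omega>. (Y \<omega> - (\<integral>x. Y x \<partial>M)) * (Z \<omega> - (\<integral>x. Z x \<partial>M)) \<partial>M)"

definition gaussian_rv :: "'a measure \<Rightarrow> ('a \<Rightarrow> real) \<Rightarrow> bool" where
  "gaussian_rv M Y \<longleftrightarrow> Y \<in> borel_measurable M \<and>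
     (\<exists>\<mu> \<sigma>. \<sigma> \<ge> 0 \<and>
        distr M borel Y = (if \<sigma> = 0 then return borel \<mu> else density lborel (normal_density \<mu> \<sigma>)))"

definition gaussian_process :: "'a measure \<Rightarrow> real set \<Rightarrow> (real \<Rightarrow> 'a \<Rightarrow> real) \<Rightarrow> bool" where
  "gaussian_process M I X \<longleftrightarrow>
     (\<forall>t\<in>I. X t \<in> borel_measurable M) \<and>
     (\<forall>ts cs. set ts \<subseteq> I \<longrightarrow> length cs = length ts \<longrightarrow>
        gaussian_rv M (\<lambda>\<omega>. \<Sum>i<length ts. cs ! i * X (ts ! i) \<omega>))"

definition centered_process :: "'a measure \<Rightarrow> real set \<Rightarrow> (real \<Rightarrow> 'a \<Rightarrow> real) \<Rightarrow> bool" where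
  "centered_process M I X \<longleftrightarrow> (\<forall>t\<in>I. (\<integral>\<omega>. X t \<omega> \<partial>M) = 0)"

definition path_map :: "(real \<Rightarrow> 'a \<Rightarrow> real) \<Rightarrow> 'a \<Rightarrow> (real \<Rightarrow> real)" where
  "path_map X \<omega> = (\<lambda>t\<in>{0..}. X t \<omega>)"

definition path_space :: "(real \<Rightarrow> real) measure" where
  "path_space = Pi\<^sub>M {0..} (\<lambda>_. borel)"

definition stationary_process :: "'a measure \<Rightarrow> (real \<Rightarrow> 'a \<Rightarrow> real) \<Rightarrow> bool" where
  "stationary_process M X \<longleftrightarrow>
     (\<forall>h\<ge>0. distr M path_space (path_map (\<lambda>t. X (t + h))) = distr M path_space (path_map X))"

definition as_continuous_paths :: "'a measure \<Rightarrow> (real \<Rightarrow> 'a \<Rightarrow> real) \<Rightarrow> bool" where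
  "as_continuous_paths M X \<longleftrightarrow> (AE \<omega> in M. continuous_on {0..} (\<lambda>t. X t \<omega>))"

definition fBm :: "'b measure \<Rightarrow> real \<Rightarrow> (real \<Rightarrow> 'b \<Rightarrow> real) \<Rightarrow> bool" where
  "fBm N \<alpha> B \<longleftrightarrow> prob_space N \<and> gaussian_process N {0..} B \<and> centered_process N {0..} B \<and>
     as_continuous_paths N B \<and>
     (\<forall>s\<ge>0. \<forall>t\<ge>0. covariance N (B s) (B t) = (s powr \<alpha> + t powr \<alpha> - \<bar>t - s\<bar> powr \<alpha>) / 2)"

text \<open>H_\<alpha>(S) = E exp(sup_{t\<in>[0,S]} (sqrt 2 B(t) - t^\<alpha>)), computed with respect to the
  completion of N (the supremum is an event only up to a null set).\<close>
definition pickands_S :: "'b measure \<Rightarrow> (real \<Rightarrow> 'b \<Rightarrow> real) \<Rightarrow> real \<Rightarrow> real \<Rightarrow> real" where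
  "pickands_S N B \<alpha> S =
     (\<integral>\<omega>. exp (Sup ((\<lambda>t. sqrt 2 * B t \<omega> - t powr \<alpha>) ` {0..S})) \<partial>(completion N))"

definition pickands :: "'b measure \<Rightarrow> (real \<Rightarrow> 'b \<Rightarrow> real) \<Rightarrow> real \<Rightarrow> real" where
  "pickands N B \<alpha> = Lim at_top (\<lambda>S. pickands_S N B \<alpha> S / S)"

end

(* The process is observed on grids of mesh a q(u), where q(u) = C^(-1/alpha) u^(-2/alpha).
   Conditionally on X(0) = u + z/u, the rescaled field u (X(q(u) t) - u) converges in distribution to
   z + sqrt 2 B(t) - t^alpha; integrating over z turns P(max over a finite grid > u) / Psi(u) into
   E exp max (sqrt 2 B(t) - t^alpha).  A chaining argument over dyadic points, with levels increasing
   to u, bounds the probability of exceeding u between the grid points by O(a^2) Psi(u) per mesh.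
   Subadditivity then gives the upper bound, and Bonferroni's inequality with P(X(0) > u, X(s) > u)
   <= P(X(0) + X(s) > 2u) the lower bound.  The two bounds together show that H_alpha(S)/S converges
   to its infimum, which is positive.  As P(sup_[0,t] X > u) <= (t + 1) P(sup_[0,1] X > u), dominated
   convergence passes from fixed t to the independent random T. *)
theory Submission
  imports Defs "HOL-Real_Asymp.Real_Asymp"
begin

section \<open>Convergence of characteristic functions and of box probabilities\<close>

text \<open>Beyond its finite-dimensional laws and path continuity, everything about
  \<open>B\<close> is read off \<open>X\<close>: dividing exceedance probabilities of
  \<open>X\<close> by \<open>gauss_tail u\<close> and letting u grow turns the chaining bound into
  an inequality between exponential moments of \<open>Z\<close>. This yields integrability of exp
  sup Z, and later the existence of the Pickands limit, with no separate theory of suprema of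
  \<open>B\<close>. The order of limits shapes the lower bound. The Bonferroni error is summed over
  pairs of grid points, and its bound \<open>overlap_const a\<close> per block blows up as a tends
  to 0. It does not depend on the block length n, however, so at fixed a it is washed out by letting
  n grow, and a is chosen before n. Conversely a wide mesh pushes it below 1, and this is where
  positivity of the constant comes from. The chaining error has to be O(a^2) because an interval of
  length S holds about S/a meshes. The chain must start below u, at u - a^\<beta>/u; this lowering
  costs the factor exp(a^\<beta>), which tends to 1.\<close>

inductive trig_poly :: "(real \<Rightarrow> complex) \<Rightarrow> bool" where
  iexp: "trig_poly (\<lambda>x. iexp (c * x))"
| scale: "trig_poly f \<Longrightarrow> trig_poly (\<lambda>x. a * f x)"
| add: "trig_poly f \<Longrightarrow> trig_poly g \<Longrightarrow> trig_poly (\<lambda>x. f x + g x)"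

lemma trig_poly_mult:
  assumes "trig_poly f" "trig_poly g"
  shows "trig_poly (\<lambda>x. f x * g x)"
  using assms
proof (induction f rule: trig_poly.induct)
  case (iexp c)
  then show ?case
  proof (induction g rule: trig_poly.induct)
    case (iexp d)
    have "trig_poly (\<lambda>x. iexp ((c + d) * x))" by (rule trig_poly.iexp)
    then show ?case by (simp add: exp_add[symmetric] algebra_simps)
  next
    case (scale f a)
    then show ?case using trig_poly.scale[OF scale.IH, of a] by (simp add: algebra_simps)
  next
    case (add f g)
    then show ?case using trig_poly.add[OF add.IH] by (simp add: algebra_simps)
  qed
next
  case (scale f a)
  then show ?case using trig_poly.scale[of "\<lambda>x. f x * g x" a] by (simp add: algebra_simps)
next
  case (add f h)
  then show ?case using trig_poly.add[of "\<lambda>x. f x * g x" "\<lambda>x. h x * g x"] by (simp add: algebra_simps)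
qed

lemma trig_poly_const: "trig_poly (\<lambda>x. a)"
  using trig_poly.scale[OF trig_poly.iexp[of 0], of a] by simp

lemma trig_poly_sin: "trig_poly (\<lambda>x. of_real (sin (b * x)))"
proof -
  have "trig_poly (\<lambda>x. (1 / (2 * \<i>)) * (iexp (b * x) + (- 1) * iexp ((- b) * x)))"
    by (intro trig_poly.intros)
  moreover have "(1 / (2 * \<i>)) * (iexp (b * x) + (- 1) * iexp ((- b) * x)) = of_real (sin (b * x))" for x
    by (simp add: sin_of_real[symmetric] sin_exp_eq field_simps)
  ultimately show ?thesis by (simp only:)
qed

lemma trig_poly_polynomial_sin:
  assumes "real_polynomial_function p"
  shows "trig_poly (\<lambda>x. of_real (p (sin (b * x))))"
  using assms
proof (induction p rule: real_polynomial_function.induct)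
  case (linear f)
  interpret f: bounded_linear f by fact
  have "f y = y * f 1" for y :: real
    using f.scaleR[of y 1] by simp
  then have "(\<lambda>x. complex_of_real (f (sin (b * x)))) = (\<lambda>x. of_real (f 1) * of_real (sin (b * x)))"
    by (metis mult.commute of_real_mult)
  then show ?case using trig_poly.scale[OF trig_poly_sin] by simp
next
  case (const c)
  then show ?case by (rule trig_poly_const)
next
  case (add f g)
  then show ?case using trig_poly.add by fastforce
next
  case (mult f g)
  then show ?case using trig_poly_mult by fastforce
qed

lemma trig_poly_bounded: "trig_poly f \<Longrightarrow> \<exists>K. \<forall>x. norm (f x) \<le> K"
proof (induction rule: trig_poly.induct)
  case (iexp c)
  then show ?case by (intro exI[of _ 1]) simp
next
  case (scale f a)
  then obtain K where "\<forall>x. norm (f x) \<le> K" by blast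
  then show ?case by (intro exI[of _ "norm a * K"]) (simp add: norm_mult mult_left_mono)
next
  case (add f g)
  then obtain K K' where "\<forall>x. norm (f x) \<le> K" "\<forall>x. norm (g x) \<le> K'" by blast
  then show ?case by (intro exI[of _ "K + K'"]) (meson add_mono norm_triangle_le)
qed

lemma trig_poly_measurable [measurable]: "trig_poly f \<Longrightarrow> f \<in> borel_measurable borel"
proof (induction rule: trig_poly.induct)
  case (iexp c)
  then show ?case by measurable
next
  case (scale f a)
  note scale.IH [measurable]
  show ?case by measurable
next
  case (add f g)
  note add.IH [measurable]
  show ?case by measurable
qed

text \<open>Composing with \<open>arcsin \<circ> sin\<close> makes the function periodic without changing it on
  \<open>[-L, L]\<close>, so that plain polynomial approximation on \<open>[-1, 1]\<close> applies.\<close>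
lemma trig_poly_approx:
  fixes g :: "real \<Rightarrow> real"
  assumes g: "continuous_on UNIV g" "\<And>x. \<bar>g x\<bar> \<le> 1" and "L > 0" "e > 0"
  obtains p where "trig_poly p" "\<And>x. \<bar>x\<bar> \<le> L \<Longrightarrow> norm (of_real (g x) - p x) \<le> e"
    "\<And>x. norm (p x) \<le> 1 + e"
proof -
  let ?h = "\<lambda>y. g (2 * L / pi * arcsin y)"
  have "continuous_on {-1..1} ?h"
    by (intro continuous_on_compose2[OF g(1)] continuous_intros) auto
  then obtain P where P: "real_polynomial_function P" "\<And>y. y \<in> {-1..1} \<Longrightarrow> \<bar>?h y - P y\<bar> < e"
    using Stone_Weierstrass_real_polynomial_function[of "{-1..1}" ?h e] \<open>e > 0\<close> by auto
  let ?b = "pi / (2 * L)"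
  let ?p = "\<lambda>x. complex_of_real (P (sin (?b * x)))"
  show thesis
  proof
    show "trig_poly ?p" by (rule trig_poly_polynomial_sin[OF P(1)])
    fix x :: real
    have in11: "sin (?b * x) \<in> {-1..1}" by simp
    show "norm (?p x) \<le> 1 + e"
      using P(2)[OF in11] g(2)[of "2 * L / pi * arcsin (sin (?b * x))"] by simp
    assume "\<bar>x\<bar> \<le> L"
    then have "\<bar>?b * x\<bar> \<le> pi / 2"
      using \<open>L > 0\<close> by (simp add: abs_mult field_simps)
    then have "arcsin (sin (?b * x)) = ?b * x"
      by (intro arcsin_sin) (auto simp only: abs_le_iff)
    then have "?h (sin (?b * x)) = g x" using \<open>L > 0\<close> by simp
    then have "\<bar>g x - P (sin (?b * x))\<bar> < e" using P(2)[OF in11] by simp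
    then show "norm (of_real (g x) - ?p x) \<le> e"
      by (metis less_imp_le norm_of_real of_real_diff)
  qed
qed

text \<open>On \<open>[-L, L]\<close> a trigonometric polynomial is close to \<open>g\<close>;
  elsewhere it is merely bounded, and the uniform second moment makes that region cost O(K / L^2).
  The weights \<open>W u\<close> are carried along so that the lemma can treat one coordinate of a
  random vector at a time.\<close>

lemma expectation_tendsto_weighted:
  fixes W :: "'u \<Rightarrow> 'a \<Rightarrow> complex" and V :: "'u \<Rightarrow> 'a \<Rightarrow> real"
    and W' :: "'b \<Rightarrow> complex" and V' :: "'b \<Rightarrow> real" and g :: "real \<Rightarrow> real"
  assumes "prob_space M" "prob_space N"
    and W [measurable]: "\<And>u. W u \<in> borel_measurable M" "\<And>u \<omega>. norm (W u \<omega>) \<le> 1"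
    and W' [measurable]: "W' \<in> borel_measurable N" "\<And>\<omega>. norm (W' \<omega>) \<le> 1"
    and V [measurable]: "\<And>u. V u \<in> borel_measurable M" and V' [measurable]: "V' \<in> borel_measurable N"
    and conv: "\<And>c. ((\<lambda>u. \<integral>\<omega>. W u \<omega> * iexp (c * V u \<omega>) \<partial>M) \<longlongrightarrow> (\<integral>\<omega>. W' \<omega> * iexp (c * V' \<omega>) \<partial>N)) F"
    and int: "\<forall>\<^sub>F u in F. integrable M (\<lambda>\<omega>. (V u \<omega>)\<^sup>2) \<and> (\<integral>\<omega>. (V u \<omega>)\<^sup>2 \<partial>M) \<le> K"
    and int': "integrable N (\<lambda>\<omega>. (V' \<omega>)\<^sup>2)" "(\<integral>\<omega>. (V' \<omega>)\<^sup>2 \<partial>N) \<le> K"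
    and g: "continuous_on UNIV g" "\<And>x. \<bar>g x\<bar> \<le> 1"
  shows "((\<lambda>u. \<integral>\<omega>. W u \<omega> * g (V u \<omega>) \<partial>M) \<longlongrightarrow> (\<integral>\<omega>. W' \<omega> * g (V' \<omega>) \<partial>N)) F"
proof -
  interpret M: prob_space M by fact
  interpret N: prob_space N by fact
  have [measurable]: "g \<in> borel_measurable borel"
    using g(1) by (rule borel_measurable_continuous_onI)
  have trig: "((\<lambda>u. \<integral>\<omega>. W u \<omega> * p (V u \<omega>) \<partial>M) \<longlongrightarrow> (\<integral>\<omega>. W' \<omega> * p (V' \<omega>) \<partial>N)) F"
    if "trig_poly p" for p :: "real \<Rightarrow> complex"
    using that
  proof (induction rule: trig_poly.induct)
    case (iexp c)
    then show ?case by (rule conv)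
  next
    case (scale f a)
    then have "((\<lambda>u. a * (\<integral>\<omega>. W u \<omega> * f (V u \<omega>) \<partial>M)) \<longlongrightarrow> a * (\<integral>\<omega>. W' \<omega> * f (V' \<omega>) \<partial>N)) F"
      by (intro tendsto_intros)
    moreover have "a * (\<integral>\<omega>. W u \<omega> * f (V u \<omega>) \<partial>M) = (\<integral>\<omega>. W u \<omega> * (a * f (V u \<omega>)) \<partial>M)" for u
      by (subst integral_mult_right_zero[symmetric]) (simp add: mult_ac)
    moreover have "a * (\<integral>\<omega>. W' \<omega> * f (V' \<omega>) \<partial>N) = (\<integral>\<omega>. W' \<omega> * (a * f (V' \<omega>)) \<partial>N)"
      by (subst integral_mult_right_zero[symmetric]) (simp add: mult_ac)
    ultimately show ?case by simp
  next
    case (add f h)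
    have [measurable]: "f \<in> borel_measurable borel" "h \<in> borel_measurable borel"
      using add.hyps by auto
    obtain Kf Kh where K: "\<And>x. norm (f x) \<le> Kf" "\<And>x. norm (h x) \<le> Kh"
      using trig_poly_bounded add.hyps by meson
    have b: "norm (w * f x) \<le> Kf" "norm (w * h x) \<le> Kh" if "norm w \<le> 1" for w x
      using mult_mono[OF that K(1)[of x]] mult_mono[OF that K(2)[of x]] by (auto simp: norm_mult)
    have i: "integrable M (\<lambda>\<omega>. W u \<omega> * f (V u \<omega>))" "integrable M (\<lambda>\<omega>. W u \<omega> * h (V u \<omega>))" for u
      by (rule M.integrable_const_bound[where B=Kf] M.integrable_const_bound[where B=Kh];
          use b W(2) in auto)+
    have i': "integrable N (\<lambda>\<omega>. W' \<omega> * f (V' \<omega>))" "integrable N (\<lambda>\<omega>. W' \<omega> * h (V' \<omega>))"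
      by (rule N.integrable_const_bound[where B=Kf] N.integrable_const_bound[where B=Kh];
          use b W'(2) in auto)+
    show ?case
      using tendsto_add[OF add.IH] i i' by (simp add: ring_distribs)
  qed
  have bound: "norm ((\<integral>\<omega>. w \<omega> * g (v \<omega>) \<partial>Q) - (\<integral>\<omega>. w \<omega> * p (v \<omega>) \<partial>Q)) \<le> e + 2 * K / L\<^sup>2"
    if Q: "prob_space Q" and [measurable]: "w \<in> borel_measurable Q" "v \<in> borel_measurable Q"
      and w: "\<And>\<omega>. norm (w \<omega>) \<le> 1"
      and v: "integrable Q (\<lambda>\<omega>. (v \<omega>)\<^sup>2)" "(\<integral>\<omega>. (v \<omega>)\<^sup>2 \<partial>Q) \<le> K"
      and p: "trig_poly p" "\<And>x. \<bar>x\<bar> \<le> L \<Longrightarrow> norm (of_real (g x) - p x) \<le> e" "\<And>x. norm (p x) \<le> 1 + e"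
      and e: "0 < e" "e < 1/2" "L > 0" 
    for Q :: "'c measure" and v and p :: "real \<Rightarrow> complex" and e L and w :: "'c \<Rightarrow> complex"
  proof -
    interpret Q: prob_space Q by fact
    have [measurable]: "p \<in> borel_measurable borel" using p(1) by auto
    \<comment> \<open>Outside \<open>[-L, L]\<close> the crude bound 2 + e is at most e + 2 x^2 /
      L^2, so a single estimate can be integrated against the second moment.\<close>
    have *: "norm (of_real (g x) - p x) \<le> e + 2 * x\<^sup>2 / L\<^sup>2" for x
    proof (cases "\<bar>x\<bar> \<le> L")
      case True
      then show ?thesis using p(2)[of x] e by (smt (verit) divide_nonneg_nonneg zero_le_power2)
    next
      case False
      then have "L\<^sup>2 \<le> x\<^sup>2" using e by (simp add: abs_le_square_iff[symmetric])
      then have "x\<^sup>2 / L\<^sup>2 \<ge> 1" using e by simp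
      moreover have "norm (of_real (g x) - p x) \<le> 1 + (1 + e)"
        using g(2)[of x] p(3)[of x] norm_triangle_ineq4[of "of_real (g x)" "p x"] by simp
      ultimately show ?thesis using e by (simp only: times_divide_eq_right[symmetric])
    qed
    have w1: "norm (w \<omega> * g (v \<omega>)) \<le> 1" for \<omega>
      using mult_mono[OF w[of \<omega>] g(2)[of "v \<omega>"]] by (simp add: norm_mult)
    have w2: "norm (w \<omega> * p (v \<omega>)) \<le> 1 + e" for \<omega>
      using mult_mono[OF w[of \<omega>] p(3)[of "v \<omega>"]] by (simp add: norm_mult)
    have i1: "integrable Q (\<lambda>\<omega>. w \<omega> * g (v \<omega>))"
      by (rule Q.integrable_const_bound[where B=1]) (use w1 in auto)
    have i2: "integrable Q (\<lambda>\<omega>. w \<omega> * p (v \<omega>))"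
      by (rule Q.integrable_const_bound[where B="1 + e"]) (use w2 in auto)
    have "norm ((\<integral>\<omega>. w \<omega> * g (v \<omega>) \<partial>Q) - (\<integral>\<omega>. w \<omega> * p (v \<omega>) \<partial>Q))
        = norm (\<integral>\<omega>. w \<omega> * g (v \<omega>) - w \<omega> * p (v \<omega>) \<partial>Q)"
      using i1 i2 by simp
    also have "\<dots> \<le> (\<integral>\<omega>. e + 2 * (v \<omega>)\<^sup>2 / L\<^sup>2 \<partial>Q)"
    proof (rule order_trans[OF integral_norm_bound integral_mono])
      show "integrable Q (\<lambda>\<omega>. norm (w \<omega> * g (v \<omega>) - w \<omega> * p (v \<omega>)))" using i1 i2 by auto
      show "integrable Q (\<lambda>\<omega>. e + 2 * (v \<omega>)\<^sup>2 / L\<^sup>2)" using v by auto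
      fix \<omega>
      have "norm (w \<omega> * g (v \<omega>) - w \<omega> * p (v \<omega>)) = norm (w \<omega>) * norm (of_real (g (v \<omega>)) - p (v \<omega>))"
        by (simp add: norm_mult[symmetric] algebra_simps)
      also have "\<dots> \<le> 1 * (e + 2 * (v \<omega>)\<^sup>2 / L\<^sup>2)"
        by (intro mult_mono w *) auto
      finally show "norm (w \<omega> * g (v \<omega>) - w \<omega> * p (v \<omega>)) \<le> e + 2 * (v \<omega>)\<^sup>2 / L\<^sup>2" by simp
    qed
    also have "\<dots> = e + 2 * (\<integral>\<omega>. (v \<omega>)\<^sup>2 \<partial>Q) / L\<^sup>2"
      using v by (simp add: Q.prob_space)
    also have "\<dots> \<le> e + 2 * K / L\<^sup>2" using v(2) e by (simp add: divide_right_mono)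
    finally show ?thesis .
  qed
  have "0 \<le> (\<integral>\<omega>. (V' \<omega>)\<^sup>2 \<partial>N)" by (rule Bochner_Integration.integral_nonneg) simp
  then have K: "K \<ge> 0" using int'(2) by linarith
  show ?thesis
  proof (rule tendstoI)
    fix \<epsilon> :: real assume "\<epsilon> > 0"
    \<comment> \<open>The final triangle inequality spends 2 e + e + 2 e, less than 8 e.\<close>
    define e where "e = min (1/4) (\<epsilon> / 8)"
    have e: "e > 0" "e < 1/2" "8 * e \<le> \<epsilon>" using \<open>\<epsilon> > 0\<close> by (auto simp: e_def)
    \<comment> \<open>Makes 2 K / L^2 \<le> e; the summand 1 keeps L positive when K = 0.\<close>
    define L where "L = sqrt (2 * K / e + 1)"
    have L2: "L\<^sup>2 = 2 * K / e + 1" unfolding L_def using K e by simp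
    have L: "L > 0" unfolding L_def using K e by (simp add: add_nonneg_pos)
    have "2 * K \<le> e * L\<^sup>2" unfolding L2 using e by (simp add: field_simps)
    then have Ke: "2 * K / L\<^sup>2 \<le> e" using L by (simp add: divide_le_eq)
    obtain p where p: "trig_poly p" "\<And>x. \<bar>x\<bar> \<le> L \<Longrightarrow> norm (of_real (g x) - p x) \<le> e"
      "\<And>x. norm (p x) \<le> 1 + e"
      using trig_poly_approx[OF g L e(1)] by blast
    have "\<forall>\<^sub>F u in F. dist (\<integral>\<omega>. W u \<omega> * p (V u \<omega>) \<partial>M) (\<integral>\<omega>. W' \<omega> * p (V' \<omega>) \<partial>N) < e"
      using tendstoD[OF trig[OF p(1)] e(1)] .
    then show "\<forall>\<^sub>F u in F. dist (\<integral>\<omega>. W u \<omega> * g (V u \<omega>) \<partial>M) (\<integral>\<omega>. W' \<omega> * g (V' \<omega>) \<partial>N) < \<epsilon>"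
      using int
    proof eventually_elim
      case (elim u)
      have "norm ((\<integral>\<omega>. W u \<omega> * g (V u \<omega>) \<partial>M) - (\<integral>\<omega>. W u \<omega> * p (V u \<omega>) \<partial>M)) \<le> e + 2 * K / L\<^sup>2"
        by (rule bound) (use elim p e L W assms(1) in auto)
      moreover have "norm ((\<integral>\<omega>. W' \<omega> * g (V' \<omega>) \<partial>N) - (\<integral>\<omega>. W' \<omega> * p (V' \<omega>) \<partial>N)) \<le> e + 2 * K / L\<^sup>2"
        by (rule bound) (use int' p e L W' assms(2) in auto)
      ultimately have "dist (\<integral>\<omega>. W u \<omega> * g (V u \<omega>) \<partial>M) (\<integral>\<omega>. W u \<omega> * p (V u \<omega>) \<partial>M) \<le> 2 * e"
        "dist (\<integral>\<omega>. W' \<omega> * g (V' \<omega>) \<partial>N) (\<integral>\<omega>. W' \<omega> * p (V' \<omega>) \<partial>N) \<le> 2 * e"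
        using Ke by (simp_all add: dist_norm)
      then show ?case using elim(1) e
        by (smt (verit) dist_commute dist_triangle)
    qed
  qed
qed


text \<open>Coordinates are converted one by one: the factors \<open>g i\<close> already obtained
  and the exponentials still present together form a weight bounded by 1. Approximation thus stays
  one-dimensional.\<close>

lemma expectation_prod_tendsto:
  fixes V :: "'u \<Rightarrow> nat \<Rightarrow> 'a \<Rightarrow> real" and Z :: "nat \<Rightarrow> 'b \<Rightarrow> real" and g :: "nat \<Rightarrow> real \<Rightarrow> real"
  assumes "prob_space M" "prob_space N"
    and V [measurable]: "\<And>u i. V u i \<in> borel_measurable M"
    and Z [measurable]: "\<And>i. Z i \<in> borel_measurable N"
    and conv: "\<And>c. ((\<lambda>u. \<integral>\<omega>. iexp (\<Sum>j<n. c j * V u j \<omega>) \<partial>M) \<longlongrightarrow> (\<integral>\<omega>. iexp (\<Sum>j<n. c j * Z j \<omega>) \<partial>N)) F"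
    and int: "\<And>i. i < n \<Longrightarrow> \<forall>\<^sub>F u in F. integrable M (\<lambda>\<omega>. (V u i \<omega>)\<^sup>2) \<and> (\<integral>\<omega>. (V u i \<omega>)\<^sup>2 \<partial>M) \<le> K i"
    and int': "\<And>i. i < n \<Longrightarrow> integrable N (\<lambda>\<omega>. (Z i \<omega>)\<^sup>2)" "\<And>i. i < n \<Longrightarrow> (\<integral>\<omega>. (Z i \<omega>)\<^sup>2 \<partial>N) \<le> K i"
    and g: "\<And>i. continuous_on UNIV (g i)" "\<And>i x. \<bar>g i x\<bar> \<le> 1"
  shows "((\<lambda>u. \<integral>\<omega>. (\<Prod>i<n. g i (V u i \<omega>)) \<partial>M) \<longlongrightarrow> (\<integral>\<omega>. (\<Prod>i<n. g i (Z i \<omega>)) \<partial>N)) F"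
proof -
  have [measurable]: "g i \<in> borel_measurable borel" for i
    using g(1) by (rule borel_measurable_continuous_onI)
  have gp: "\<bar>\<Prod>i<k. g i (x i)\<bar> \<le> 1" for k x
    unfolding abs_prod by (rule prod_le_1) (use g(2) in auto)
  \<comment> \<open>All n exponentials stay, with arbitrary c, because the induction step absorbs
    the frequency d at coordinate k into \<open>c k\<close>. The claim is recovered at k = n with c
    = 0.\<close>
  have "((\<lambda>u. \<integral>\<omega>. of_real (\<Prod>i<k. g i (V u i \<omega>)) * iexp (\<Sum>j<n. c j * V u j \<omega>) \<partial>M)
      \<longlongrightarrow> (\<integral>\<omega>. of_real (\<Prod>i<k. g i (Z i \<omega>)) * iexp (\<Sum>j<n. c j * Z j \<omega>) \<partial>N)) F"
    if "k \<le> n" for k c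
    using that
  proof (induction k arbitrary: c)
    case 0
    then show ?case using conv by simp
  next
    case (Suc k)
    then have kn: "k < n" by simp
    let ?W = "\<lambda>u \<omega>. of_real (\<Prod>i<k. g i (V u i \<omega>)) * iexp (\<Sum>j<n. c j * V u j \<omega>)"
    let ?W' = "\<lambda>\<omega>. of_real (\<Prod>i<k. g i (Z i \<omega>)) * iexp (\<Sum>j<n. c j * Z j \<omega>)"
    have shift: "iexp (\<Sum>j<n. c j * x j) * iexp (d * x k) = iexp (\<Sum>j<n. (c(k := c k + d)) j * x j)"
      for x :: "nat \<Rightarrow> real" and d
    proof -
      have "(\<Sum>j<n. (c(k := c k + d)) j * x j) = (\<Sum>j<n. c j * x j + (if j = k then d * x j else 0))"
        by (intro sum.cong) (auto simp: algebra_simps)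
      also have "\<dots> = (\<Sum>j<n. c j * x j) + d * x k"
        using kn by (simp add: sum.distrib)
      finally show ?thesis by (simp add: exp_add[symmetric] algebra_simps)
    qed
    have W: "?W u \<omega> * iexp (d * V u k \<omega>) = of_real (\<Prod>i<k. g i (V u i \<omega>)) * iexp (\<Sum>j<n. (c(k := c k + d)) j * V u j \<omega>)"
      for u \<omega> d
      unfolding mult.assoc using shift[of "\<lambda>j. V u j \<omega>" d] by (simp only:)
    have W': "?W' \<omega> * iexp (d * Z k \<omega>) = of_real (\<Prod>i<k. g i (Z i \<omega>)) * iexp (\<Sum>j<n. (c(k := c k + d)) j * Z j \<omega>)"
      for \<omega> d
      unfolding mult.assoc using shift[of "\<lambda>j. Z j \<omega>" d] by (simp only:)
    have "((\<lambda>u. \<integral>\<omega>. ?W u \<omega> * g k (V u k \<omega>) \<partial>M) \<longlongrightarrow> (\<integral>\<omega>. ?W' \<omega> * g k (Z k \<omega>) \<partial>N)) F"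
    proof (rule expectation_tendsto_weighted[OF assms(1,2), where W="?W" and W'="?W'"
          and V="\<lambda>u. V u k" and V'="Z k" and g="g k" and K="K k"])
      show "norm (?W u \<omega>) \<le> 1" for u \<omega>
        using gp by (simp only: norm_mult norm_of_real norm_exp_i_times mult_1_right)
      show "norm (?W' \<omega>) \<le> 1" for \<omega>
        using gp by (simp only: norm_mult norm_of_real norm_exp_i_times mult_1_right)
      show "((\<lambda>u. \<integral>\<omega>. ?W u \<omega> * iexp (d * V u k \<omega>) \<partial>M) \<longlongrightarrow> (\<integral>\<omega>. ?W' \<omega> * iexp (d * Z k \<omega>) \<partial>N)) F" for d
        unfolding W W' using Suc.IH[of "c(k := c k + d)"] kn by simp
      show "\<forall>\<^sub>F u in F. integrable M (\<lambda>\<omega>. (V u k \<omega>)\<^sup>2) \<and> (\<integral>\<omega>. (V u k \<omega>)\<^sup>2 \<partial>M) \<le> K k"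
        by (rule int[OF kn])
    qed (use int'[OF kn] g in auto)
    then show ?case by (simp add: mult_ac)
  qed
  from this[of n "\<lambda>_. 0"] show ?thesis
    by (simp del: of_real_prod add: tendsto_of_real_iff)
qed

section \<open>Continuous approximation of boxes\<close>

definition ramp :: "real \<Rightarrow> real \<Rightarrow> real \<Rightarrow> real" where
  "ramp e w x = max 0 (min 1 ((w + e - x) / e))"

lemma ramp_bounds: "0 \<le> ramp e w x" "ramp e w x \<le> 1" "\<bar>ramp e w x\<bar> \<le> 1"
  by (auto simp: ramp_def)

lemma continuous_on_ramp: "continuous_on UNIV (ramp e w)"
  unfolding ramp_def divide_inverse by (intro continuous_intros)

lemma ramp_measurable [measurable]: "ramp e w \<in> borel_measurable borel"
  by (rule borel_measurable_continuous_onI[OF continuous_on_ramp])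

lemma ramp_eq_1: "e > 0 \<Longrightarrow> x \<le> w \<Longrightarrow> ramp e w x = 1"
  by (auto simp: ramp_def field_simps)

lemma ramp_eq_0: "e > 0 \<Longrightarrow> x \<ge> w + e \<Longrightarrow> ramp e w x = 0"
  by (auto simp: ramp_def field_simps)

lemma prod_indicator_eq:
  "(\<Prod>i<n. if P i then 1 else (0::real)) = (if \<forall>i<(n::nat). P i then 1 else 0)"
  by (induction n) (auto simp: less_Suc_eq)

text \<open>Ramps decrease to the indicator of a closed half-line; shifted left by their width they
  approach that of the open half-line from below. These are the two sides of the sandwich in
  \<open>prob_box_tendsto\<close>.\<close>

lemma (in prob_space) expectation_prod_ramp_tendsto:
  fixes V :: "nat \<Rightarrow> 'a \<Rightarrow> real"
  assumes [measurable]: "\<And>i. V i \<in> borel_measurable M"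
  shows "(\<lambda>k. expectation (\<lambda>\<omega>. \<Prod>i<n. ramp (1 / Suc k) (w i) (V i \<omega>))) \<longlonglongrightarrow> prob {\<omega> \<in> space M. \<forall>i<n. V i \<omega> \<le> w i}"
    and "(\<lambda>k. expectation (\<lambda>\<omega>. \<Prod>i<n. ramp (1 / Suc k) (w i - 1 / Suc k) (V i \<omega>))) \<longlonglongrightarrow> prob {\<omega> \<in> space M. \<forall>i<n. V i \<omega> < w i}"
proof -
  have *: "(\<lambda>k. expectation (f k)) \<longlonglongrightarrow> prob {\<omega> \<in> space M. \<forall>i<n. Q i (V i \<omega>)}"
    if f: "f = (\<lambda>k \<omega>. \<Prod>i<n. ramp (1 / Suc k) (w' k i) (V i \<omega>))"
      and lim: "\<And>i x. (\<lambda>k. ramp (1 / Suc k) (w' k i) x) \<longlonglongrightarrow> (if Q i x then 1 else 0)"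
      and [measurable]: "\<And>i. Measurable.pred borel (Q i)"
    for f :: "nat \<Rightarrow> 'a \<Rightarrow> real" and Q :: "nat \<Rightarrow> real \<Rightarrow> bool" and w' :: "nat \<Rightarrow> nat \<Rightarrow> real"
  proof -
    let ?A = "{\<omega> \<in> space M. \<forall>i<n. Q i (V i \<omega>)}"
    have "(\<lambda>k. expectation (f k)) \<longlonglongrightarrow> expectation (indicator ?A)"
    proof (rule integral_dominated_convergence[where w="\<lambda>_. 1"])
      show "indicator ?A \<in> borel_measurable M" by measurable
      show "f k \<in> borel_measurable M" for k unfolding f by measurable
      show "AE \<omega> in M. norm (f k \<omega>) \<le> 1" for k
        unfolding f by (intro AE_I2) (auto simp: abs_prod ramp_bounds intro!: prod_le_1)
      show "AE \<omega> in M. (\<lambda>k. f k \<omega>) \<longlonglongrightarrow> indicator ?A \<omega>"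
      proof (intro AE_I2)
        fix \<omega> assume \<omega>: "\<omega> \<in> space M"
        have "(\<lambda>k. f k \<omega>) \<longlonglongrightarrow> (\<Prod>i<n. if Q i (V i \<omega>) then 1 else 0)"
          unfolding f by (intro tendsto_prod lim)
        also have "(\<Prod>i<n. if Q i (V i \<omega>) then 1 else (0::real)) = indicator ?A \<omega>"
          using \<omega> by (simp add: prod_indicator_eq)
        finally show "(\<lambda>k. f k \<omega>) \<longlonglongrightarrow> indicator ?A \<omega>" .
      qed
    qed simp
    then show ?thesis by simp
  qed
  have small: "\<forall>\<^sub>F k in sequentially. 1 / real (Suc k) < d" if "d > 0" for d
    using order_tendstoD(2)[OF LIMSEQ_inverse_real_of_nat that] by (simp add: inverse_eq_divide)
  show "(\<lambda>k. expectation (\<lambda>\<omega>. \<Prod>i<n. ramp (1 / Suc k) (w i) (V i \<omega>))) \<longlonglongrightarrow> prob {\<omega> \<in> space M. \<forall>i<n. V i \<omega> \<le> w i}"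
  proof (rule *[OF refl])
    fix i x
    show "(\<lambda>k. ramp (1 / Suc k) (w i) x) \<longlonglongrightarrow> (if x \<le> w i then 1 else 0)"
    proof (cases "x \<le> w i")
      case True
      then show ?thesis by (simp add: ramp_eq_1)
    next
      case False
      then have "\<forall>\<^sub>F k in sequentially. ramp (1 / Suc k) (w i) x = 0"
        using small[of "x - w i"] by (auto elim!: eventually_mono intro!: ramp_eq_0)
      then show ?thesis using False by (simp add: tendsto_eventually)
    qed
  qed measurable
  show "(\<lambda>k. expectation (\<lambda>\<omega>. \<Prod>i<n. ramp (1 / Suc k) (w i - 1 / Suc k) (V i \<omega>))) \<longlonglongrightarrow> prob {\<omega> \<in> space M. \<forall>i<n. V i \<omega> < w i}"
  proof (rule *[OF refl])
    fix i x
    show "(\<lambda>k. ramp (1 / Suc k) (w i - 1 / Suc k) x) \<longlonglongrightarrow> (if x < w i then 1 else 0)"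
    proof (cases "x < w i")
      case True
      then have "\<forall>\<^sub>F k in sequentially. ramp (1 / Suc k) (w i - 1 / Suc k) x = 1"
        using small[of "w i - x"] by (auto elim!: eventually_mono intro!: ramp_eq_1)
      then show ?thesis using True by (simp add: tendsto_eventually)
    next
      case False
      then show ?thesis by (simp add: ramp_eq_0)
    qed
  qed measurable
qed

text \<open>Uniqueness is the convergence theorem applied to a constant family; afterwards the ramps
  shrink to the box on both sides.\<close>

lemma prob_box_eq_of_char_eq:
  fixes V :: "nat \<Rightarrow> 'a \<Rightarrow> real" and Z :: "nat \<Rightarrow> 'b \<Rightarrow> real"
  assumes "prob_space M" "prob_space N"
    and [measurable]: "\<And>i. V i \<in> borel_measurable M" "\<And>i. Z i \<in> borel_measurable N"
    and char: "\<And>c. (\<integral>\<omega>. iexp (\<Sum>j<n. c j * V j \<omega>) \<partial>M) = (\<integral>\<omega>. iexp (\<Sum>j<n. c j * Z j \<omega>) \<partial>N)"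
    and int: "\<And>i. i < n \<Longrightarrow> integrable M (\<lambda>\<omega>. (V i \<omega>)\<^sup>2)" "\<And>i. i < n \<Longrightarrow> integrable N (\<lambda>\<omega>. (Z i \<omega>)\<^sup>2)"
  shows "measure M {\<omega> \<in> space M. \<forall>i<n. V i \<omega> \<le> w i} = measure N {\<omega> \<in> space N. \<forall>i<n. Z i \<omega> \<le> w i}"
proof -
  interpret M: prob_space M by fact
  interpret N: prob_space N by fact
  have "((\<lambda>u::nat. \<integral>\<omega>. (\<Prod>i<n. ramp (1 / Suc k) (w i) (V i \<omega>)) \<partial>M) \<longlonglongrightarrow> (\<integral>\<omega>. (\<Prod>i<n. ramp (1 / Suc k) (w i) (Z i \<omega>)) \<partial>N))" for k
    by (rule expectation_prod_tendsto[where K="\<lambda>i. max (\<integral>\<omega>. (V i \<omega>)\<^sup>2 \<partial>M) (\<integral>\<omega>. (Z i \<omega>)\<^sup>2 \<partial>N)"])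
      (use assms in \<open>auto intro: continuous_on_ramp ramp_bounds\<close>)
  then have eq: "(\<integral>\<omega>. (\<Prod>i<n. ramp (1 / Suc k) (w i) (V i \<omega>)) \<partial>M) = (\<integral>\<omega>. (\<Prod>i<n. ramp (1 / Suc k) (w i) (Z i \<omega>)) \<partial>N)" for k
    by (simp add: LIMSEQ_const_iff)
  show ?thesis
    using M.expectation_prod_ramp_tendsto(1)[where V=V and n=n and w=w] N.expectation_prod_ramp_tendsto(1)[where V=Z and n=n and w=w]
    unfolding eq by (intro LIMSEQ_unique) auto
qed

text \<open>In the limit the ramps from above and from below differ only by the boundary of the box,
  which \<open>null\<close> makes negligible.\<close>

lemma prob_box_tendsto:
  fixes V :: "'u \<Rightarrow> nat \<Rightarrow> 'a \<Rightarrow> real" and Z :: "nat \<Rightarrow> 'b \<Rightarrow> real"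
  assumes "prob_space M" "prob_space N"
    and [measurable]: "\<And>u i. V u i \<in> borel_measurable M" "\<And>i. Z i \<in> borel_measurable N"
    and conv: "\<And>c. ((\<lambda>u. \<integral>\<omega>. iexp (\<Sum>j<n. c j * V u j \<omega>) \<partial>M) \<longlongrightarrow> (\<integral>\<omega>. iexp (\<Sum>j<n. c j * Z j \<omega>) \<partial>N)) F"
    and int: "\<And>i. i < n \<Longrightarrow> \<forall>\<^sub>F u in F. integrable M (\<lambda>\<omega>. (V u i \<omega>)\<^sup>2) \<and> (\<integral>\<omega>. (V u i \<omega>)\<^sup>2 \<partial>M) \<le> K i"
    and int': "\<And>i. i < n \<Longrightarrow> integrable N (\<lambda>\<omega>. (Z i \<omega>)\<^sup>2)" "\<And>i. i < n \<Longrightarrow> (\<integral>\<omega>. (Z i \<omega>)\<^sup>2 \<partial>N) \<le> K i"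
    and null: "\<And>i. i < n \<Longrightarrow> AE \<omega> in N. Z i \<omega> \<noteq> w i"
  shows "((\<lambda>u. measure M {\<omega> \<in> space M. \<forall>i<n. V u i \<omega> \<le> w i}) \<longlongrightarrow> measure N {\<omega> \<in> space N. \<forall>i<n. Z i \<omega> \<le> w i}) F"
proof -
  interpret M: prob_space M by fact
  interpret N: prob_space N by fact
  let ?p = "measure N {\<omega> \<in> space N. \<forall>i<n. Z i \<omega> \<le> w i}"
  have E: "((\<lambda>u. \<integral>\<omega>. (\<Prod>i<n. ramp e (w' i) (V u i \<omega>)) \<partial>M) \<longlongrightarrow> (\<integral>\<omega>. (\<Prod>i<n. ramp e (w' i) (Z i \<omega>)) \<partial>N)) F" for e w'
    by (rule expectation_prod_tendsto[OF assms(1-4) conv int int'])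
       (auto intro: continuous_on_ramp ramp_bounds)
  have ind: "measure M {\<omega> \<in> space M. \<forall>i<n. V u i \<omega> \<le> w i} = (\<integral>\<omega>. (\<Prod>i<n. if V u i \<omega> \<le> w i then 1 else 0) \<partial>M)" for u
  proof -
    have "measure M {\<omega> \<in> space M. \<forall>i<n. V u i \<omega> \<le> w i} = (\<integral>\<omega>. indicator {\<omega> \<in> space M. \<forall>i<n. V u i \<omega> \<le> w i} \<omega> \<partial>M)"
      by simp
    also have "\<dots> = (\<integral>\<omega>. (\<Prod>i<n. if V u i \<omega> \<le> w i then 1 else 0) \<partial>M)"
      by (intro Bochner_Integration.integral_cong refl) (simp add: prod_indicator_eq)
    finally show ?thesis .
  qed
  have i1: "integrable M (\<lambda>\<omega>. \<Prod>i<n. ramp e (w' i) (V u i \<omega>))" for e w' u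
    by (rule M.integrable_const_bound[where B=1]) (auto simp: abs_prod ramp_bounds intro!: prod_le_1)
  have i2: "integrable M (\<lambda>\<omega>. \<Prod>i<n. if V u i \<omega> \<le> w i then 1 else (0::real))" for u
    by (rule M.integrable_const_bound[where B=1]) (auto simp: abs_prod intro!: prod_le_1)
  have up: "measure M {\<omega> \<in> space M. \<forall>i<n. V u i \<omega> \<le> w i} \<le> (\<integral>\<omega>. (\<Prod>i<n. ramp e (w i) (V u i \<omega>)) \<partial>M)" if "e > 0" for u e
    unfolding ind by (intro integral_mono i1 i2 prod_mono) (use that in \<open>auto simp: ramp_bounds ramp_eq_1\<close>)
  have lo: "(\<integral>\<omega>. (\<Prod>i<n. ramp e (w i - e) (V u i \<omega>)) \<partial>M) \<le> measure M {\<omega> \<in> space M. \<forall>i<n. V u i \<omega> \<le> w i}" if "e > 0" for u e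
    unfolding ind by (intro integral_mono i1 i2 prod_mono) (use that in \<open>auto simp: ramp_bounds ramp_eq_0\<close>)
  have "AE \<omega> in N. \<forall>i\<in>{..<n}. Z i \<omega> \<noteq> w i"
    by (rule AE_finite_allI) (use null in auto)
  then have "AE \<omega> in N. (\<forall>i<n. Z i \<omega> < w i) \<longleftrightarrow> (\<forall>i<n. Z i \<omega> \<le> w i)"
    by eventually_elim (auto simp: less_le)
  then have lt: "measure N {\<omega> \<in> space N. \<forall>i<n. Z i \<omega> < w i} = ?p"
    by (intro N.prob_eq_AE) auto
  note lims = N.expectation_prod_ramp_tendsto[where V=Z and n=n and w=w, unfolded lt]
  show ?thesis
  proof (rule order_tendstoI)
    fix a assume "a < ?p"
    then obtain k where k: "a < (\<integral>\<omega>. (\<Prod>i<n. ramp (1 / Suc k) (w i - 1 / Suc k) (Z i \<omega>)) \<partial>N)"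
      using order_tendstoD(1)[OF lims(2)] eventually_happens'[OF sequentially_bot] by fastforce
    show "\<forall>\<^sub>F u in F. a < measure M {\<omega> \<in> space M. \<forall>i<n. V u i \<omega> \<le> w i}"
      using order_tendstoD(1)[OF E k]
      by eventually_elim (use lo[of "1 / Suc k"] in \<open>fastforce intro: less_le_trans\<close>)
  next
    fix a assume "a > ?p"
    then obtain k where k: "a > (\<integral>\<omega>. (\<Prod>i<n. ramp (1 / Suc k) (w i) (Z i \<omega>)) \<partial>N)"
      using order_tendstoD(2)[OF lims(1)] eventually_happens'[OF sequentially_bot] by fastforce
    show "\<forall>\<^sub>F u in F. a > measure M {\<omega> \<in> space M. \<forall>i<n. V u i \<omega> \<le> w i}"
      using order_tendstoD(2)[OF E k]
      by eventually_elim (use up[of "1 / Suc k"] in \<open>fastforce intro: le_less_trans\<close>)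
  qed
qed

section \<open>Gaussian variables and Gaussian fields\<close>

interpretation std_normal: prob_space std_normal_distribution
  by (rule prob_space_normal_density) simp

text \<open>Encoded as the image of the standard normal law under scaling by sqrt v, so that v = 0
  gives the point mass at 0 without a case distinction.\<close>

definition centered_gaussian :: "'a measure \<Rightarrow> ('a \<Rightarrow> real) \<Rightarrow> real \<Rightarrow> bool" where
  "centered_gaussian M Y v \<longleftrightarrow> Y \<in> borel_measurable M \<and> 0 \<le> v \<and>
     distr M borel Y = distr std_normal_distribution borel (\<lambda>z. sqrt v * z)"

lemma
  assumes "centered_gaussian M Y v"
  shows centered_gaussian_measurable: "Y \<in> borel_measurable M"
    and centered_gaussian_nonneg: "0 \<le> v"
  using assms by (auto simp: centered_gaussian_def)

lemma centered_gaussian_integral: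
  fixes h :: "real \<Rightarrow> 'b::{banach, second_countable_topology}"
  assumes Y: "centered_gaussian M Y v" and [measurable]: "h \<in> borel_measurable borel"
  shows "(\<integral>\<omega>. h (Y \<omega>) \<partial>M) = (\<integral>z. h (sqrt v * z) \<partial>std_normal_distribution)"
    and "integrable M (\<lambda>\<omega>. h (Y \<omega>)) \<longleftrightarrow> integrable std_normal_distribution (\<lambda>z. h (sqrt v * z))"
proof -
  have [measurable]: "Y \<in> borel_measurable M" by (rule centered_gaussian_measurable[OF Y])
  have eq: "distr M borel Y = distr std_normal_distribution borel (\<lambda>z. sqrt v * z)"
    using Y by (simp add: centered_gaussian_def)
  show "(\<integral>\<omega>. h (Y \<omega>) \<partial>M) = (\<integral>z. h (sqrt v * z) \<partial>std_normal_distribution)"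
    using arg_cong[OF eq, of "\<lambda>D. integral\<^sup>L D h"] by (simp add: integral_distr)
  show "integrable M (\<lambda>\<omega>. h (Y \<omega>)) \<longleftrightarrow> integrable std_normal_distribution (\<lambda>z. h (sqrt v * z))"
    using arg_cong[OF eq, of "\<lambda>D. integrable D h"] by (simp add: integrable_distr_eq)
qed

lemma centered_gaussian_measure:
  assumes Y: "centered_gaussian M Y v" and [measurable]: "Measurable.pred borel P"
  shows "measure M {\<omega> \<in> space M. P (Y \<omega>)} = measure std_normal_distribution {z. P (sqrt v * z)}"
proof -
  have [measurable]: "Y \<in> borel_measurable M" by (rule centered_gaussian_measurable[OF Y])
  have eq: "distr M borel Y = distr std_normal_distribution borel (\<lambda>z. sqrt v * z)"
    using Y by (simp add: centered_gaussian_def)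
  have "measure (distr M borel Y) {x. P x} = measure (distr std_normal_distribution borel (\<lambda>z. sqrt v * z)) {x. P x}"
    by (simp only: eq)
  then show ?thesis
    by (subst (asm) (1 2) measure_distr) (auto simp: vimage_def Int_def conj_commute)
qed

lemma centered_gaussian_moments:
  assumes Y: "centered_gaussian M Y v"
  shows "integrable M Y" "(\<integral>\<omega>. Y \<omega> \<partial>M) = 0" "integrable M (\<lambda>\<omega>. (Y \<omega>)\<^sup>2)" "(\<integral>\<omega>. (Y \<omega>)\<^sup>2 \<partial>M) = v"
proof -
  have i: "integrable std_normal_distribution (\<lambda>z. z ^ k)" for k
    by (rule integrable_std_normal_distribution_moment)
  have v: "(sqrt v)\<^sup>2 = v" using centered_gaussian_nonneg[OF Y] by simp
  have e1: "(\<integral>z. z \<partial>std_normal_distribution) = 0"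
    using integral_std_normal_distribution_moment_odd[of 1] by simp
  have e2: "(\<integral>z. z\<^sup>2 \<partial>std_normal_distribution) = 1"
    using std_normal_distribution_even_moments(1)[of 1] by (simp add: fact_numeral)
  show "integrable M Y" using centered_gaussian_integral(2)[OF Y, of "\<lambda>x. x"] i[of 1] by simp
  show "(\<integral>\<omega>. Y \<omega> \<partial>M) = 0" using centered_gaussian_integral(1)[OF Y, of "\<lambda>x. x"] e1 by simp
  show "integrable M (\<lambda>\<omega>. (Y \<omega>)\<^sup>2)"
    using centered_gaussian_integral(2)[OF Y, of "\<lambda>x. x\<^sup>2"] i[of 2] by (simp add: power_mult_distrib)
  show "(\<integral>\<omega>. (Y \<omega>)\<^sup>2 \<partial>M) = v"
    using centered_gaussian_integral(1)[OF Y, of "\<lambda>x. x\<^sup>2"] e2 v by (simp add: power_mult_distrib)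
qed

lemma centered_gaussian_char:
  assumes Y: "centered_gaussian M Y v"
  shows "(\<integral>\<omega>. iexp (Y \<omega>) \<partial>M) = of_real (exp (- v / 2))"
proof -
  have "(\<integral>\<omega>. iexp (Y \<omega>) \<partial>M) = char std_normal_distribution (sqrt v)"
    using centered_gaussian_integral(1)[OF Y, of iexp] by (simp add: char_def)
  also have "\<dots> = of_real (exp (- v / 2))"
    using centered_gaussian_nonneg[OF Y] by (simp add: char_std_normal_distribution)
  finally show ?thesis .
qed

lemma std_normal_mgf:
  "integrable std_normal_distribution (\<lambda>z. exp (s * z))"
  "(\<integral>z. exp (s * z) \<partial>std_normal_distribution) = exp (s\<^sup>2 / 2)"
proof -
  have eq: "std_normal_density z * exp (s * z) = exp (s\<^sup>2 / 2) * normal_density s 1 z" for z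
    by (simp add: normal_density_def exp_add[symmetric] field_simps power2_eq_square)
  show "integrable std_normal_distribution (\<lambda>z. exp (s * z))"
    by (subst integrable_real_density) (auto simp: eq)
  show "(\<integral>z. exp (s * z) \<partial>std_normal_distribution) = exp (s\<^sup>2 / 2)"
    by (subst integral_real_density) (auto simp: eq)
qed

lemma centered_gaussian_mgf:
  assumes Y: "centered_gaussian M Y v"
  shows "integrable M (\<lambda>\<omega>. exp (s * Y \<omega>))" "(\<integral>\<omega>. exp (s * Y \<omega>) \<partial>M) = exp (s\<^sup>2 * v / 2)"
  using centered_gaussian_integral[OF Y, of "\<lambda>x. exp (s * x)"] std_normal_mgf[of "s * sqrt v"]
    centered_gaussian_nonneg[OF Y]
  by (simp_all add: mult.assoc power_mult_distrib)

lemma centered_gaussian_exp_markov: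
  assumes "prob_space M" and Y: "centered_gaussian M Y v" and s: "0 \<le> s"
  shows "measure M {\<omega> \<in> space M. y \<le> Y \<omega>} \<le> exp (- s * y + s\<^sup>2 * v / 2)"
proof -
  interpret prob_space M by fact
  note [measurable] = centered_gaussian_measurable[OF Y]
  have "measure M {\<omega> \<in> space M. y \<le> Y \<omega>} = expectation (indicator {\<omega> \<in> space M. y \<le> Y \<omega>})"
    by simp
  also have "\<dots> \<le> expectation (\<lambda>\<omega>. exp (- s * y) * exp (s * Y \<omega>))"
  proof (rule integral_mono)
    show "integrable M (indicator {\<omega> \<in> space M. y \<le> Y \<omega>} :: _ \<Rightarrow> real)"
      by (rule integrable_const_bound[where B=1]) auto
    show "integrable M (\<lambda>\<omega>. exp (- s * y) * exp (s * Y \<omega>))"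
      using centered_gaussian_mgf(1)[OF Y] by auto
    show "indicator {\<omega> \<in> space M. y \<le> Y \<omega>} \<omega> \<le> exp (- s * y) * exp (s * Y \<omega>)" for \<omega>
      using s by (auto simp: indicator_def exp_add[symmetric] mult_left_mono)
  qed
  also have "\<dots> = exp (- s * y + s\<^sup>2 * v / 2)"
    by (subst integral_mult_right_zero) (simp only: centered_gaussian_mgf(2)[OF Y] mult_exp_exp)
  finally show ?thesis .
qed

text \<open>The exponential Markov bound at its best exponent. A separate positive bound
  \<open>w\<close> on the variance lets degenerate variables in.\<close>

lemma centered_gaussian_chernoff:
  assumes "prob_space M" and Y: "centered_gaussian M Y v" and v: "v \<le> w" "0 < w" and "0 \<le> y"
  shows "measure M {\<omega> \<in> space M. y \<le> Y \<omega>} \<le> exp (- y\<^sup>2 / (2 * w))"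
proof -
  \<comment> \<open>The minimiser of \<open>- s * y + s\<^sup>2 * w / 2\<close>.\<close>
  define s where "s = y / w"
  have "s \<ge> 0" using assms by (simp add: s_def)
  then have "measure M {\<omega> \<in> space M. y \<le> Y \<omega>} \<le> exp (- s * y + s\<^sup>2 * v / 2)"
    by (rule centered_gaussian_exp_markov[OF assms(1) Y])
  also have "\<dots> \<le> exp (- s * y + s\<^sup>2 * w / 2)"
    using v by (simp add: mult_left_mono)
  also have "- s * y + s\<^sup>2 * w / 2 = - y\<^sup>2 / (2 * w)"
    using v by (simp add: s_def field_simps power2_eq_square)
  finally show ?thesis .
qed

text \<open>A centered Gaussian law has an atom only for v = 0, and then only at 0.\<close>

lemma centered_gaussian_AE_neq:
  assumes "prob_space M" and Y: "centered_gaussian M Y v" and "0 < v \<or> w \<noteq> 0"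
  shows "AE \<omega> in M. Y \<omega> \<noteq> w"
proof -
  interpret prob_space M by fact
  note [measurable] = centered_gaussian_measurable[OF Y]
  have "AE z in std_normal_distribution. sqrt v * z \<noteq> w"
  proof (cases "v = 0")
    case True
    then show ?thesis using assms(3) by simp
  next
    case False
    then have "0 < v" using centered_gaussian_nonneg[OF Y] by simp
    have "AE z in lborel. z \<noteq> w / sqrt v"
      by (rule AE_lborel_singleton)
    then show ?thesis
      using \<open>0 < v\<close> by (auto simp: AE_density elim!: eventually_mono)
  qed
  then have "measure std_normal_distribution {z. sqrt v * z \<noteq> w} = 1"
    using std_normal.prob_Collect_eq_1[of "\<lambda>z. sqrt v * z \<noteq> w"] by auto
  then have "measure M {\<omega> \<in> space M. Y \<omega> \<noteq> w} = 1"
    using centered_gaussian_measure[OF Y, of "\<lambda>x. x \<noteq> w"] by simp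
  then show ?thesis by (subst (asm) prob_Collect_eq_1) auto
qed

lemma distr_std_normal_affine:
  assumes "\<sigma> > 0"
  shows "distr std_normal_distribution borel (\<lambda>z. \<mu> + \<sigma> * z) = density lborel (normal_density \<mu> \<sigma>)"
proof -
  have "distributed std_normal_distribution lborel (\<lambda>z. z) std_normal_density"
    unfolding distributed_def by (auto simp: distr_id2[where N=lborel, simplified] intro!: distr_id2)
  then have "distributed std_normal_distribution lborel (\<lambda>z. ((\<mu> + \<sigma> * z) - \<mu>) / \<sigma>) std_normal_density"
    using assms by simp
  then have "distributed std_normal_distribution lborel (\<lambda>z. \<mu> + \<sigma> * z) (normal_density \<mu> \<sigma>)"
    using std_normal.normal_standard_normal_convert[OF assms] by blast
  then have "distr std_normal_distribution lborel (\<lambda>z. \<mu> + \<sigma> * z) = density lborel (normal_density \<mu> \<sigma>)"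
    by (simp add: distributed_def)
  then show ?thesis by (simp cong: distr_cong)
qed

lemma centered_gaussian_of_gaussian_rv:
  assumes "prob_space M" and Y: "gaussian_rv M Y" and mean: "(\<integral>\<omega>. Y \<omega> \<partial>M) = 0"
  shows "centered_gaussian M Y (\<integral>\<omega>. (Y \<omega>)\<^sup>2 \<partial>M)"
proof -
  interpret prob_space M by fact
  obtain \<mu> \<sigma> where [measurable]: "Y \<in> borel_measurable M" and \<sigma>: "\<sigma> \<ge> 0"
    and d: "distr M borel Y = (if \<sigma> = 0 then return borel \<mu> else density lborel (normal_density \<mu> \<sigma>))"
    using Y by (auto simp: gaussian_rv_def)
  have d': "distr M borel Y = distr std_normal_distribution borel (\<lambda>z. \<mu> + \<sigma> * z)"
  proof (cases "\<sigma> = 0")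
    case True
    have "distr std_normal_distribution borel (\<lambda>z. \<mu>) = return borel \<mu>"
      by (rule std_normal.distr_const) simp
    then show ?thesis using True d by simp
  next
    case False
    then show ?thesis using d distr_std_normal_affine[of \<sigma> \<mu>] \<sigma> by simp
  qed
  have "(\<integral>\<omega>. Y \<omega> \<partial>M) = (\<integral>z. \<mu> + \<sigma> * z \<partial>std_normal_distribution)"
    using arg_cong[OF d', of "\<lambda>D. integral\<^sup>L D (\<lambda>x. x)"] by (simp add: integral_distr)
  also have "\<dots> = \<mu>"
    using integrable_std_normal_distribution_moment[of 1] integral_std_normal_distribution_moment_odd[of 1]
    by (simp add: std_normal.prob_space[simplified])
  finally have "\<mu> = 0" using mean by simp
  then have "centered_gaussian M Y (\<sigma>\<^sup>2)"
    using d' \<sigma> by (simp add: centered_gaussian_def)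
  then show ?thesis using centered_gaussian_moments(4) by fastforce
qed

text \<open>Passes from the list-based definition of a Gaussian process to indexed sums with
  explicit variance. The square integrability needed to expand the variance comes from the one-point
  marginals.\<close>

lemma centered_gaussian_sum_process:
  fixes t :: "nat \<Rightarrow> real" and c :: "nat \<Rightarrow> real"
  assumes "prob_space M" and X: "gaussian_process M I X" "centered_process M I X"
    and t: "\<And>i. i < n \<Longrightarrow> t i \<in> I"
  shows "centered_gaussian M (\<lambda>\<omega>. \<Sum>i<n. c i * X (t i) \<omega>)
    (\<Sum>i<n. \<Sum>j<n. c i * c j * covariance M (X (t i)) (X (t j)))"
proof -
  interpret prob_space M by fact
  have g: "gaussian_rv M (\<lambda>\<omega>. \<Sum>i<n. c i * X (t i) \<omega>)" if "\<And>i. i < n \<Longrightarrow> t i \<in> I" for n :: nat and t c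
  proof -
    have "gaussian_rv M (\<lambda>\<omega>. \<Sum>i<length (map t [0..<n]). map c [0..<n] ! i * X (map t [0..<n] ! i) \<omega>)"
      by (rule X(1)[unfolded gaussian_process_def, THEN conjunct2, rule_format]) (use that in auto)
    moreover have "(\<lambda>\<omega>. \<Sum>i<length (map t [0..<n]). map c [0..<n] ! i * X (map t [0..<n] ! i) \<omega>)
        = (\<lambda>\<omega>. \<Sum>i<n. c i * X (t i) \<omega>)"
      by (intro ext sum.cong) auto
    ultimately show ?thesis by simp
  qed
  have X1: "centered_gaussian M (X s) (\<integral>\<omega>. (X s \<omega>)\<^sup>2 \<partial>M)" if "s \<in> I" for s
  proof (rule centered_gaussian_of_gaussian_rv)
    show "gaussian_rv M (X s)" using g[of 1 "\<lambda>_. s" "\<lambda>_. 1"] that by simp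
    show "expectation (X s) = 0" using X(2) that by (simp add: centered_process_def)
  qed fact
  have i1: "integrable M (X s)" and m [measurable]: "X s \<in> borel_measurable M"
    and i2: "integrable M (\<lambda>\<omega>. (X s \<omega>)\<^sup>2)" and e1: "expectation (X s) = 0" if "s \<in> I" for s
    using centered_gaussian_moments[OF X1[OF that]] centered_gaussian_measurable[OF X1[OF that]] by auto
  have ip: "integrable M (\<lambda>\<omega>. X s \<omega> * X s' \<omega>)" if "s \<in> I" "s' \<in> I" for s s'
  proof (rule Bochner_Integration.integrable_bound)
    show "integrable M (\<lambda>\<omega>. (X s \<omega>)\<^sup>2 + (X s' \<omega>)\<^sup>2)" using i2 that by auto
    show "(\<lambda>\<omega>. X s \<omega> * X s' \<omega>) \<in> borel_measurable M" using m[OF that(1)] m[OF that(2)] by measurable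
    have "\<bar>x * y\<bar> \<le> x\<^sup>2 + y\<^sup>2" for x y :: real
      using sum_squares_bound[of "\<bar>x\<bar>" "\<bar>y\<bar>"] mult_nonneg_nonneg[OF abs_ge_zero abs_ge_zero, of x y] by (simp only: abs_mult power2_abs)
    then show "AE \<omega> in M. norm (X s \<omega> * X s' \<omega>) \<le> norm ((X s \<omega>)\<^sup>2 + (X s' \<omega>)\<^sup>2)" by simp
  qed
  have cov: "covariance M (X s) (X s') = expectation (\<lambda>\<omega>. X s \<omega> * X s' \<omega>)" if "s \<in> I" "s' \<in> I" for s s'
    using e1 that by (simp add: covariance_def)
  have "expectation (\<lambda>\<omega>. \<Sum>i<n. c i * X (t i) \<omega>) = 0"
    using t by (subst Bochner_Integration.integral_sum) (auto simp: i1 e1)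
  from centered_gaussian_of_gaussian_rv[OF assms(1) g[OF t] this]
  have *: "centered_gaussian M (\<lambda>\<omega>. \<Sum>i<n. c i * X (t i) \<omega>) (\<integral>\<omega>. (\<Sum>i<n. c i * X (t i) \<omega>)\<^sup>2 \<partial>M)" .
  have "(\<integral>\<omega>. (\<Sum>i<n. c i * X (t i) \<omega>)\<^sup>2 \<partial>M)
      = (\<integral>\<omega>. (\<Sum>i<n. \<Sum>j<n. c i * c j * (X (t i) \<omega> * X (t j) \<omega>)) \<partial>M)"
    by (simp add: power2_eq_square sum_product mult_ac)
  also have "\<dots> = (\<Sum>i<n. \<Sum>j<n. c i * c j * expectation (\<lambda>\<omega>. X (t i) \<omega> * X (t j) \<omega>))"
    by (subst Bochner_Integration.integral_sum, use t ip in \<open>auto intro!: Bochner_Integration.integrable_sum sum.cong\<close>)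
  also have "\<dots> = (\<Sum>i<n. \<Sum>j<n. c i * c j * covariance M (X (t i)) (X (t j)))"
    using t by (intro sum.cong refl) (simp add: cov)
  finally show ?thesis using * by simp
qed

text \<open>The Mills ratio, tail probability over density at y, after the substitution x = y + z;
  in this form it is visibly decreasing in y.\<close>

definition mills :: "real \<Rightarrow> real" where
  "mills y = (\<integral>z. indicator {0<..} z * exp (- y * z - z\<^sup>2 / 2) \<partial>lborel)"

lemma integrable_mills:
  fixes y :: real
  shows "integrable lborel (\<lambda>z. indicator {0<..} z * exp (- y * z - z\<^sup>2 / 2))"
proof -
  have "integrable lborel (\<lambda>z. sqrt (2 * pi) * exp (y\<^sup>2 / 2) * normal_density (- y) 1 z)"
    by simp
  also have "(\<lambda>z. sqrt (2 * pi) * exp (y\<^sup>2 / 2) * normal_density (- y) 1 z) = (\<lambda>z. exp (- y * z - z\<^sup>2 / 2))"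
    by (auto simp: normal_density_def exp_add[symmetric] field_simps power2_eq_square)
  finally show ?thesis
    by (rule Bochner_Integration.integrable_bound) (auto simp: indicator_def)
qed

lemma mills_antimono: "x \<le> y \<Longrightarrow> mills y \<le> mills x"
  unfolding mills_def
  by (intro integral_mono integrable_mills) (auto simp: indicator_def mult_right_mono)

lemma Psi_eq_mills: "Psi u = std_normal_density u * mills u"
proof -
  have "Psi u = (\<integral>x. indicator {u<..} x \<partial>std_normal_distribution)"
    unfolding Psi_def by simp
  also have "\<dots> = (\<integral>x. std_normal_density x * indicator {u<..} x \<partial>lborel)"
    by (subst integral_real_density) auto
  also have "\<dots> = (\<integral>z. std_normal_density (u + z) * indicator {u<..} (u + z) \<partial>lborel)"
    by (subst lborel_integral_real_affine[where c=1 and t=u]) auto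
  also have "\<dots> = (\<integral>z. std_normal_density u * (indicator {0<..} z * exp (- u * z - z\<^sup>2 / 2)) \<partial>lborel)"
    by (intro Bochner_Integration.integral_cong refl)
       (auto simp: std_normal_density_def indicator_def exp_add[symmetric] field_simps power2_eq_square)
  finally show ?thesis by (simp add: mills_def)
qed

lemma Psi_nonneg: "0 \<le> Psi u"
  by (simp add: Psi_def)

lemma Psi_antimono: "x \<le> y \<Longrightarrow> Psi y \<le> Psi x"
  unfolding Psi_def by (intro std_normal.finite_measure_mono) auto

text \<open>The density contributes exactly the exponential factor, and the Mills ratio can only
  decrease as the level rises.\<close>

lemma Psi_scale_le:
  assumes "0 \<le> u" "1 \<le> k"
  shows "Psi (k * u) \<le> exp (- u\<^sup>2 * (k\<^sup>2 - 1) / 2) * Psi u"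
proof -
  have "std_normal_density (k * u) = exp (- u\<^sup>2 * (k\<^sup>2 - 1) / 2) * std_normal_density u"
    by (simp add: std_normal_density_def exp_add[symmetric] field_simps)
  moreover have "mills (k * u) \<le> mills u"
    using assms by (intro mills_antimono) (simp add: mult_le_cancel_right1)
  ultimately show ?thesis
    by (simp add: Psi_eq_mills mult_left_mono)
qed

text \<open>Rescaling to unit variance raises the level to u / sqrt v, and 1/v - 1 \<ge> 1 - v. For
  the mean of two values with correlation r the variance is (1 + r)/2, which is how this serves the
  double sum.\<close>

lemma centered_gaussian_tail_le:
  assumes Y: "centered_gaussian M Y v" and "v \<le> 1" "0 < u"
  shows "measure M {\<omega> \<in> space M. u < Y \<omega>} \<le> exp (- u\<^sup>2 * (1 - v) / 2) * Psi u"
proof (cases "v = 0")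
  case True
  then have "measure M {\<omega> \<in> space M. u < Y \<omega>} = 0"
    using centered_gaussian_measure[OF Y, of "\<lambda>x. u < x"] assms by simp
  then show ?thesis by (simp add: Psi_nonneg)
next
  case False
  then have v: "0 < v" using centered_gaussian_nonneg[OF Y] by simp
  have s: "0 < sqrt v" "sqrt v \<le> 1" using v assms by auto
  have "measure M {\<omega> \<in> space M. u < Y \<omega>} = Psi ((1 / sqrt v) * u)"
    using centered_gaussian_measure[OF Y, of "\<lambda>x. u < x"] s
    by (simp add: Psi_def greaterThan_def field_simps)
  also have "\<dots> \<le> exp (- u\<^sup>2 * ((1 / sqrt v)\<^sup>2 - 1) / 2) * Psi u"
    using assms s by (intro Psi_scale_le) auto
  also have "\<dots> \<le> exp (- u\<^sup>2 * (1 - v) / 2) * Psi u"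
  proof -
    have "(1 - v) * v \<le> (1 - v) * 1" using v assms by (intro mult_left_mono) auto
    then have "1 - v \<le> (1 / sqrt v)\<^sup>2 - 1" using v by (simp add: power_divide field_simps)
    then have "u\<^sup>2 * (1 - v) \<le> u\<^sup>2 * ((1 / sqrt v)\<^sup>2 - 1)" by (rule mult_left_mono) simp
    then show ?thesis by (intro mult_right_mono Psi_nonneg) simp
  qed
  finally show ?thesis .
qed

lemma centered_gaussian_1_tail:
  assumes Y: "centered_gaussian M Y 1"
  shows "measure M {\<omega> \<in> space M. u < Y \<omega>} = Psi u"
  using centered_gaussian_measure[OF Y, of "\<lambda>x. u < x"] by (simp add: Psi_def greaterThan_def)


text \<open>Finite-dimensional laws in the form in which they are used: every linear combination is
  centered Gaussian with variance computed from \<open>R\<close>. Both the observed process and the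
  fractional Brownian motion are instances.\<close>

locale gaussian_field = prob_space M for M :: "'a measure" +
  fixes X :: "real \<Rightarrow> 'a \<Rightarrow> real" and R :: "real \<Rightarrow> real \<Rightarrow> real"
  assumes field_measurable [measurable]: "\<And>t. 0 \<le> t \<Longrightarrow> X t \<in> borel_measurable M"
    and cov_sym: "\<And>s t. R s t = R t s"
    and gaussian_sum: "\<And>n t c. (\<And>i. i < n \<Longrightarrow> 0 \<le> t i) \<Longrightarrow>
      centered_gaussian M (\<lambda>\<omega>. \<Sum>i<(n::nat). c i * X (t i) \<omega>) (\<Sum>i<n. \<Sum>j<n. c i * c j * R (t i) (t j))"
begin

lemma gaussian_single: "0 \<le> t \<Longrightarrow> centered_gaussian M (X t) (R t t)"
  using gaussian_sum[of 1 "\<lambda>_. t" "\<lambda>_. 1"] by simp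

lemma gaussian_pair:
  assumes "0 \<le> s" "0 \<le> t"
  shows "centered_gaussian M (\<lambda>\<omega>. c * X s \<omega> + d * X t \<omega>) (c\<^sup>2 * R s s + 2 * c * d * R s t + d\<^sup>2 * R t t)"
  using gaussian_sum[of 2 "\<lambda>i. if i = 0 then s else t" "\<lambda>i. if i = 0 then c else d"] assms cov_sym[of t s]
  by (simp add: numeral_2_eq_2 power2_eq_square algebra_simps)

lemma gaussian_residual:
  fixes t :: "nat \<Rightarrow> real"
  assumes t: "\<And>i. 0 \<le> t i" and R0: "R (t 0) (t 0) = 1"
  shows "centered_gaussian M (\<lambda>\<omega>. \<Sum>i<n. c i * (X (t i) \<omega> - R (t 0) (t i) * X (t 0) \<omega>))
    (\<Sum>i<n. \<Sum>j<n. c i * c j * (R (t i) (t j) - R (t 0) (t i) * R (t 0) (t j)))"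
proof -
  define b where "b = (\<Sum>i<n. c i * R (t 0) (t i))"
  \<comment> \<open>The residual sum is a combination of n + 1 values: the additional index n
    carries the time \<open>t 0\<close> with the total coefficient - b.\<close>
  define c' where "c' = c(n := - b)"
  define t' where "t' = t(n := t 0)"
  have "centered_gaussian M (\<lambda>\<omega>. \<Sum>i<Suc n. c' i * X (t' i) \<omega>) (\<Sum>i<Suc n. \<Sum>j<Suc n. c' i * c' j * R (t' i) (t' j))"
    by (rule gaussian_sum) (simp add: t'_def t)
  moreover have "(\<lambda>\<omega>. \<Sum>i<Suc n. c' i * X (t' i) \<omega>) = (\<lambda>\<omega>. \<Sum>i<n. c i * (X (t i) \<omega> - R (t 0) (t i) * X (t 0) \<omega>))"
    by (auto simp: c'_def t'_def b_def sum_distrib_left sum_distrib_right sum_subtractf algebra_simps)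
  moreover have "(\<Sum>i<Suc n. \<Sum>j<Suc n. c' i * c' j * R (t' i) (t' j))
      = (\<Sum>i<n. \<Sum>j<n. c i * c j * (R (t i) (t j) - R (t 0) (t i) * R (t 0) (t j)))"
  proof -
    have "(\<Sum>i<Suc n. \<Sum>j<Suc n. c' i * c' j * R (t' i) (t' j))
        = (\<Sum>i<n. (\<Sum>j<n. c i * c j * R (t i) (t j)) - c i * b * R (t i) (t 0)) + ((\<Sum>j<n. - b * c j * R (t 0) (t j)) + b * b)"
      by (simp add: c'_def t'_def R0)
    also have "\<dots> = (\<Sum>i<n. \<Sum>j<n. c i * c j * R (t i) (t j)) - b * b - b * b + b * b"
      by (simp add: sum_subtractf b_def sum_distrib_left sum_distrib_right sum_negf cov_sym[of _ "t 0"] mult_ac)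
    also have "b * b = (\<Sum>i<n. \<Sum>j<n. c i * c j * (R (t 0) (t i) * R (t 0) (t j)))"
      unfolding b_def sum_product by (simp add: mult_ac)
    finally show ?thesis by (simp add: sum_subtractf right_diff_distrib)
  qed
  ultimately show ?thesis by simp
qed

text \<open>The residual is uncorrelated with \<open>X (t 0)\<close>, so replacing that variable by an
  independent standard normal one does not change any characteristic function.\<close>
lemma prob_regression:
  fixes t :: "nat \<Rightarrow> real"
  assumes t: "\<And>i. 0 \<le> t i" and R0: "R (t 0) (t 0) = 1"
  shows "prob {\<omega> \<in> space M. \<forall>i<n. \<epsilon> i * X (t i) \<omega> \<le> w i}
    = (\<integral>x. prob {\<omega> \<in> space M. \<forall>i<n. \<epsilon> i * (R (t 0) (t i) * x + (X (t i) \<omega> - R (t 0) (t i) * X (t 0) \<omega>)) \<le> w i} \<partial>std_normal_distribution)"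
proof -
  let ?S = "std_normal_distribution"
  let ?Y = "\<lambda>i \<omega>. X (t i) \<omega> - R (t 0) (t i) * X (t 0) \<omega>"
  \<comment> \<open>The factors \<epsilon> i let a box express upper and lower bounds at once;
    \<open>prob_drop_le\<close> uses one of each.\<close>
  let ?Z = "\<lambda>i z. \<epsilon> i * (R (t 0) (t i) * fst z + ?Y i (snd z))"
  interpret P: pair_prob_space ?S M ..
  note [measurable] = field_measurable[OF t]
  define E where "E = {z \<in> space (?S \<Otimes>\<^sub>M M). \<forall>i<n. ?Z i z \<le> w i}"
  have [measurable]: "E \<in> sets (?S \<Otimes>\<^sub>M M)" unfolding E_def by measurable
  have "prob {\<omega> \<in> space M. \<forall>i<n. \<epsilon> i * X (t i) \<omega> \<le> w i}
      = measure (?S \<Otimes>\<^sub>M M) {z \<in> space (?S \<Otimes>\<^sub>M M). \<forall>i<n. ?Z i z \<le> w i}"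
  proof (rule prob_box_eq_of_char_eq[OF prob_space_axioms P.prob_space_axioms])
    fix c :: "nat \<Rightarrow> real"
    define b where "b = (\<Sum>j<n. c j * \<epsilon> j * R (t 0) (t j))"
    let ?c = "\<lambda>j. c j * \<epsilon> j"
    have sum_eq: "(\<Sum>j<n. c j * ?Z j z) = b * fst z + (\<Sum>j<n. ?c j * ?Y j (snd z))" for z
      unfolding b_def sum_distrib_right sum.distrib[symmetric] by (intro sum.cong refl) (simp add: algebra_simps)
    have i: "integrable (?S \<Otimes>\<^sub>M M) (\<lambda>z. iexp (\<Sum>j<n. c j * ?Z j z))"
      by (rule P.integrable_const_bound[where B=1]) (auto simp: norm_exp_i_times[of "\<Sum>j<n. c j * ?Z j z" for z])
    have "(\<integral>z. iexp (\<Sum>j<n. c j * ?Z j z) \<partial>(?S \<Otimes>\<^sub>M M)) = (\<integral>x. \<integral>\<omega>. iexp (\<Sum>j<n. c j * ?Z j (x, \<omega>)) \<partial>M \<partial>?S)"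
      using P.integral_fst'[OF i] by simp
    also have "\<dots> = (\<integral>x. iexp (b * x) * (\<integral>\<omega>. iexp (\<Sum>j<n. ?c j * ?Y j \<omega>) \<partial>M) \<partial>?S)"
      unfolding sum_eq unfolding of_real_add distrib_left exp_add fst_conv snd_conv by simp
    also have "\<dots> = char ?S b * (\<integral>\<omega>. iexp (\<Sum>j<n. ?c j * ?Y j \<omega>) \<partial>M)"
      by (simp add: char_def)
    also have "\<dots> = of_real (exp (- b\<^sup>2 / 2) * exp (- (\<Sum>i<n. \<Sum>j<n. ?c i * ?c j * (R (t i) (t j) - R (t 0) (t i) * R (t 0) (t j))) / 2))"
      by (simp only: char_std_normal_distribution centered_gaussian_char[OF gaussian_residual[where t=t and n=n and c="?c", OF t R0]] of_real_mult)
    also have "\<dots> = of_real (exp (- (b\<^sup>2 + (\<Sum>i<n. \<Sum>j<n. ?c i * ?c j * (R (t i) (t j) - R (t 0) (t i) * R (t 0) (t j)))) / 2))"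
      by (simp add: mult_exp_exp field_simps)
    \<comment> \<open>Independence adds the variances, and b^2 restores the products that the
      residual covariance had lost.\<close>
    also have "b\<^sup>2 + (\<Sum>i<n. \<Sum>j<n. ?c i * ?c j * (R (t i) (t j) - R (t 0) (t i) * R (t 0) (t j)))
        = (\<Sum>i<n. \<Sum>j<n. ?c i * ?c j * R (t i) (t j))"
      unfolding b_def power2_eq_square sum_product by (simp add: sum.distrib[symmetric] algebra_simps)
    also have "of_real (exp (- (\<Sum>i<n. \<Sum>j<n. ?c i * ?c j * R (t i) (t j)) / 2)) = (\<integral>\<omega>. iexp (\<Sum>j<n. c j * (\<epsilon> j * X (t j) \<omega>)) \<partial>M)"
      using centered_gaussian_char[OF gaussian_sum[where t=t and n=n and c="?c", OF t]] by (simp add: mult.assoc)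
    finally show "(\<integral>\<omega>. iexp (\<Sum>j<n. c j * (\<epsilon> j * X (t j) \<omega>)) \<partial>M) = (\<integral>z. iexp (\<Sum>j<n. c j * ?Z j z) \<partial>(?S \<Otimes>\<^sub>M M))"
      by (rule sym)
  next
    fix i
    show "integrable M (\<lambda>\<omega>. (\<epsilon> i * X (t i) \<omega>)\<^sup>2)"
      using centered_gaussian_moments(3)[OF gaussian_single[OF t]] by (simp add: power_mult_distrib)
    have 1: "integrable (?S \<Otimes>\<^sub>M M) (\<lambda>z. (fst z)\<^sup>2)"
      by (rule P.Fubini_integrable) (use integrable_std_normal_distribution_moment[of 2] in \<open>auto simp: prob_space\<close>)
    have 2: "integrable (?S \<Otimes>\<^sub>M M) (\<lambda>z. (?Y i (snd z))\<^sup>2)"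
    proof (rule P.Fubini_integrable)
      have "integrable M (\<lambda>\<omega>. (?Y i \<omega>)\<^sup>2)"
      proof (cases "i = 0")
        case True
        then show ?thesis by (simp add: R0)
      next
        case False
        then show ?thesis
          using centered_gaussian_moments(3)[OF gaussian_pair[of "t i" "t 0" 1 "- R (t 0) (t i)"]] t by simp
      qed
      then show "AE x in ?S. integrable M (\<lambda>\<omega>. (?Y i (snd (x, \<omega>)))\<^sup>2)" by simp
    qed auto
    show "integrable (?S \<Otimes>\<^sub>M M) (\<lambda>z. (?Z i z)\<^sup>2)"
    proof (rule Bochner_Integration.integrable_bound)
      show "integrable (?S \<Otimes>\<^sub>M M) (\<lambda>z. 2 * (\<epsilon> i)\<^sup>2 * ((R (t 0) (t i) * fst z)\<^sup>2 + (?Y i (snd z))\<^sup>2))"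
        unfolding power_mult_distrib[of "R (t 0) (t i)"]
        using 1 2 by (intro integrable_mult_right Bochner_Integration.integrable_add) auto
      have le: "(e * (x + y))\<^sup>2 \<le> 2 * e\<^sup>2 * (x\<^sup>2 + y\<^sup>2)" for e x y :: real
      proof -
        have "(x + y)\<^sup>2 \<le> 2 * (x\<^sup>2 + y\<^sup>2)"
          using sum_squares_bound[of x y] by (simp add: power2_sum)
        then have "e\<^sup>2 * (x + y)\<^sup>2 \<le> e\<^sup>2 * (2 * (x\<^sup>2 + y\<^sup>2))" by (rule mult_left_mono) simp
        then show ?thesis by (simp only: power_mult_distrib[of e] mult.assoc mult.left_commute[of 2])
      qed
      show "AE z in ?S \<Otimes>\<^sub>M M. norm ((?Z i z)\<^sup>2)
          \<le> norm (2 * (\<epsilon> i)\<^sup>2 * ((R (t 0) (t i) * fst z)\<^sup>2 + (?Y i (snd z))\<^sup>2))"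
      proof (rule AE_I2)
        fix z
        show "norm ((?Z i z)\<^sup>2) \<le> norm (2 * (\<epsilon> i)\<^sup>2 * ((R (t 0) (t i) * fst z)\<^sup>2 + (?Y i (snd z))\<^sup>2))"
          unfolding real_norm_def abs_power2 by (rule order_trans[OF le abs_ge_self])
      qed
      show "(\<lambda>z. (?Z i z)\<^sup>2) \<in> borel_measurable (?S \<Otimes>\<^sub>M M)" by measurable
    qed
  next
    show "(\<lambda>\<omega>. \<epsilon> i * X (t i) \<omega>) \<in> borel_measurable M" for i by measurable
    show "?Z i \<in> borel_measurable (?S \<Otimes>\<^sub>M M)" for i by measurable
  qed
  also have "{z \<in> space (?S \<Otimes>\<^sub>M M). \<forall>i<n. ?Z i z \<le> w i} = E"
    by (simp only: E_def)
  also have "measure (?S \<Otimes>\<^sub>M M) E = (\<integral>z. indicator E z \<partial>(?S \<Otimes>\<^sub>M M))"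
  proof -
    have "E \<inter> space (?S \<Otimes>\<^sub>M M) = E" unfolding E_def by blast
    then show ?thesis by (simp only: Bochner_Integration.integral_indicator)
  qed
  also have "\<dots> = (\<integral>x. \<integral>\<omega>. indicator E (x, \<omega>) \<partial>M \<partial>?S)"
    by (rule P.integral_fst'[symmetric], rule P.integrable_const_bound[where B=1]) auto
  also have "\<dots> = (\<integral>x. prob {\<omega> \<in> space M. \<forall>i<n. \<epsilon> i * (R (t 0) (t i) * x + (X (t i) \<omega> - R (t 0) (t i) * X (t 0) \<omega>)) \<le> w i} \<partial>?S)"
  proof (rule Bochner_Integration.integral_cong[OF refl])
    fix x
    let ?A = "{\<omega> \<in> space M. \<forall>i<n. \<epsilon> i * (R (t 0) (t i) * x + (X (t i) \<omega> - R (t 0) (t i) * X (t 0) \<omega>)) \<le> w i}"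
    have "(\<integral>\<omega>. indicator E (x, \<omega>) \<partial>M) = (\<integral>\<omega>. indicator ?A \<omega> \<partial>M)"
      by (intro Bochner_Integration.integral_cong) (auto simp: E_def indicator_def space_pair_measure)
    also have "\<dots> = prob (?A \<inter> space M)"
      by (rule Bochner_Integration.integral_indicator)
    also have "?A \<inter> space M = ?A" by blast
    finally show "(\<integral>\<omega>. indicator E (x, \<omega>) \<partial>M) = prob ?A" .
  qed
  finally show ?thesis .
qed

end

lemma (in prob_space) measurable_prob_param:
  assumes [measurable]: "Measurable.pred (borel \<Otimes>\<^sub>M M) P"
  shows "(\<lambda>x. prob {\<omega> \<in> space M. P (x, \<omega>)}) \<in> borel_measurable borel"
proof -
  have "(\<lambda>z. indicator {z \<in> space (borel \<Otimes>\<^sub>M M). P z} z :: real) \<in> borel_measurable (borel \<Otimes>\<^sub>M M)"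
    by measurable
  also have "?this \<longleftrightarrow> (\<lambda>(x, \<omega>). indicator {\<omega> \<in> space M. P (x, \<omega>)} \<omega> :: real) \<in> borel_measurable (borel \<Otimes>\<^sub>M M)"
    by (intro measurable_cong) (auto simp: space_pair_measure indicator_def)
  finally show ?thesis
    using borel_measurable_lebesgue_integral by fastforce
qed

text \<open>The complement of the box form, taken inside the integral; maxima over a grid call for
  this version.\<close>

lemma (in gaussian_field) prob_regression_ex:
  fixes t :: "nat \<Rightarrow> real"
  assumes t: "\<And>i. 0 \<le> t i" and R0: "R (t 0) (t 0) = 1"
  shows "prob {\<omega> \<in> space M. \<exists>i<n. w i < X (t i) \<omega>}
    = (\<integral>x. prob {\<omega> \<in> space M. \<exists>i<n. w i < R (t 0) (t i) * x + (X (t i) \<omega> - R (t 0) (t i) * X (t 0) \<omega>)} \<partial>std_normal_distribution)"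
    (is "_ = (\<integral>x. prob (?E x) \<partial>_)")
proof -
  note [measurable] = field_measurable[OF t]
  define A where "A x = {\<omega> \<in> space M. \<forall>i<n. R (t 0) (t i) * x + (X (t i) \<omega> - R (t 0) (t i) * X (t 0) \<omega>) \<le> w i}" for x
  have A [measurable]: "A x \<in> events" for x unfolding A_def by measurable
  have "(\<lambda>x. prob {\<omega> \<in> space M. (\<lambda>(x, \<omega>). \<forall>i<n. R (t 0) (t i) * x + (X (t i) \<omega> - R (t 0) (t i) * X (t 0) \<omega>) \<le> w i) (x, \<omega>)}) \<in> borel_measurable borel"
    by (rule measurable_prob_param) measurable
  then have [measurable]: "(\<lambda>x. prob (A x)) \<in> borel_measurable borel"
    by (simp add: A_def)
  have int: "integrable std_normal_distribution (\<lambda>x. prob (A x))"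
    by (rule std_normal.integrable_const_bound[where B=1]) auto
  have "prob {\<omega> \<in> space M. \<exists>i<n. w i < X (t i) \<omega>} = prob (space M - {\<omega> \<in> space M. \<forall>i<n. 1 * X (t i) \<omega> \<le> w i})"
    by (intro arg_cong[where f=prob]) (auto simp: not_le)
  also have "\<dots> = 1 - prob {\<omega> \<in> space M. \<forall>i<n. 1 * X (t i) \<omega> \<le> w i}"
    by (rule prob_compl) measurable
  also have "prob {\<omega> \<in> space M. \<forall>i<n. 1 * X (t i) \<omega> \<le> w i} = (\<integral>x. prob (A x) \<partial>std_normal_distribution)"
    using prob_regression[where t=t and \<epsilon>="\<lambda>_. 1" and w=w and n=n, OF t R0] by (simp add: A_def)
  also have "1 - (\<integral>x. prob (A x) \<partial>std_normal_distribution) = (\<integral>x. 1 - prob (A x) \<partial>std_normal_distribution)"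
    using int by (simp add: std_normal.prob_space[simplified])
  also have "\<dots> = (\<integral>x. prob (?E x) \<partial>std_normal_distribution)"
  proof (intro Bochner_Integration.integral_cong refl)
    fix x
    have "?E x = space M - A x" by (auto simp: A_def not_le)
    then show "1 - prob (A x) = prob (?E x)" using prob_compl[OF A] by simp
  qed
  finally show ?thesis .
qed

section \<open>High exceedances on a finite grid\<close>

lemma nn_integral_exp_minus:
  "(\<integral>\<^sup>+ z. ennreal (exp (- z)) * indicator {b..} z \<partial>lborel) = ennreal (exp (- b))"
proof -
  have "((\<lambda>z::real. - exp (- z)) \<longlongrightarrow> 0) at_top" by real_asymp
  then have "(\<integral>\<^sup>+ z. ennreal (exp (- z)) * indicator {b..} z \<partial>lborel) = ennreal (0 - (- exp (- b)))"
    by (intro nn_integral_FTC_atLeast) (auto intro!: derivative_eq_intros)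
  then show ?thesis by simp
qed

text \<open>The two processes live on separate probability spaces and are linked only by \<alpha>.
  No path property is assumed: everything up to the grid limit concerns finitely many times.\<close>

locale pickands_fields =
  X: gaussian_field M X "\<lambda>s t. r \<bar>s - t\<bar>" +
  B: gaussian_field N B "\<lambda>s t. (s powr \<alpha> + t powr \<alpha> - \<bar>t - s\<bar> powr \<alpha>) / 2"
  for M :: "'a measure" and X r and N :: "'b measure" and B \<alpha> +
  fixes C :: real
  assumes r_0: "r 0 = 1" and \<alpha>: "0 < \<alpha>" "\<alpha> \<le> 2" and C: "0 < C"
    and A1: "((\<lambda>t. (r t - (1 - C * t powr \<alpha>)) / t powr \<alpha>) \<longlongrightarrow> 0) (at_right 0)"
    and A2: "\<And>t. t > 0 \<Longrightarrow> r t < 1"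
begin

definition q :: "real \<Rightarrow> real" where
  "q u = C powr (- 1 / \<alpha>) * u powr (- 2 / \<alpha>)"

definition Z :: "real \<Rightarrow> 'b \<Rightarrow> real" where
  "Z t \<omega> = sqrt 2 * B t \<omega> - t powr \<alpha>"

lemma Z_measurable [measurable]: "0 \<le> t \<Longrightarrow> Z t \<in> borel_measurable N"
  unfolding Z_def by measurable

lemma q_pos: "0 < u \<Longrightarrow> 0 < q u"
  using C by (simp add: q_def)

lemma q_nonneg: "0 \<le> q u"
  by (simp add: q_def)

text \<open>This identity is the reason for the choice of \<open>q\<close>: it turns C (q u *
  s)^\<alpha> into s^\<alpha> / u^2.\<close>

lemma q_powr: "0 < u \<Longrightarrow> u\<^sup>2 * (q u) powr \<alpha> = 1 / C"
proof -
  assume u: "0 < u"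
  have "(q u) powr \<alpha> = C powr (- 1) * u powr (- 2)"
    using \<alpha> by (simp add: q_def powr_mult powr_powr)
  also have "u powr (- 2) = 1 / u\<^sup>2"
    using u by (simp add: powr_minus_divide)
  finally show ?thesis using u C by (simp add: powr_minus_divide)
qed

lemma q_tendsto_0: "(q \<longlongrightarrow> 0) at_top"
proof -
  have "((\<lambda>u. u powr (- 2 / \<alpha>)) \<longlongrightarrow> 0) at_top"
    using \<alpha> by (intro tendsto_neg_powr filterlim_ident) auto
  from tendsto_mult[OF tendsto_const this] show ?thesis by (simp add: q_def[abs_def])
qed

lemma r_le_1: "0 \<le> t \<Longrightarrow> r t \<le> 1"
  using A2[of t] r_0 by (cases "t = 0") auto

text \<open>The variance 2 + 2 r t of X 0 + X t is nonnegative.\<close>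

lemma r_ge_m1: "0 \<le> t \<Longrightarrow> -1 \<le> r t"
  using centered_gaussian_nonneg[OF X.gaussian_pair[of 0 t 1 1]] r_0 by simp

lemma r_local: "((\<lambda>t. (1 - r t) / t powr \<alpha>) \<longlongrightarrow> C) (at_right 0)"
proof -
  have "((\<lambda>t. C - (r t - (1 - C * t powr \<alpha>)) / t powr \<alpha>) \<longlongrightarrow> C - 0) (at_right 0)"
    by (intro tendsto_intros A1)
  moreover have "\<forall>\<^sub>F t in at_right 0. C - (r t - (1 - C * t powr \<alpha>)) / t powr \<alpha> = (1 - r t) / t powr \<alpha>"
    by (auto simp: eventually_at_right_field field_simps intro!: exI[of _ 1])
  ultimately show ?thesis by (simp add: tendsto_cong)
qed

lemma r_scaled_tendsto:
  assumes "0 \<le> s"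
  shows "((\<lambda>u. u\<^sup>2 * (1 - r (q u * s))) \<longlongrightarrow> s powr \<alpha>) at_top"
proof (cases "s = 0")
  case True
  then show ?thesis by (simp add: r_0)
next
  case False
  then have s: "0 < s" using assms by simp
  have "((\<lambda>u. q u * s) \<longlongrightarrow> 0) at_top"
    using tendsto_mult_left_zero[OF q_tendsto_0] by simp
  then have "filterlim (\<lambda>u. q u * s) (at_right 0) at_top"
    using s by (force simp: filterlim_at intro: eventually_mono[OF eventually_gt_at_top[of 0]] dest: q_pos)
  then have "((\<lambda>u. (1 - r (q u * s)) / (q u * s) powr \<alpha> * (s powr \<alpha> / C)) \<longlongrightarrow> C * (s powr \<alpha> / C)) at_top"
    by (intro tendsto_mult tendsto_const filterlim_compose[OF r_local])
  moreover have "\<forall>\<^sub>F u in at_top. (1 - r (q u * s)) / (q u * s) powr \<alpha> * (s powr \<alpha> / C) = u\<^sup>2 * (1 - r (q u * s))"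
    using eventually_gt_at_top[of 0]
  proof eventually_elim
    case (elim u)
    have eq: "s powr \<alpha> / C = (q u * s) powr \<alpha> * u\<^sup>2"
      using q_powr[OF elim] s q_pos[OF elim] by (simp add: powr_mult mult_ac)
    have "(q u * s) powr \<alpha> > 0" using s q_pos[OF elim] by simp
    then show ?case unfolding eq by simp
  qed
  ultimately show ?thesis using C by (simp add: tendsto_cong)
qed

lemma r_scaled_tendsto_0:
  assumes "0 \<le> s"
  shows "((\<lambda>u. 1 - r (q u * s)) \<longlongrightarrow> 0) at_top"
proof -
  have "((\<lambda>u. u\<^sup>2 * (1 - r (q u * s)) * inverse (u\<^sup>2)) \<longlongrightarrow> s powr \<alpha> * 0) at_top"
    by (intro tendsto_mult r_scaled_tendsto[OF assms] tendsto_inverse_0_at_top filterlim_pow_at_top filterlim_ident) auto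
  moreover have "\<forall>\<^sub>F u in at_top. u\<^sup>2 * (1 - r (q u * s)) * inverse (u\<^sup>2) = 1 - r (q u * s)"
    using eventually_gt_at_top[of "0::real"] by eventually_elim (simp add: field_simps)
  ultimately show ?thesis by (simp add: tendsto_cong)
qed

text \<open>The factor sqrt 2 in \<open>Z\<close> doubles the covariance of \<open>B\<close> and so
  cancels its 1/2; the result is the limit found in \<open>V_cov_tendsto\<close>.\<close>

lemma gaussian_Z:
  fixes s c :: "nat \<Rightarrow> real" and n :: nat
  assumes s: "\<And>i. 0 \<le> s i"
  shows "centered_gaussian N (\<lambda>\<omega>. \<Sum>i<n. c i * (Z (s i) \<omega> + s i powr \<alpha>))
    (\<Sum>i<n. \<Sum>j<n. c i * c j * (s i powr \<alpha> + s j powr \<alpha> - \<bar>s i - s j\<bar> powr \<alpha>))"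
proof -
  have "centered_gaussian N (\<lambda>\<omega>. \<Sum>i<n. (c i * sqrt 2) * B (s i) \<omega>)
      (\<Sum>i<n. \<Sum>j<n. (c i * sqrt 2) * (c j * sqrt 2) * ((s i powr \<alpha> + s j powr \<alpha> - \<bar>s j - s i\<bar> powr \<alpha>) / 2))"
    by (rule B.gaussian_sum[where n=n and t=s and c="\<lambda>i. c i * sqrt 2"]) (rule s)
  moreover have cs: "(c i * sqrt 2) * (c j * sqrt 2) * ((s i powr \<alpha> + s j powr \<alpha> - \<bar>s j - s i\<bar> powr \<alpha>) / 2)
      = c i * c j * (s i powr \<alpha> + s j powr \<alpha> - \<bar>s i - s j\<bar> powr \<alpha>)" for i j
  proof -
    have "(c i * sqrt 2) * (c j * sqrt 2) = c i * c j * (sqrt 2 * sqrt 2)"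
      by (simp only: mult_ac)
    then have eq: "(c i * sqrt 2) * (c j * sqrt 2) = c i * c j * 2"
      by simp
    show ?thesis unfolding eq by (simp add: abs_minus_commute)
  qed
  ultimately have "centered_gaussian N (\<lambda>\<omega>. \<Sum>i<n. (c i * sqrt 2) * B (s i) \<omega>)
      (\<Sum>i<n. \<Sum>j<n. c i * c j * (s i powr \<alpha> + s j powr \<alpha> - \<bar>s i - s j\<bar> powr \<alpha>))"
    by (simp only:)
  then show ?thesis by (simp add: Z_def mult.assoc)
qed

text \<open>\<open>V u z i\<close> is \<open>u (X (q u * s i) - u)\<close> conditioned on \<open>X 0 = u + z / u\<close>, up to the shift by \<open>z\<close>.\<close>
definition V :: "(nat \<Rightarrow> real) \<Rightarrow> real \<Rightarrow> real \<Rightarrow> nat \<Rightarrow> 'a \<Rightarrow> real" where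
  "V s z u i \<omega> = u * (X (q u * s i) \<omega> - r (q u * s i) * X 0 \<omega>) - (1 - r (q u * s i)) * (u\<^sup>2 + z)"

lemma V_measurable [measurable]: "(\<And>i. 0 \<le> s i) \<Longrightarrow> V s z u i \<in> borel_measurable M"
proof -
  assume "\<And>i. 0 \<le> s i"
  then have "0 \<le> q u * s i" using q_nonneg[of u] by simp
  note [measurable] = X.field_measurable[OF this] X.field_measurable[OF order_refl]
  show "V s z u i \<in> borel_measurable M" unfolding V_def by measurable
qed

section \<open>Limit of the conditioned process at finitely many times\<close>

context
  fixes s :: "nat \<Rightarrow> real"
  assumes s: "\<And>i. 0 \<le> s i" and s_0: "s 0 = 0"
begin

lemma gaussian_residual_scaled:
  "centered_gaussian M (\<lambda>\<omega>. \<Sum>i<n. c i * (X (q u * s i) \<omega> - r (q u * s i) * X 0 \<omega>))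
    (\<Sum>i<n. \<Sum>j<n. c i * c j * (r (q u * \<bar>s i - s j\<bar>) - r (q u * s i) * r (q u * s j)))"
proof -
  have "\<bar>q u * s i - q u * s j\<bar> = q u * \<bar>s i - s j\<bar>" for i j
    using q_nonneg[of u] by (simp add: right_diff_distrib[symmetric] abs_mult)
  then show ?thesis
    using X.gaussian_residual[where t="\<lambda>i. q u * s i" and n=n and c=c] s s_0 q_nonneg[of u] r_0
    by (simp add: abs_mult)
qed

text \<open>The value z enters the drift only through (1 - r) z, which vanishes; hence the limit law
  does not depend on z.\<close>

lemma V_mean_tendsto:
  "((\<lambda>u. (1 - r (q u * s i)) * (u\<^sup>2 + z)) \<longlongrightarrow> s i powr \<alpha>) at_top"
proof -
  have "((\<lambda>u. u\<^sup>2 * (1 - r (q u * s i)) + (1 - r (q u * s i)) * z) \<longlongrightarrow> s i powr \<alpha> + 0 * z) at_top"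
    by (intro tendsto_intros r_scaled_tendsto r_scaled_tendsto_0 s)
  then show ?thesis by (simp add: algebra_simps)
qed

text \<open>With r_ij the correlation between times i and j, and r_i that between times i and 0,
  r_ij - r_i r_j = (1 - r_i) + (1 - r_j) - (1 - r_ij) - (1 - r_i)(1 - r_j). Multiplied by u^2 the
  first three terms converge separately, while the product still vanishes.\<close>

lemma V_cov_tendsto:
  "((\<lambda>u. u\<^sup>2 * (r (q u * \<bar>s i - s j\<bar>) - r (q u * s i) * r (q u * s j)))
     \<longlongrightarrow> s i powr \<alpha> + s j powr \<alpha> - \<bar>s i - s j\<bar> powr \<alpha>) at_top"
proof -
  have "((\<lambda>u. u\<^sup>2 * (1 - r (q u * s i)) + u\<^sup>2 * (1 - r (q u * s j)) - u\<^sup>2 * (1 - r (q u * \<bar>s i - s j\<bar>))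
        - u\<^sup>2 * (1 - r (q u * s i)) * (1 - r (q u * s j)))
      \<longlongrightarrow> s i powr \<alpha> + s j powr \<alpha> - \<bar>s i - s j\<bar> powr \<alpha> - s i powr \<alpha> * 0) at_top"
    by (intro tendsto_intros r_scaled_tendsto r_scaled_tendsto_0 s) auto
  then show ?thesis by (simp add: algebra_simps)
qed

lemma V_char_tendsto:
  "((\<lambda>u. \<integral>\<omega>. iexp (\<Sum>i<n. c i * V s z u i \<omega>) \<partial>M) \<longlongrightarrow> (\<integral>\<omega>. iexp (\<Sum>i<n. c i * Z (s i) \<omega>) \<partial>N)) at_top"
proof -
  let ?m = "\<lambda>u i. (1 - r (q u * s i)) * (u\<^sup>2 + z)"
  let ?v = "\<lambda>u. \<Sum>i<n. \<Sum>j<n. c i * c j * (u\<^sup>2 * (r (q u * \<bar>s i - s j\<bar>) - r (q u * s i) * r (q u * s j)))"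
  let ?v' = "\<Sum>i<n. \<Sum>j<n. c i * c j * (s i powr \<alpha> + s j powr \<alpha> - \<bar>s i - s j\<bar> powr \<alpha>)"
  have "(\<integral>\<omega>. iexp (\<Sum>i<n. c i * V s z u i \<omega>) \<partial>M) = iexp (- (\<Sum>i<n. c i * ?m u i)) * of_real (exp (- ?v u / 2))" for u
  proof -
    have "(\<Sum>i<n. c i * V s z u i \<omega>) = - (\<Sum>i<n. c i * ?m u i) + (\<Sum>i<n. (c i * u) * (X (q u * s i) \<omega> - r (q u * s i) * X 0 \<omega>))" for \<omega>
      unfolding V_def sum_negf[symmetric] sum.distrib[symmetric] by (intro sum.cong refl) (simp add: algebra_simps)
    then have "(\<integral>\<omega>. iexp (\<Sum>i<n. c i * V s z u i \<omega>) \<partial>M)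
        = iexp (- (\<Sum>i<n. c i * ?m u i)) * (\<integral>\<omega>. iexp (\<Sum>i<n. (c i * u) * (X (q u * s i) \<omega> - r (q u * s i) * X 0 \<omega>)) \<partial>M)"
      by (simp only: of_real_add distrib_left exp_add integral_mult_right_zero)
    also have "(\<integral>\<omega>. iexp (\<Sum>i<n. (c i * u) * (X (q u * s i) \<omega> - r (q u * s i) * X 0 \<omega>)) \<partial>M) = of_real (exp (- ?v u / 2))"
      by (subst centered_gaussian_char[OF gaussian_residual_scaled]) (simp add: power2_eq_square mult_ac)
    finally show ?thesis .
  qed
  moreover have "(\<integral>\<omega>. iexp (\<Sum>i<n. c i * Z (s i) \<omega>) \<partial>N) = iexp (- (\<Sum>i<n. c i * s i powr \<alpha>)) * of_real (exp (- ?v' / 2))"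
  proof -
    have "(\<Sum>i<n. c i * Z (s i) \<omega>) = - (\<Sum>i<n. c i * s i powr \<alpha>) + (\<Sum>i<n. c i * (Z (s i) \<omega> + s i powr \<alpha>))" for \<omega>
      unfolding sum_negf[symmetric] sum.distrib[symmetric] by (intro sum.cong refl) (simp add: algebra_simps)
    then have "(\<integral>\<omega>. iexp (\<Sum>i<n. c i * Z (s i) \<omega>) \<partial>N)
        = iexp (- (\<Sum>i<n. c i * s i powr \<alpha>)) * (\<integral>\<omega>. iexp (\<Sum>i<n. c i * (Z (s i) \<omega> + s i powr \<alpha>)) \<partial>N)"
      by (simp only: of_real_add distrib_left exp_add integral_mult_right_zero)
    also have "(\<integral>\<omega>. iexp (\<Sum>i<n. c i * (Z (s i) \<omega> + s i powr \<alpha>)) \<partial>N) = of_real (exp (- ?v' / 2))"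
      by (subst centered_gaussian_char[OF gaussian_Z[OF s]]) simp
    finally show ?thesis .
  qed
  moreover have "((\<lambda>u. iexp (- (\<Sum>i<n. c i * ?m u i)) * of_real (exp (- ?v u / 2)))
      \<longlongrightarrow> iexp (- (\<Sum>i<n. c i * s i powr \<alpha>)) * of_real (exp (- ?v' / 2))) at_top"
    by (intro tendsto_intros V_mean_tendsto V_cov_tendsto) auto
  ultimately show ?thesis by simp
qed

lemma residual_scaled_1:
  "centered_gaussian M (\<lambda>\<omega>. u * (X (q u * s i) \<omega> - r (q u * s i) * X 0 \<omega>)) (u\<^sup>2 * (1 - (r (q u * s i))\<^sup>2))"
  using gaussian_residual_scaled[where c="\<lambda>j. if j = i then u else 0" and n="Suc i" and u=u] r_0
  by (simp add: power2_eq_square if_distrib[where f="\<lambda>x. x * _"] mult.assoc if_distribR cong: if_cong)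

text \<open>An exact value, so that the uniform second-moment bound required by
  \<open>prob_box_tendsto\<close> follows from convergence of its two terms.\<close>

lemma V_second_moment:
  "integrable M (\<lambda>\<omega>. (V s z u i \<omega>)\<^sup>2)"
  "(\<integral>\<omega>. (V s z u i \<omega>)\<^sup>2 \<partial>M) = u\<^sup>2 * (1 - (r (q u * s i))\<^sup>2) + ((1 - r (q u * s i)) * (u\<^sup>2 + z))\<^sup>2"
proof -
  note m = centered_gaussian_moments[OF residual_scaled_1[of u i]]
  let ?Y = "\<lambda>\<omega>. u * (X (q u * s i) \<omega> - r (q u * s i) * X 0 \<omega>)"
  let ?m = "(1 - r (q u * s i)) * (u\<^sup>2 + z)"
  have eq: "(V s z u i \<omega>)\<^sup>2 = (?Y \<omega>)\<^sup>2 + (- 2 * ?m * ?Y \<omega> + ?m\<^sup>2)" for \<omega>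
    unfolding V_def by (simp add: power2_diff)
  show "integrable M (\<lambda>\<omega>. (V s z u i \<omega>)\<^sup>2)"
    unfolding eq by (intro Bochner_Integration.integrable_add m integrable_mult_right X.integrable_const)
  have "(\<integral>\<omega>. (?Y \<omega>)\<^sup>2 + (- 2 * ?m * ?Y \<omega> + ?m\<^sup>2) \<partial>M) = (\<integral>\<omega>. (?Y \<omega>)\<^sup>2 \<partial>M) + (- 2 * ?m * (\<integral>\<omega>. ?Y \<omega> \<partial>M) + ?m\<^sup>2)"
    by (subst Bochner_Integration.integral_add, intro m,
        intro Bochner_Integration.integrable_add m integrable_mult_right X.integrable_const,
        subst Bochner_Integration.integral_add, intro m integrable_mult_right, intro X.integrable_const,
        simp only: integral_mult_right_zero X.prob_space lebesgue_integral_const scaleR_one)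
  then show "(\<integral>\<omega>. (V s z u i \<omega>)\<^sup>2 \<partial>M) = u\<^sup>2 * (1 - (r (q u * s i))\<^sup>2) + ?m\<^sup>2"
    unfolding eq m by simp
qed

lemma gaussian_Z_single: "centered_gaussian N (\<lambda>\<omega>. Z (s i) \<omega> + s i powr \<alpha>) (2 * s i powr \<alpha>)"
  using gaussian_Z[where s="\<lambda>_. s i" and n=1 and c="\<lambda>_. 1"] s \<alpha> by simp

lemma Z_second_moment:
  "integrable N (\<lambda>\<omega>. (Z (s i) \<omega>)\<^sup>2)"
  "(\<integral>\<omega>. (Z (s i) \<omega>)\<^sup>2 \<partial>N) = 2 * s i powr \<alpha> + (s i powr \<alpha>)\<^sup>2"
proof -
  note m = centered_gaussian_moments[OF gaussian_Z_single[of i]]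
  let ?Y = "\<lambda>\<omega>. Z (s i) \<omega> + s i powr \<alpha>"
  let ?m = "s i powr \<alpha>"
  have eq: "(Z (s i) \<omega>)\<^sup>2 = (?Y \<omega>)\<^sup>2 + (- 2 * ?m * ?Y \<omega> + ?m\<^sup>2)" for \<omega>
    by (simp add: power2_eq_square algebra_simps)
  show "integrable N (\<lambda>\<omega>. (Z (s i) \<omega>)\<^sup>2)"
    unfolding eq by (intro Bochner_Integration.integrable_add m integrable_mult_right B.integrable_const)
  have "(\<integral>\<omega>. (?Y \<omega>)\<^sup>2 + (- 2 * ?m * ?Y \<omega> + ?m\<^sup>2) \<partial>N) = (\<integral>\<omega>. (?Y \<omega>)\<^sup>2 \<partial>N) + (- 2 * ?m * (\<integral>\<omega>. ?Y \<omega> \<partial>N) + ?m\<^sup>2)"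
    by (subst Bochner_Integration.integral_add, intro m,
        intro Bochner_Integration.integrable_add m integrable_mult_right B.integrable_const,
        subst Bochner_Integration.integral_add, intro m integrable_mult_right, intro B.integrable_const,
        simp only: integral_mult_right_zero B.prob_space lebesgue_integral_const scaleR_one)
  then show "(\<integral>\<omega>. (Z (s i) \<omega>)\<^sup>2 \<partial>N) = 2 * s i powr \<alpha> + ?m\<^sup>2"
    unfolding eq m by simp
qed

lemma Z_AE_neq:
  assumes "0 < s i \<or> w \<noteq> 0"
  shows "AE \<omega> in N. Z (s i) \<omega> \<noteq> w"
proof -
  have "AE \<omega> in N. Z (s i) \<omega> + s i powr \<alpha> \<noteq> w + s i powr \<alpha>"
    by (rule centered_gaussian_AE_neq[OF B.prob_space_axioms gaussian_Z_single])
      (use assms s[of i] in auto)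
  then show ?thesis by simp
qed

text \<open>The level w = 0 is excluded because \<open>Z (s 0)\<close> is almost surely 0, an atom
  on the boundary of the box.\<close>

lemma V_box_tendsto:
  assumes "w \<noteq> 0"
  shows "((\<lambda>u. measure M {\<omega> \<in> space M. \<exists>i<n. w < V s z u i \<omega>}) \<longlongrightarrow> measure N {\<omega> \<in> space N. \<exists>i<n. w < Z (s i) \<omega>}) at_top"
proof -
  let ?L = "\<lambda>i. 2 * s i powr \<alpha> + (s i powr \<alpha>)\<^sup>2"
  have [measurable]: "V s z u i \<in> borel_measurable M" "Z (s i) \<in> borel_measurable N" for u i
    by (auto intro: V_measurable Z_measurable s)
  have "((\<lambda>u. measure M {\<omega> \<in> space M. \<forall>i<n. V s z u i \<omega> \<le> w}) \<longlongrightarrow> measure N {\<omega> \<in> space N. \<forall>i<n. Z (s i) \<omega> \<le> w}) at_top"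
  proof (rule prob_box_tendsto[OF X.prob_space_axioms B.prob_space_axioms, where K="\<lambda>i. ?L i + 1"])
    fix i
    have "((\<lambda>u. u\<^sup>2 * (1 - r (q u * s i)) * (2 - (1 - r (q u * s i))) + ((1 - r (q u * s i)) * (u\<^sup>2 + z))\<^sup>2)
        \<longlongrightarrow> s i powr \<alpha> * (2 - 0) + (s i powr \<alpha>)\<^sup>2) at_top"
      by (intro tendsto_intros r_scaled_tendsto r_scaled_tendsto_0 V_mean_tendsto s)
    also have "(\<lambda>u. u\<^sup>2 * (1 - r (q u * s i)) * (2 - (1 - r (q u * s i))) + ((1 - r (q u * s i)) * (u\<^sup>2 + z))\<^sup>2)
        = (\<lambda>u. \<integral>\<omega>. (V s z u i \<omega>)\<^sup>2 \<partial>M)"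
      unfolding V_second_moment by (simp add: power2_eq_square algebra_simps)
    finally have "\<forall>\<^sub>F u in at_top. (\<integral>\<omega>. (V s z u i \<omega>)\<^sup>2 \<partial>M) < ?L i + 1"
      by (rule order_tendstoD) simp
    then show "\<forall>\<^sub>F u in at_top. integrable M (\<lambda>\<omega>. (V s z u i \<omega>)\<^sup>2) \<and> (\<integral>\<omega>. (V s z u i \<omega>)\<^sup>2 \<partial>M) \<le> ?L i + 1"
      by eventually_elim (simp add: V_second_moment(1))
    show "AE \<omega> in N. Z (s i) \<omega> \<noteq> w" using assms by (intro Z_AE_neq) simp
    show "((\<lambda>u. \<integral>\<omega>. iexp (\<Sum>i<n. c i * V s z u i \<omega>) \<partial>M) \<longlongrightarrow> (\<integral>\<omega>. iexp (\<Sum>i<n. c i * Z (s i) \<omega>) \<partial>N)) at_top" for c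
      by (rule V_char_tendsto)
  qed (auto simp: Z_second_moment)
  then have "((\<lambda>u. 1 - measure M {\<omega> \<in> space M. \<forall>i<n. V s z u i \<omega> \<le> w}) \<longlongrightarrow> 1 - measure N {\<omega> \<in> space N. \<forall>i<n. Z (s i) \<omega> \<le> w}) at_top"
    by (intro tendsto_intros)
  moreover have "1 - measure M {\<omega> \<in> space M. \<forall>i<n. V s z u i \<omega> \<le> w} = measure M {\<omega> \<in> space M. \<exists>i<n. w < V s z u i \<omega>}" for u
    by (subst X.prob_compl[symmetric]) (auto intro!: arg_cong[where f="measure M"])
  moreover have "1 - measure N {\<omega> \<in> space N. \<forall>i<n. Z (s i) \<omega> \<le> w} = measure N {\<omega> \<in> space N. \<exists>i<n. w < Z (s i) \<omega>}"
    by (subst B.prob_compl[symmetric]) (auto intro!: arg_cong[where f="measure N"])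
  ultimately show ?thesis by simp
qed

text \<open>Regression on X 0 followed by the substitution x = u + z/u. The shift \<gamma> is there
  for the chaining, which compares with the level u - a^\<beta>/u instead of u.\<close>

lemma prob_grid_eq_integral:
  assumes u: "0 < u"
  shows "measure M {\<omega> \<in> space M. \<exists>i<n. u - \<gamma> / u < X (q u * s i) \<omega>}
    = std_normal_density u / u * (\<integral>z. exp (- z - z\<^sup>2 / (2 * u\<^sup>2)) * measure M {\<omega> \<in> space M. \<exists>i<n. - z - \<gamma> < V s z u i \<omega>} \<partial>lborel)"
proof -
  have qs: "0 \<le> q u * s i" for i using q_nonneg[of u] s by simp
  note [measurable] = X.field_measurable[OF qs] X.field_measurable[OF order_refl]
  define H where "H x = measure M {\<omega> \<in> space M. \<exists>i<n. u - \<gamma> / u < r (q u * s i) * x + (X (q u * s i) \<omega> - r (q u * s i) * X 0 \<omega>)}" for x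
  have "(\<lambda>x. measure M {\<omega> \<in> space M. (\<lambda>(x, \<omega>). \<exists>i<n. u - \<gamma> / u < r (q u * s i) * x + (X (q u * s i) \<omega> - r (q u * s i) * X 0 \<omega>)) (x, \<omega>)}) \<in> borel_measurable borel"
    by (rule X.measurable_prob_param) measurable
  then have [measurable]: "H \<in> borel_measurable borel" by (simp add: H_def[abs_def])
  have "measure M {\<omega> \<in> space M. \<exists>i<n. u - \<gamma> / u < X (q u * s i) \<omega>} = (\<integral>x. H x \<partial>std_normal_distribution)"
    using X.prob_regression_ex[where t="\<lambda>i. q u * s i" and n=n and w="\<lambda>_. u - \<gamma> / u"] qs s_0 r_0
    by (simp add: H_def)
  also have "\<dots> = (\<integral>x. std_normal_density x * H x \<partial>lborel)"
    by (subst integral_real_density) auto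
  also have "\<dots> = (1 / u) * (\<integral>z. std_normal_density (u + (1 / u) * z) * H (u + (1 / u) * z) \<partial>lborel)"
    using u by (subst lborel_integral_real_affine[where c="1 / u" and t=u]) auto
  also have "\<dots> = (1 / u) * (\<integral>z. std_normal_density u * (exp (- z - z\<^sup>2 / (2 * u\<^sup>2)) * measure M {\<omega> \<in> space M. \<exists>i<n. - z - \<gamma> < V s z u i \<omega>}) \<partial>lborel)"
  proof (intro arg_cong[where f="\<lambda>x. (1 / u) * x"] Bochner_Integration.integral_cong refl)
    fix z
    have "std_normal_density (u + (1 / u) * z) = std_normal_density u * exp (- z - z\<^sup>2 / (2 * u\<^sup>2))"
      using u by (simp add: std_normal_density_def mult_exp_exp field_simps power2_eq_square)
    moreover have "H (u + (1 / u) * z) = measure M {\<omega> \<in> space M. \<exists>i<n. - z - \<gamma> < V s z u i \<omega>}"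
    proof -
      have "(u - \<gamma> / u < \<rho> * (u + (1 / u) * z) + y) \<longleftrightarrow> (- z - \<gamma> < u * y - (1 - \<rho>) * (u\<^sup>2 + z))" for \<rho> y
      proof -
        have "(u - \<gamma> / u < \<rho> * (u + (1 / u) * z) + y) \<longleftrightarrow> u * (u - \<gamma> / u) < u * (\<rho> * (u + (1 / u) * z) + y)"
          using u by simp
        also have "u * (u - \<gamma> / u) = u\<^sup>2 - \<gamma>" using u by (simp add: power2_eq_square algebra_simps)
        also have "u * (\<rho> * (u + (1 / u) * z) + y) = \<rho> * (u\<^sup>2 + z) + u * y" using u by (simp add: power2_eq_square algebra_simps)
        finally show ?thesis by (auto simp: algebra_simps)
      qed
      then show ?thesis by (simp add: H_def V_def)
    qed
    ultimately show "std_normal_density (u + (1 / u) * z) * H (u + (1 / u) * z)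
      = std_normal_density u * (exp (- z - z\<^sup>2 / (2 * u\<^sup>2)) * measure M {\<omega> \<in> space M. \<exists>i<n. - z - \<gamma> < V s z u i \<omega>})"
      by simp
  qed
  finally show ?thesis by simp
qed


text \<open>Dominated convergence in z, then Fubini: integrating exp(-z) over z > - max - \<gamma>
  gives exp(max + \<gamma>). Integrability of exp max falls out of the same computation, since the
  limit inherits the dominating function.\<close>

lemma grid_probability_tendsto:
  assumes n: "0 < n"
  shows "integrable N (\<lambda>\<omega>. exp (Max ((\<lambda>i. Z (s i) \<omega>) ` {..<n})))" (is "integrable N (\<lambda>\<omega>. exp (?mx \<omega>))")
    and "((\<lambda>u. measure M {\<omega> \<in> space M. \<exists>i<n. u - \<gamma> / u < X (q u * s i) \<omega>} / (std_normal_density u / u))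
      \<longlongrightarrow> exp \<gamma> * (\<integral>\<omega>. exp (Max ((\<lambda>i. Z (s i) \<omega>) ` {..<n})) \<partial>N)) at_top"
proof -
  have [measurable]: "V s z u i \<in> borel_measurable M" "Z (s i) \<in> borel_measurable N" for u i z
    by (auto intro: V_measurable Z_measurable s)
  have mx_meas [measurable]: "?mx \<in> borel_measurable N"
    by (rule borel_measurable_Max) auto
  have mx_iff: "w < ?mx \<omega> \<longleftrightarrow> (\<exists>i<n. w < Z (s i) \<omega>)" for w \<omega>
    using n by (subst Max_gr_iff) auto
  define p where "p u z = measure M {\<omega> \<in> space M. \<exists>i<n. - z - \<gamma> < V s z u i \<omega>}" for u z
  define p' where "p' z = measure N {\<omega> \<in> space N. \<exists>i<n. - z - \<gamma> < Z (s i) \<omega>}" for z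
  have [measurable]: "p u \<in> borel_measurable borel" for u
  proof -
    have qs: "0 \<le> q u * s i" for i using q_nonneg[of u] s by simp
    note [measurable] = X.field_measurable[OF qs] X.field_measurable[OF order_refl]
    have "Measurable.pred (borel \<Otimes>\<^sub>M M) (\<lambda>(z, \<omega>). \<exists>i<n. - z - \<gamma> <
        u * (X (q u * s i) \<omega> - r (q u * s i) * X 0 \<omega>) - (1 - r (q u * s i)) * (u\<^sup>2 + z))"
      by measurable
    from X.measurable_prob_param[OF this] show ?thesis
      by (simp add: p_def[abs_def] V_def)
  qed
  have [measurable]: "p' \<in> borel_measurable borel"
  proof -
    have "Measurable.pred (borel \<Otimes>\<^sub>M N) (\<lambda>(z, \<omega>). \<exists>i<n. - z - \<gamma> < Z (s i) \<omega>)"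
      by measurable
    from B.measurable_prob_param[OF this] show ?thesis
      by (simp add: p'_def[abs_def])
  qed
  define K where "K = Max ((\<lambda>i. s i powr \<alpha>) ` {..<n}) + 1"
  have K: "s i powr \<alpha> < K" if "i < n" for i
  proof -
    have "s i powr \<alpha> \<le> Max ((\<lambda>i. s i powr \<alpha>) ` {..<n})" by (rule Max_ge) (use that in auto)
    then show ?thesis unfolding K_def by linarith
  qed
  have "0 \<le> s 0 powr \<alpha>" by simp
  with K[OF n] have K0: "0 \<le> K" by linarith
  \<comment> \<open>For z \<ge> 0 the factor 1 suffices; for z < 0 a union bound over the n points
    gives the second entry.\<close>
  define D where "D = max 1 (real n * exp (4 * \<gamma> + 16 * K))"
  have bound: "\<forall>\<^sub>F u in at_top. \<forall>i<n. 1 - r (q u * s i) \<le> 1 / 2 \<and> u\<^sup>2 * (1 - r (q u * s i)) \<le> K"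
  proof -
    have "\<forall>\<^sub>F u in at_top. \<forall>i\<in>{..<n}. 1 - r (q u * s i) < 1 / 2 \<and> u\<^sup>2 * (1 - r (q u * s i)) < K"
    proof (intro eventually_ball_finite ballI eventually_conj)
      fix i assume i: "i \<in> {..<n}"
      show "\<forall>\<^sub>F u in at_top. 1 - r (q u * s i) < 1 / 2"
        by (rule order_tendstoD(2)[OF r_scaled_tendsto_0[OF s]]) simp
      show "\<forall>\<^sub>F u in at_top. u\<^sup>2 * (1 - r (q u * s i)) < K"
        by (rule order_tendstoD(2)[OF r_scaled_tendsto[OF s]]) (use K i in auto)
    qed auto
    then show ?thesis by eventually_elim (auto intro: less_imp_le)
  qed
  have p_le: "exp (- z) * p u z \<le> D * exp (- \<bar>z\<bar>)"
    if u: "\<forall>i<n. 1 - r (q u * s i) \<le> 1 / 2 \<and> u\<^sup>2 * (1 - r (q u * s i)) \<le> K" for u z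
  proof (cases "0 \<le> z")
    case True
    have "exp (- z) * p u z \<le> exp (- z) * 1" unfolding p_def by (intro mult_left_mono) auto
    also have "\<dots> \<le> exp (- z) * D" unfolding D_def by (intro mult_left_mono) auto
    finally show ?thesis using True by (simp add: mult.commute)
  next
    case False
    define Y where "Y i \<omega> = u * (X (q u * s i) \<omega> - r (q u * s i) * X 0 \<omega>)" for i \<omega>
    have Y: "centered_gaussian M (Y i) (u\<^sup>2 * (1 - (r (q u * s i))\<^sup>2))" for i
      unfolding Y_def by (rule residual_scaled_1)
    note [measurable] = centered_gaussian_measurable[OF Y]
    have qs: "0 \<le> q u * s i" for i using q_nonneg[of u] s by simp
    have tail: "measure M {\<omega> \<in> space M. - z / 2 - \<gamma> \<le> Y i \<omega>} \<le> exp (2 * z + 4 * \<gamma> + 16 * K)" if i: "i < n" for i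
    proof -
      \<comment> \<open>The exponent 4 turns the level - z/2 into exp(2 z), which beats the weight
        exp(- z) and leaves exp z, integrable on the negative half-line.\<close>
      have "measure M {\<omega> \<in> space M. - z / 2 - \<gamma> \<le> Y i \<omega>} \<le> exp (- 4 * (- z / 2 - \<gamma>) + 4\<^sup>2 * (u\<^sup>2 * (1 - (r (q u * s i))\<^sup>2)) / 2)"
        by (rule centered_gaussian_exp_markov[OF X.prob_space_axioms Y]) simp
      also have "u\<^sup>2 * (1 - (r (q u * s i))\<^sup>2) = (u\<^sup>2 * (1 - r (q u * s i))) * (1 + r (q u * s i))"
        by (simp add: power2_eq_square algebra_simps)
      also have "\<dots> \<le> K * 2"
        using u i r_le_1[OF qs[of i]] r_ge_m1[OF qs[of i]] K0 by (intro mult_mono) auto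
      then have "- 4 * (- z / 2 - \<gamma>) + 4\<^sup>2 * ((u\<^sup>2 * (1 - r (q u * s i))) * (1 + r (q u * s i))) / 2 \<le> 2 * z + 4 * \<gamma> + 16 * K"
        by simp
      finally show ?thesis by simp
    qed
    have "p u z \<le> measure M (\<Union>i\<in>{..<n}. {\<omega> \<in> space M. - z / 2 - \<gamma> \<le> Y i \<omega>})"
      unfolding p_def
    proof (rule X.finite_measure_mono)
      show "{\<omega> \<in> space M. \<exists>i<n. - z - \<gamma> < V s z u i \<omega>} \<subseteq> (\<Union>i\<in>{..<n}. {\<omega> \<in> space M. - z / 2 - \<gamma> \<le> Y i \<omega>})"
      proof safe
        fix \<omega> i assume i: "i < n" and V: "- z - \<gamma> < V s z u i \<omega>" and "\<omega> \<in> space M"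
        have 0: "0 \<le> 1 - r (q u * s i)" using r_le_1[OF qs] by simp
        \<comment> \<open>For z < 0 the drift gives back at most half of |z|, so an exceedance still
          forces a deviation of order |z|/2.\<close>
        have "(1 - r (q u * s i)) * z \<ge> 1 / 2 * z"
          using u i False by (intro mult_right_mono_neg) auto
        moreover have "0 \<le> (1 - r (q u * s i)) * u\<^sup>2" using 0 by simp
        ultimately have "V s z u i \<omega> \<le> Y i \<omega> - z / 2"
          unfolding V_def Y_def[symmetric] by (simp only: distrib_left)
        then have "- z / 2 - \<gamma> \<le> Y i \<omega>" using V by linarith
        then show "\<omega> \<in> (\<Union>i\<in>{..<n}. {\<omega> \<in> space M. - z / 2 - \<gamma> \<le> Y i \<omega>})"
          using i \<open>\<omega> \<in> space M\<close> by blast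
      qed
    qed measurable
    also have "\<dots> \<le> (\<Sum>i<n. measure M {\<omega> \<in> space M. - z / 2 - \<gamma> \<le> Y i \<omega>})"
      by (rule X.finite_measure_subadditive_finite) auto
    also have "\<dots> \<le> (\<Sum>i<n. exp (2 * z + 4 * \<gamma> + 16 * K))" by (intro sum_mono tail) simp
    also have "\<dots> = exp (2 * z) * (real n * exp (4 * \<gamma> + 16 * K))" by (simp add: exp_add mult_ac)
    also have "\<dots> \<le> exp (2 * z) * D" unfolding D_def by (intro mult_left_mono) auto
    finally have "exp (- z) * p u z \<le> exp (- z) * (exp (2 * z) * D)" by (intro mult_left_mono) auto
    also have "\<dots> = D * exp (- \<bar>z\<bar>)" using False by (simp add: mult_exp_exp mult.assoc[symmetric] mult.commute)
    finally show ?thesis .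
  qed
  have D0: "0 \<le> D" by (simp add: D_def)
  have int_exp: "integrable lborel (\<lambda>z. D * exp (- \<bar>z\<bar>))"
  proof -
    have "integrable lborel (\<lambda>z::real. indicator {0..} z * exp (- z))"
    proof (rule integrableI_nn_integral_finite[where x=1])
      show "(\<integral>\<^sup>+ z. ennreal (indicator {0::real..} z * exp (- z)) \<partial>lborel) = ennreal 1"
        using nn_integral_exp_minus[of 0] by (simp add: ennreal_mult' ennreal_indicator mult.commute)
    qed auto
    note i = this lborel_integrable_real_affine[OF this, of "-1" 0]
    have "integrable lborel (\<lambda>z. D * (indicator {0..} z * exp (- z) + indicator {0..} (0 + (- 1) * z) * exp (- (0 + (- 1) * z))))"
      using i by (intro integrable_mult_right Bochner_Integration.integrable_add) auto
    then show ?thesis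
      by (rule Bochner_Integration.integrable_bound)
         (use D0 in \<open>auto simp: indicator_def mult_left_mono\<close>)
  qed
  have lim: "((\<lambda>u. \<integral>z. exp (- z - z\<^sup>2 / (2 * u\<^sup>2)) * p u z \<partial>lborel) \<longlongrightarrow> (\<integral>z. exp (- z) * p' z \<partial>lborel)) at_top"
    and int_lim: "integrable lborel (\<lambda>z. exp (- z) * p' z)"
  proof -
    have dom: "\<forall>\<^sub>F u in at_top. AE z in lborel. norm (exp (- z - z\<^sup>2 / (2 * u\<^sup>2)) * p u z) \<le> D * exp (- \<bar>z\<bar>)"
      using bound
    proof eventually_elim
      case (elim u)
      have "exp (- z - z\<^sup>2 / (2 * u\<^sup>2)) * p u z \<le> D * exp (- \<bar>z\<bar>)" for z
      proof -
        have "exp (- z - z\<^sup>2 / (2 * u\<^sup>2)) * p u z \<le> exp (- z) * p u z"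
          by (intro mult_right_mono) (auto simp: p_def)
        then show ?thesis using p_le[OF elim, of z] by linarith
      qed
      then show ?case by (simp add: p_def)
    qed
    \<comment> \<open>At z = - \<gamma> the level meets the atom of \<open>Z 0\<close>; this single
      point is null.\<close>
    have "AE z in lborel. z \<noteq> - \<gamma>" by (rule AE_lborel_singleton)
    then have conv: "AE z in lborel. ((\<lambda>u. exp (- z - z\<^sup>2 / (2 * u\<^sup>2)) * p u z) \<longlongrightarrow> exp (- z) * p' z) at_top"
    proof eventually_elim
      case (elim z)
      have "((\<lambda>u. p u z) \<longlongrightarrow> p' z) at_top"
        unfolding p_def p'_def using elim by (intro V_box_tendsto) auto
      moreover have "((\<lambda>u::real. exp (- z - z\<^sup>2 / (2 * u\<^sup>2))) \<longlongrightarrow> exp (- z - 0)) at_top"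
        by (intro tendsto_intros real_tendsto_divide_at_top filterlim_tendsto_pos_mult_at_top[OF tendsto_const]
            filterlim_pow_at_top filterlim_ident) auto
      ultimately show ?case by (auto intro: tendsto_mult)
    qed
    show "((\<lambda>u. \<integral>z. exp (- z - z\<^sup>2 / (2 * u\<^sup>2)) * p u z \<partial>lborel) \<longlongrightarrow> (\<integral>z. exp (- z) * p' z \<partial>lborel)) at_top"
      by (rule integral_dominated_convergence_at_top[OF _ _ int_exp conv dom]) auto
    show "integrable lborel (\<lambda>z. exp (- z) * p' z)"
    proof (rule Bochner_Integration.integrable_bound[OF int_exp])
      show "AE z in lborel. norm (exp (- z) * p' z) \<le> norm (D * exp (- \<bar>z\<bar>))"
        using conv
      proof eventually_elim
        case (elim z)
        have "\<forall>\<^sub>F u in at_top. exp (- z - z\<^sup>2 / (2 * u\<^sup>2)) * p u z \<le> D * exp (- \<bar>z\<bar>)"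
          using bound
        proof eventually_elim
          case (elim u)
          have "exp (- z - z\<^sup>2 / (2 * u\<^sup>2)) * p u z \<le> exp (- z) * p u z"
            by (intro mult_right_mono) (auto simp: p_def)
          then show ?case using p_le[OF elim, of z] by linarith
        qed
        with elim have "exp (- z) * p' z \<le> D * exp (- \<bar>z\<bar>)"
          by (rule tendsto_upperbound) simp
        then show ?case using D0 by (simp add: p'_def)
      qed
    qed measurable
  qed
  have nn: "(\<integral>\<^sup>+ z. ennreal (exp (- z) * p' z) \<partial>lborel) = (\<integral>\<^sup>+ \<omega>. ennreal (exp (?mx \<omega> + \<gamma>)) \<partial>N)"
  proof -
    interpret P: pair_sigma_finite lborel N ..
    have "ennreal (exp (- z) * p' z) = (\<integral>\<^sup>+ \<omega>. ennreal (exp (- z)) * indicator {- ?mx \<omega> - \<gamma><..} z \<partial>N)" for z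
    proof -
      have "(\<integral>\<^sup>+ \<omega>. ennreal (exp (- z)) * indicator {- ?mx \<omega> - \<gamma><..} z \<partial>N)
          = (\<integral>\<^sup>+ \<omega>. ennreal (exp (- z)) * indicator {\<omega> \<in> space N. \<exists>i<n. - z - \<gamma> < Z (s i) \<omega>} \<omega> \<partial>N)"
        by (intro nn_integral_cong) (auto simp: indicator_def mx_iff[symmetric])
      also have "\<dots> = ennreal (exp (- z)) * emeasure N {\<omega> \<in> space N. \<exists>i<n. - z - \<gamma> < Z (s i) \<omega>}"
        by (rule nn_integral_cmult_indicator) measurable
      also have "\<dots> = ennreal (exp (- z) * p' z)"
        by (simp add: p'_def B.emeasure_eq_measure ennreal_mult')
      finally show ?thesis by simp
    qed
    then have "(\<integral>\<^sup>+ z. ennreal (exp (- z) * p' z) \<partial>lborel)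
        = (\<integral>\<^sup>+ z. \<integral>\<^sup>+ \<omega>. ennreal (exp (- z)) * indicator {- ?mx \<omega> - \<gamma><..} z \<partial>N \<partial>lborel)"
      by simp
    also have "\<dots> = (\<integral>\<^sup>+ \<omega>. \<integral>\<^sup>+ z. ennreal (exp (- z)) * indicator {- ?mx \<omega> - \<gamma><..} z \<partial>lborel \<partial>N)"
    proof (rule P.Fubini'[symmetric])
      have "(\<lambda>x. ennreal (exp (- fst x)) * indicator {x \<in> space (lborel \<Otimes>\<^sub>M N). - ?mx (snd x) - \<gamma> < fst x} x) \<in> borel_measurable (lborel \<Otimes>\<^sub>M N)"
        by measurable
      also have "?this \<longleftrightarrow> (\<lambda>(z, \<omega>). ennreal (exp (- z)) * indicator {- ?mx \<omega> - \<gamma><..} z) \<in> borel_measurable (lborel \<Otimes>\<^sub>M N)"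
        by (intro measurable_cong) (auto simp: space_pair_measure indicator_def)
      finally show "(\<lambda>(z, \<omega>). ennreal (exp (- z)) * indicator {- ?mx \<omega> - \<gamma><..} z) \<in> borel_measurable (lborel \<Otimes>\<^sub>M N)" .
    qed
    also have "\<dots> = (\<integral>\<^sup>+ \<omega>. ennreal (exp (?mx \<omega> + \<gamma>)) \<partial>N)"
    proof (intro nn_integral_cong)
      fix \<omega>
      let ?b = "- ?mx \<omega> - \<gamma>"
      have "(\<integral>\<^sup>+ z. ennreal (exp (- z)) * indicator {?b<..} z \<partial>lborel) = (\<integral>\<^sup>+ z. ennreal (exp (- z)) * indicator {?b..} z \<partial>lborel)"
        by (rule nn_integral_cong_AE)
           (use AE_lborel_singleton[of ?b] in \<open>auto elim!: eventually_mono simp: indicator_def\<close>)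
      also have "\<dots> = ennreal (exp (- ?b))" by (rule nn_integral_exp_minus)
      finally show "(\<integral>\<^sup>+ z. ennreal (exp (- z)) * indicator {?b<..} z \<partial>lborel) = ennreal (exp (?mx \<omega> + \<gamma>))"
        by simp
    qed
    finally show ?thesis .
  qed
  have val: "(\<integral>\<^sup>+ \<omega>. ennreal (exp (?mx \<omega> + \<gamma>)) \<partial>N) = ennreal (\<integral>z. exp (- z) * p' z \<partial>lborel)"
    unfolding nn[symmetric] by (rule nn_integral_eq_integral[OF int_lim]) (simp add: p'_def)
  have p'_nonneg: "0 \<le> (\<integral>z. exp (- z) * p' z \<partial>lborel)"
    by (rule Bochner_Integration.integral_nonneg) (simp add: p'_def)
  have int2: "integrable N (\<lambda>\<omega>. exp (?mx \<omega> + \<gamma>))"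
    by (rule integrableI_nn_integral_finite[OF _ _ val]) (auto simp: p'_nonneg)
  have "integrable N (\<lambda>\<omega>. exp (- \<gamma>) * exp (?mx \<omega> + \<gamma>))"
    using int2 by (rule integrable_mult_right)
  then show "integrable N (\<lambda>\<omega>. exp (?mx \<omega>))" by (simp add: mult_exp_exp)
  have "(\<integral>\<omega>. exp (?mx \<omega> + \<gamma>) \<partial>N) = (\<integral>z. exp (- z) * p' z \<partial>lborel)"
    by (subst integral_eq_nn_integral) (auto simp: val p'_nonneg)
  then have eq: "(\<integral>z. exp (- z) * p' z \<partial>lborel) = exp \<gamma> * (\<integral>\<omega>. exp (?mx \<omega>) \<partial>N)"
    by (simp add: exp_add mult.commute)
  have "\<forall>\<^sub>F u in at_top. (\<integral>z. exp (- z - z\<^sup>2 / (2 * u\<^sup>2)) * p u z \<partial>lborel)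
      = measure M {\<omega> \<in> space M. \<exists>i<n. u - \<gamma> / u < X (q u * s i) \<omega>} / (std_normal_density u / u)"
    using eventually_gt_at_top[of 0]
  proof eventually_elim
    case (elim u)
    have "0 < std_normal_density u / u" using elim by (simp add: normal_density_pos)
    then have "std_normal_density u / u \<noteq> 0" by linarith
    then show ?case unfolding prob_grid_eq_integral[OF elim] p_def
      by (rule nonzero_mult_div_cancel_left[symmetric])
  qed
  then show "((\<lambda>u. measure M {\<omega> \<in> space M. \<exists>i<n. u - \<gamma> / u < X (q u * s i) \<omega>} / (std_normal_density u / u))
      \<longlongrightarrow> exp \<gamma> * (\<integral>\<omega>. exp (?mx \<omega>) \<partial>N)) at_top"
    using lim unfolding eq by (simp add: tendsto_cong)
qed

end

end

section \<open>Chaining between grid points\<close>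

text \<open>Strict exceedance of a continuous function is an open condition. Events about an
  interval thereby reduce to countably many times, both for measurability and for
  stationarity.\<close>

lemma ex_greater_dense_iff:
  fixes f :: "real \<Rightarrow> real"
  assumes f: "continuous_on A f" and D: "D \<subseteq> A" "A \<subseteq> closure D"
  shows "(\<exists>s\<in>A. u < f s) \<longleftrightarrow> (\<exists>s\<in>D. u < f s)"
proof
  assume "\<exists>s\<in>A. u < f s"
  then obtain s where s: "s \<in> A" "u < f s" by blast
  then have "s \<in> closure D" using D(2) by blast
  then obtain x where x: "\<And>n. x n \<in> D" "x \<longlonglongrightarrow> s" unfolding closure_sequential by blast
  have "(\<lambda>n. f (x n)) \<longlonglongrightarrow> f s"
    using f x(1) x(2) s(1) D(1) by (auto simp: continuous_on_sequentially o_def)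
  then have "\<forall>\<^sub>F n in sequentially. u < f (x n)" using s(2) by (rule order_tendstoD)
  then obtain n where "u < f (x n)" using eventually_happens'[OF sequentially_bot] by blast
  then show "\<exists>s\<in>D. u < f s" using x(1) by blast
qed (use D(1) in blast)

lemma sets_ex_greater:
  fixes Y :: "real \<Rightarrow> 'a \<Rightarrow> real"
  assumes [measurable]: "\<And>t. t \<in> A \<Longrightarrow> Y t \<in> borel_measurable M"
    and cont: "\<And>\<omega>. \<omega> \<in> space M \<Longrightarrow> continuous_on A (\<lambda>t. Y t \<omega>)"
  shows "{\<omega> \<in> space M. \<exists>s\<in>A. u < Y s \<omega>} \<in> sets M"
proof -
  obtain D where D: "countable D" "D \<subseteq> A" "A \<subseteq> closure D" using separable by blast
  have "{\<omega> \<in> space M. \<exists>s\<in>D. u < Y s \<omega>} = (\<Union>s\<in>D. {\<omega> \<in> space M. u < Y s \<omega>})" by blast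
  also have "\<dots> \<in> sets M"
    by (rule sets.countable_UN'[OF D(1)]) (use D(2) in auto)
  finally show ?thesis
    using ex_greater_dense_iff[OF cont D(2,3)] by (simp cong: conj_cong)
qed

lemma less_Sup_image_iff:
  fixes f :: "real \<Rightarrow> real"
  assumes "continuous_on {0..S} f" "0 \<le> S"
  shows "u < Sup (f ` {0..S}) \<longleftrightarrow> (\<exists>s\<in>{0..S}. u < f s)"
proof -
  have "compact (f ` {0..S})" using assms by (intro compact_continuous_image) auto
  then have "bdd_above (f ` {0..S})" by (intro bounded_imp_bdd_above compact_imp_bounded)
  then show ?thesis using assms(2) by (subst less_cSup_iff) auto
qed

lemma dyadic_approx:
  fixes s :: real
  assumes "0 \<le> s" "s \<le> 1"
  obtains j :: nat where "j < 2 ^ k" "\<bar>real j / 2 ^ k - s\<bar> \<le> 1 / 2 ^ k"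
proof (cases "s = 0")
  case True
  show ?thesis by (rule that[of 0]) (use True in auto)
next
  case False
  \<comment> \<open>Rounding up and subtracting 1 keeps \<open>j < 2 ^ k\<close> even at s = 1,
    where rounding down would give \<open>2 ^ k\<close>.\<close>
  define j where "j = nat (\<lceil>s * 2 ^ k\<rceil> - 1)"
  have "0 < s * 2 ^ k" using False assms by simp
  then have c: "0 < \<lceil>s * 2 ^ k\<rceil>" by simp
  then have j: "real j = of_int \<lceil>s * 2 ^ k\<rceil> - 1" by (simp add: j_def)
  have "s * 2 ^ k \<le> 2 ^ k" using assms by simp
  then have "\<lceil>s * 2 ^ k\<rceil> \<le> 2 ^ k" by (simp add: ceiling_le_iff)
  then have "real_of_int \<lceil>s * 2 ^ k\<rceil> \<le> real_of_int (2 ^ k)" by (simp only: of_int_le_iff)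
  also have "real_of_int (2 ^ k) = 2 ^ k" by simp
  finally have "real j < 2 ^ k" unfolding j by linarith
  then have 1: "j < 2 ^ k" by (metis of_nat_less_iff of_nat_numeral of_nat_power)
  have "\<bar>real j - s * 2 ^ k\<bar> \<le> 1" unfolding j using ceiling_correct[of "s * 2 ^ k"] by linarith
  then have "\<bar>real j / 2 ^ k - s\<bar> \<le> 1 / 2 ^ k"
    by (simp add: field_simps abs_le_iff)
  then show ?thesis using 1 that by blast
qed

lemma dyadic_dense:
  fixes x l :: real
  shows "{x..x + l} \<subseteq> closure {x + l * real j / 2 ^ k |j k. j < (2::nat) ^ k}"
proof
  fix s assume s: "s \<in> {x..x + l}"
  show "s \<in> closure {x + l * real j / 2 ^ k |j k. j < (2::nat) ^ k}"
  proof (cases "l = 0")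
    case True
    then show ?thesis using s by (intro subsetD[OF closure_subset]) (auto intro!: exI[of _ "0::nat"])
  next
    case False
    then have l: "0 < l" using s by auto
    then have s': "0 \<le> (s - x) / l" "(s - x) / l \<le> 1" using s by (auto simp: field_simps)
    have "\<exists>j. j < (2::nat) ^ k \<and> \<bar>real j / 2 ^ k - (s - x) / l\<bar> \<le> 1 / 2 ^ k" for k
      using dyadic_approx[OF s', of k] by blast
    then obtain j where j: "\<And>k. j k < (2::nat) ^ k" "\<And>k. \<bar>real (j k) / 2 ^ k - (s - x) / l\<bar> \<le> 1 / 2 ^ k" by metis
    have "(\<lambda>k. real (j k) / 2 ^ k - (s - x) / l) \<longlonglongrightarrow> 0"
    proof (rule Lim_null_comparison)
      show "(\<lambda>k. 1 / 2 ^ k :: real) \<longlonglongrightarrow> 0" by real_asymp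
    qed (use j(2) in simp)
    then have "(\<lambda>k. x + l * (real (j k) / 2 ^ k - (s - x) / l) + (s - x)) \<longlonglongrightarrow> x + l * 0 + (s - x)"
      by (intro tendsto_intros)
    moreover have "x + l * (real (j k) / 2 ^ k - (s - x) / l) + (s - x) = x + l * real (j k) / 2 ^ k" for k
      using l by (simp add: field_simps)
    moreover have "x + l * 0 + (s - x) = s" by simp
    ultimately have "(\<lambda>k. x + l * real (j k) / 2 ^ k) \<longlonglongrightarrow> s"
      by (simp only:)
    then show ?thesis unfolding closure_sequential
      by (intro exI[of _ "\<lambda>k. x + l * real (j k) / 2 ^ k"]) (use j(1) in auto)
  qed
qed

text \<open>A function that exceeds the limiting level at a dyadic point must overtake the increasing
  levels \<open>b k\<close> between a point of generation \<open>k\<close> and its new neighbour of generation \<open>k + 1\<close>.\<close>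
lemma dyadic_no_crossing:
  fixes f :: "real \<Rightarrow> real"
  assumes "f x \<le> b 0" and mono: "\<And>k. b k \<le> b (Suc k)"
    and nc: "\<And>k j. j < (2::nat) ^ k \<Longrightarrow> f (x + l * real j / 2 ^ k) \<le> b k
      \<Longrightarrow> f (x + l * real j / 2 ^ k + l / 2 ^ Suc k) \<le> b (Suc k)"
    and "j < 2 ^ k"
  shows "f (x + l * real j / 2 ^ k) \<le> b k"
  using assms(4)
proof (induction k arbitrary: j)
  case 0
  then show ?case using assms(1) by simp
next
  case (Suc k)
  define i where "i = j div 2"
  have i: "i < 2 ^ k" using Suc.prems by (simp add: i_def)
  note IH = Suc.IH[OF i]
  show ?case
  proof (cases "even j")
    case True
    then have "real j = 2 * real i" by (simp add: i_def real_of_nat_div)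
    then have "x + l * real j / 2 ^ Suc k = x + l * real i / 2 ^ k" by simp
    then show ?thesis using IH mono[of k] by simp
  next
    case False
    then have "j = 2 * i + 1" by (simp add: i_def)
    then have "x + l * real j / 2 ^ Suc k = x + l * real i / 2 ^ k + l / 2 ^ Suc k"
      by (simp add: field_simps)
    then show ?thesis using nc[OF i IH] by (simp only:)
  qed
qed

lemma all_less_two: "(\<forall>i<2. P i) \<longleftrightarrow> P 0 \<and> P (1::nat)"
  by (auto simp: numeral_2_eq_2 less_Suc_eq)

text \<open>A single term of the exponential series. It trades exponential decay for a power of
  freely chosen order, for the chaining and for the overlap sum.\<close>

lemma exp_minus_le_fact_div:
  fixes y :: real
  assumes "0 < y"
  shows "exp (- y) \<le> fact m / y ^ m"
proof -
  have "y ^ m / fact m \<le> exp y"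
  proof -
    have "(\<Sum>n\<in>{m}. inverse (fact n) * y ^ n) \<le> (\<Sum>n. inverse (fact n) * y ^ n)"
      using assms by (intro sum_le_suminf summable_exp) auto
    then show ?thesis by (simp add: exp_def divide_inverse mult.commute)
  qed
  then show ?thesis using assms by (simp add: exp_minus field_simps)
qed

text \<open>Every path is continuous here; the theorem reaches this situation by changing both
  processes on null sets. Stationarity is stated for exceedance over countable sets of times, the
  form in which it is used and which survives such a change.\<close>

locale pickands_setting = pickands_fields +
  assumes X_cont: "\<And>\<omega>. \<omega> \<in> space M \<Longrightarrow> continuous_on {0..} (\<lambda>t. X t \<omega>)"
    and B_cont: "\<And>\<omega>. \<omega> \<in> space N \<Longrightarrow> continuous_on {0..} (\<lambda>t. B t \<omega>)"
    and X_stationary: "\<And>A h u. countable A \<Longrightarrow> A \<subseteq> {0..} \<Longrightarrow> 0 \<le> h \<Longrightarrow>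
      measure M {\<omega> \<in> space M. \<exists>s\<in>A. u < X (s + h) \<omega>} = measure M {\<omega> \<in> space M. \<exists>s\<in>A. u < X s \<omega>}"
begin

lemma X_sets_ex [measurable]: "A \<subseteq> {0..} \<Longrightarrow> {\<omega> \<in> space M. \<exists>s\<in>A. u < X s \<omega>} \<in> sets M"
  by (rule sets_ex_greater) (auto intro: X.field_measurable continuous_on_subset[OF X_cont])

lemma X_stationary_ex:
  assumes A: "A \<subseteq> {0..}" and h: "0 \<le> h"
  shows "measure M {\<omega> \<in> space M. \<exists>s\<in>(\<lambda>s. s + h) ` A. u < X s \<omega>} = measure M {\<omega> \<in> space M. \<exists>s\<in>A. u < X s \<omega>}"
proof -
  obtain D where D: "countable D" "D \<subseteq> A" "A \<subseteq> closure D" using separable by blast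
  have 1: "(\<exists>s\<in>A. u < X s \<omega>) \<longleftrightarrow> (\<exists>s\<in>D. u < X s \<omega>)" if "\<omega> \<in> space M" for \<omega>
    by (rule ex_greater_dense_iff[OF continuous_on_subset[OF X_cont[OF that] A] D(2,3)])
  have 2: "(\<exists>s\<in>A. u < X (s + h) \<omega>) \<longleftrightarrow> (\<exists>s\<in>D. u < X (s + h) \<omega>)" if "\<omega> \<in> space M" for \<omega>
    by (rule ex_greater_dense_iff[OF continuous_on_compose2[OF X_cont[OF that]] D(2,3)])
       (use A h in \<open>auto intro!: continuous_intros\<close>)
  have "measure M {\<omega> \<in> space M. \<exists>s\<in>(\<lambda>s. s + h) ` A. u < X s \<omega>} = measure M {\<omega> \<in> space M. \<exists>s\<in>D. u < X (s + h) \<omega>}"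
    using 2 by (simp cong: conj_cong)
  also have "\<dots> = measure M {\<omega> \<in> space M. \<exists>s\<in>D. u < X s \<omega>}"
    by (rule X_stationary[OF D(1) _ h]) (use A D(2) in auto)
  also have "\<dots> = measure M {\<omega> \<in> space M. \<exists>s\<in>A. u < X s \<omega>}"
    using 1 by (simp cong: conj_cong)
  finally show ?thesis .
qed

text \<open>Regress the earlier value on the later one. If the later value is z \<ge> v, the
  residual of the earlier one must lie below v' - r h z \<le> v' - r h v. The last bound no longer
  involves z, so the Chernoff factor simply multiplies \<open>Psi v\<close>.\<close>

lemma prob_drop_le:
  assumes x: "0 \<le> x" and h: "0 \<le> h" and r: "0 \<le> r h" and v: "v' \<le> r h * v" and w: "1 - (r h)\<^sup>2 \<le> w" "0 < w"
  shows "measure M {\<omega> \<in> space M. X x \<omega> \<le> v' \<and> v < X (x + h) \<omega>} \<le> Psi v * exp (- (r h * v - v')\<^sup>2 / (2 * w))"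
proof -
  let ?S = std_normal_distribution
  let ?Y = "\<lambda>\<omega>. r h * X (x + h) \<omega> + (- 1) * X x \<omega>"
  have xh: "0 \<le> x + h" using x h by simp
  note [measurable] = X.field_measurable[OF x] X.field_measurable[OF xh]
  \<comment> \<open>Index 0 is the later time, the one conditioned on; its inequality points upwards
    and therefore carries the sign - 1.\<close>
  define t where "t i = (if i = (0::nat) then x + h else x)" for i
  define e where "e i = (if i = (0::nat) then - 1 else 1 :: real)" for i
  define b where "b i = (if i = (0::nat) then - v else v')" for i
  have Y: "centered_gaussian M ?Y (1 - (r h)\<^sup>2)"
    using X.gaussian_pair[OF xh x, of "r h" "- 1"] h by (simp add: r_0 power2_eq_square)
  have "measure M {\<omega> \<in> space M. X x \<omega> \<le> v' \<and> v < X (x + h) \<omega>} \<le> measure M {\<omega> \<in> space M. \<forall>i<2. e i * X (t i) \<omega> \<le> b i}"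
    by (rule X.finite_measure_mono) (auto simp: e_def t_def b_def all_less_two)
  also have "\<dots> = (\<integral>z. measure M {\<omega> \<in> space M. \<forall>i<2. e i * (r \<bar>t 0 - t i\<bar> * z + (X (t i) \<omega> - r \<bar>t 0 - t i\<bar> * X (t 0) \<omega>)) \<le> b i} \<partial>?S)"
    by (rule X.prob_regression) (use x xh r_0 in \<open>auto simp: t_def\<close>)
  also have "\<dots> \<le> (\<integral>z. indicator {v..} z * measure M {\<omega> \<in> space M. r h * v - v' \<le> ?Y \<omega>} \<partial>?S)"
  proof (rule integral_mono_AE')
    show "integrable ?S (\<lambda>z. indicator {v..} z * measure M {\<omega> \<in> space M. r h * v - v' \<le> ?Y \<omega>})"
      by (rule std_normal.integrable_const_bound[where B=1]) (auto simp: indicator_def)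
    show "AE z in ?S. measure M {\<omega> \<in> space M. \<forall>i<2. e i * (r \<bar>t 0 - t i\<bar> * z + (X (t i) \<omega> - r \<bar>t 0 - t i\<bar> * X (t 0) \<omega>)) \<le> b i}
        \<le> indicator {v..} z * measure M {\<omega> \<in> space M. r h * v - v' \<le> ?Y \<omega>}"
    proof (rule AE_I2)
      fix z
      show "measure M {\<omega> \<in> space M. \<forall>i<2. e i * (r \<bar>t 0 - t i\<bar> * z + (X (t i) \<omega> - r \<bar>t 0 - t i\<bar> * X (t 0) \<omega>)) \<le> b i}
        \<le> indicator {v..} z * measure M {\<omega> \<in> space M. r h * v - v' \<le> ?Y \<omega>}"
      proof (cases "v \<le> z")
        case True
        then have "r h * v \<le> r h * z" using r by (rule mult_left_mono)
        then show ?thesis using True h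
          by (auto simp: e_def t_def b_def all_less_two r_0 intro!: X.finite_measure_mono)
      next
        case False
        then have empty: "{\<omega> \<in> space M. \<forall>i<2. e i * (r \<bar>t 0 - t i\<bar> * z + (X (t i) \<omega> - r \<bar>t 0 - t i\<bar> * X (t 0) \<omega>)) \<le> b i} = {}"
          by (auto simp: e_def t_def b_def all_less_two r_0)
        show ?thesis unfolding empty by simp
      qed
    qed
  qed (auto simp: indicator_def)
  also have "\<dots> = measure ?S {v..} * measure M {\<omega> \<in> space M. r h * v - v' \<le> ?Y \<omega>}"
    by simp
  also have "measure ?S {v..} = Psi v"
    unfolding Psi_def
    by (rule std_normal.finite_measure_eq_AE)
       (use AE_lborel_singleton[of v] in \<open>auto simp: AE_density elim!: eventually_mono\<close>)
  also have "measure M {\<omega> \<in> space M. r h * v - v' \<le> ?Y \<omega>} \<le> exp (- (r h * v - v')\<^sup>2 / (2 * w))"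
    by (rule centered_gaussian_chernoff[OF X.prob_space_axioms Y w]) (use v in simp)
  finally show ?thesis by (simp add: mult_left_mono Psi_nonneg)
qed


text \<open>The classical asymptotic equivalent of \<open>Psi\<close>. It is the normaliser that
  \<open>grid_probability_tendsto\<close> produces; \<open>Psi_tendsto\<close> allows replacing it
  by \<open>Psi\<close>.\<close>

definition gauss_tail :: "real \<Rightarrow> real" where
  "gauss_tail u = std_normal_density u / u"

lemma gauss_tail_pos: "0 < u \<Longrightarrow> 0 < gauss_tail u"
  by (simp add: gauss_tail_def normal_density_pos)

text \<open>The grid limit for the single time 0, where \<open>Z\<close> vanishes almost surely and
  the expectation is 1.\<close>

lemma Psi_shift_tendsto: "((\<lambda>u. Psi (u - \<gamma> / u) / gauss_tail u) \<longlongrightarrow> exp \<gamma>) at_top"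
proof -
  have X0: "centered_gaussian M (X 0) 1"
    using X.gaussian_single[of 0] by (simp add: r_0)
  have B0: "centered_gaussian N (B 0) 0"
    using B.gaussian_single[of 0] \<alpha> by simp
  have "(\<integral>\<omega>. exp (Max ((\<lambda>i. Z 0 \<omega>) ` {..<1::nat})) \<partial>N) = (\<integral>\<omega>. exp (sqrt 2 * B 0 \<omega>) \<partial>N)"
    using \<alpha> by (intro Bochner_Integration.integral_cong) (auto simp: Z_def lessThan_Suc)
  also have "\<dots> = 1" using centered_gaussian_mgf(2)[OF B0, of "sqrt 2"] by simp
  finally show ?thesis
    using grid_probability_tendsto(2)[of "\<lambda>_. 0" 1 \<gamma>] centered_gaussian_1_tail[OF X0]
    by (simp add: gauss_tail_def)
qed

lemma Psi_tendsto: "((\<lambda>u. Psi u / gauss_tail u) \<longlongrightarrow> 1) at_top"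
  using Psi_shift_tendsto[of 0] by simp

lemma Psi_eventually_pos: "\<forall>\<^sub>F u in at_top. 0 < Psi u"
proof -
  have "\<forall>\<^sub>F u in at_top. 0 < Psi u / gauss_tail u"
    by (rule order_tendstoD(1)[OF Psi_tendsto]) simp
  then show ?thesis using eventually_gt_at_top[of 0]
  proof eventually_elim
    case (elim u)
    then show ?case using gauss_tail_pos[of u] by (auto simp: zero_less_divide_iff)
  qed
qed

text \<open>The ratio tends to e, which is less than 3.\<close>

lemma Psi_ratio_le: "\<forall>\<^sub>F u in at_top. Psi (u - 1 / u) \<le> 3 * Psi u"
proof -
  have "((\<lambda>u. Psi (u - 1 / u) / gauss_tail u - 3 * (Psi u / gauss_tail u)) \<longlongrightarrow> exp 1 - 3 * 1) at_top"
    by (intro tendsto_intros Psi_shift_tendsto Psi_tendsto)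
  moreover have "exp 1 - 3 * 1 < (0::real)"
    using e_less_272 by simp
  ultimately have "\<forall>\<^sub>F u in at_top. Psi (u - 1 / u) / gauss_tail u - 3 * (Psi u / gauss_tail u) < 0"
    by (rule order_tendstoD)
  then show ?thesis using eventually_gt_at_top[of 0]
  proof eventually_elim
    case (elim u)
    then have "(Psi (u - 1 / u) - 3 * Psi u) / gauss_tail u < 0" by (simp add: diff_divide_distrib)
    then show ?case using gauss_tail_pos[OF elim(2)] by (simp add: divide_less_0_iff)
  qed
qed

text \<open>Across a mesh the standard deviation of \<open>X\<close> is of order a^(\<alpha>/2) / u.
  Level gaps of order a^(\<alpha>/4) / u exceed it by the factor a^(- \<alpha>/4), so that crossing
  a gap has a probability smaller than any power of a.\<close>

definition \<beta> :: real where "\<beta> = \<alpha> / 4"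

text \<open>The factor by which the gap a^\<beta> shrinks when the mesh is halved.\<close>

definition \<theta> :: real where "\<theta> = 2 powr (- \<beta>)"

text \<open>The last condition makes the drift \<open>(1 - r h) u\<close> over a dyadic step \<open>h\<close> at most half of
  the increment between consecutive levels \<open>u - a powr \<beta> * \<theta> ^ k / u\<close> of the chaining.\<close>
definition fine_mesh :: "real \<Rightarrow> bool" where
  "fine_mesh a \<longleftrightarrow> 0 < a \<and> a \<le> 1 \<and> 4 * (a powr \<beta>) ^ 3 \<le> 1 - \<theta>"

lemma \<beta>: "0 < \<beta>" using \<alpha> by (simp add: \<beta>_def)

lemma \<theta>: "0 < \<theta>" "\<theta> < 1"
proof -
  show "0 < \<theta>" by (simp add: \<theta>_def)
  have "2 powr (- \<beta>) < 2 powr 0" using \<beta> by (intro powr_less_mono) auto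
  then show "\<theta> < 1" by (simp add: \<theta>_def)
qed

lemma powr_\<beta>_tendsto_0: "((\<lambda>a. a powr \<beta>) \<longlongrightarrow> 0) (at_right 0)"
proof (rule tendstoI)
  fix e :: real assume "e > 0"
  then have "\<forall>\<^sub>F a in at_right 0. a < e powr (1 / \<beta>)"
    by (intro order_tendstoD(2)[OF tendsto_ident_at]) simp
  then show "\<forall>\<^sub>F a in at_right 0. dist (a powr \<beta>) 0 < e"
    using eventually_at_right_less[of "0::real"]
  proof eventually_elim
    case (elim a)
    then have "a powr \<beta> < (e powr (1 / \<beta>)) powr \<beta>" using \<beta> by (intro powr_less_mono2) auto
    also have "\<dots> = e" using \<beta> \<open>e > 0\<close> by (simp add: powr_powr)
    finally show ?case by simp
  qed
qed

lemma eventually_fine_mesh: "\<forall>\<^sub>F a in at_right 0. fine_mesh a"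
proof -
  have "((\<lambda>a. 4 * (a powr \<beta>) ^ 3) \<longlongrightarrow> 4 * 0 ^ 3) (at_right 0)"
    by (intro tendsto_intros powr_\<beta>_tendsto_0)
  then have "\<forall>\<^sub>F a in at_right 0. 4 * (a powr \<beta>) ^ 3 < 1 - \<theta>"
    by (rule order_tendstoD(2)) (use \<theta> in simp)
  moreover have "\<forall>\<^sub>F a::real in at_right 0. a < 1"
    by (rule order_tendstoD(2)[OF tendsto_ident_at]) simp
  ultimately show ?thesis using eventually_at_right_less[of "0::real"]
    by eventually_elim (simp add: fine_mesh_def)
qed

lemma r_local_bound:
  obtains d where "0 < d" "\<And>h. 0 < h \<Longrightarrow> h < d \<Longrightarrow> 0 \<le> r h"
    "\<And>h. 0 < h \<Longrightarrow> h < d \<Longrightarrow> 1 - r h \<le> 2 * C * h powr \<alpha>"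
    "\<And>h. 0 < h \<Longrightarrow> h < d \<Longrightarrow> C / 2 * h powr \<alpha> \<le> 1 - r h"
proof -
  have "((\<lambda>t. t powr \<alpha>) \<longlongrightarrow> 0) (at_right 0)"
  proof -
    have "((\<lambda>a. (a powr \<beta>) ^ 4) \<longlongrightarrow> 0 ^ 4) (at_right 0)" by (intro tendsto_intros powr_\<beta>_tendsto_0)
    moreover have "\<forall>\<^sub>F a in at_right 0. (a powr \<beta>) ^ 4 = a powr \<alpha>"
      using eventually_at_right_less[of "0::real"] by eventually_elim (simp add: powr_power \<beta>_def)
    ultimately show ?thesis by (simp add: tendsto_cong)
  qed
  then have "((\<lambda>t. 2 * C * t powr \<alpha>) \<longlongrightarrow> 2 * C * 0) (at_right 0)" by (intro tendsto_intros)
  then have "\<forall>\<^sub>F t in at_right 0. 2 * C * t powr \<alpha> < 1"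
    by (rule order_tendstoD) simp
  moreover have "\<forall>\<^sub>F t in at_right 0. (1 - r t) / t powr \<alpha> < 2 * C"
    by (rule order_tendstoD(2)[OF r_local]) (use C in simp)
  moreover have "\<forall>\<^sub>F t in at_right 0. C / 2 < (1 - r t) / t powr \<alpha>"
    by (rule order_tendstoD(1)[OF r_local]) (use C in simp)
  ultimately have "\<forall>\<^sub>F t in at_right 0. 2 * C * t powr \<alpha> < 1 \<and> (1 - r t) / t powr \<alpha> < 2 * C \<and> C / 2 < (1 - r t) / t powr \<alpha>"
    by eventually_elim simp
  then obtain d where d: "0 < d" "\<And>t. 0 < t \<Longrightarrow> t < d \<Longrightarrow> 2 * C * t powr \<alpha> < 1 \<and> (1 - r t) / t powr \<alpha> < 2 * C \<and> C / 2 < (1 - r t) / t powr \<alpha>"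
    by (auto simp: eventually_at_right_field)
  have 1: "1 - r t \<le> 2 * C * t powr \<alpha>" "C / 2 * t powr \<alpha> \<le> 1 - r t" if "0 < t" "t < d" for t
    using d(2)[OF that] that by (auto simp: field_simps)
  show ?thesis
    by (rule that[OF d(1) _ 1]) (use 1 d(2) in fastforce)+
qed

text \<open>The 6 is 3 from \<open>Psi_ratio_le\<close> times 2 from the geometric series over
  generations. The rest is the constant in bounding exp(- c / p^2) by a power of p, with c = (1 -
  \<theta>)^2 / 32.\<close>

definition chain_const :: real where
  "chain_const = 6 * (fact (nat \<lceil>1 / \<beta>\<rceil>) / ((1 - \<theta>)\<^sup>2 / 32) ^ nat \<lceil>1 / \<beta>\<rceil>)"

lemma chain_const_nonneg: "0 \<le> chain_const"
  by (simp add: chain_const_def)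

text \<open>A union bound over dyadic steps: generation k has \<open>2 ^ k\<close> of them, each
  crossing its gap with probability at most of order a^2 4^(-k) Psi u, because gap over standard
  deviation grows like 1 / (a^\<beta> \<theta>^k). Uniformity in x lets one threshold for u serve
  all grid cells.\<close>

lemma prob_exceed_from_below:
  assumes "fine_mesh a"
  shows "\<forall>\<^sub>F u in at_top. \<forall>x\<ge>0.
    measure M {\<omega> \<in> space M. X x \<omega> \<le> u - a powr \<beta> / u \<and> (\<exists>s\<in>{x..x + a * q u}. u < X s \<omega>)} \<le> chain_const * a\<^sup>2 * Psi u"
proof -
  have a: "0 < a" "a \<le> 1" "4 * (a powr \<beta>) ^ 3 \<le> 1 - \<theta>" using assms by (auto simp: fine_mesh_def)
  define g where "g = a powr \<beta>"
  \<comment> \<open>The order of the power bound: m \<beta> \<ge> 1 gives g^(2m) \<le> a^2 and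
    \<theta>^(2m) \<le> 1/4, and 4^(-k) outweighs the \<open>2 ^ k\<close> steps of generation
    k.\<close>
  define m where "m = nat \<lceil>1 / \<beta>\<rceil>"
  define c where "c = (1 - \<theta>)\<^sup>2 / 32"
  have c: "0 < c" using \<theta> by (simp add: c_def)
  have g: "0 < g" "g \<le> 1" using a \<beta> by (auto simp: g_def intro: powr_le1)
  have g4: "g ^ 4 = a powr \<alpha>" using a by (simp add: g_def powr_power \<beta>_def)
  have \<theta>4: "\<theta> ^ 4 = 2 powr (- \<alpha>)" by (simp add: \<theta>_def powr_power \<beta>_def)
  have "1 / \<beta> \<le> real m" using \<beta> by (simp add: m_def real_nat_ceiling_ge)
  then have m\<beta>: "1 \<le> real m * \<beta>" using \<beta> by (simp add: field_simps)
  have g2m: "g ^ (2 * m) \<le> a\<^sup>2"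
  proof -
    have "g ^ (2 * m) = a powr (2 * (real m * \<beta>))" using a by (simp add: g_def powr_power mult_ac)
    also have "\<dots> \<le> a powr 2" using a m\<beta> by (intro powr_mono') auto
    also have "\<dots> = a\<^sup>2" using a by simp
    finally show ?thesis .
  qed
  have \<theta>2m: "\<theta> ^ (2 * m) \<le> 1 / 4"
  proof -
    have "\<theta> ^ (2 * m) = 2 powr (- (2 * (real m * \<beta>)))" by (simp add: \<theta>_def powr_power mult_ac)
    also have "\<dots> \<le> 2 powr (- 2)" using m\<beta> by (intro powr_mono) auto
    also have "\<dots> = 1 / 4" by (simp add: powr_minus)
    finally show ?thesis .
  qed
  obtain d where d: "0 < d" "\<And>h. 0 < h \<Longrightarrow> h < d \<Longrightarrow> 0 \<le> r h"
    "\<And>h. 0 < h \<Longrightarrow> h < d \<Longrightarrow> 1 - r h \<le> 2 * C * h powr \<alpha>"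
    using r_local_bound by metis
  have "((\<lambda>u. a * q u) \<longlongrightarrow> a * 0) at_top" by (intro tendsto_intros q_tendsto_0)
  then have "\<forall>\<^sub>F u in at_top. a * q u < d" by (rule order_tendstoD) (use d in simp)
  then show ?thesis
    using eventually_ge_at_top[of 1] Psi_ratio_le
  proof eventually_elim
    case (elim u)
    have u: "1 \<le> u" "0 < u" using elim by auto
    define l where "l = a * q u"
    have l: "0 < l" "l < d" using a u elim q_pos by (auto simp: l_def)
    \<comment> \<open>The levels rise from u - g/u towards u and never fall below u - 1/u, so
      passing from \<open>Psi (b k)\<close> to \<open>Psi u\<close> costs a factor 3 only.\<close>
    define b where "b k = u - g * \<theta> ^ k / u" for k :: nat
    have gt: "0 \<le> g * \<theta> ^ k" "g * \<theta> ^ k \<le> 1" for k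
      using g \<theta> by (auto intro!: mult_le_one power_le_one)
    have "u - 1 / u \<le> b k" for k
      unfolding b_def using gt[of k] u by (simp add: divide_right_mono)
    moreover have "0 \<le> u - 1 / u" using u by (simp add: divide_le_eq mult_le_cancel_left1 order_trans[of 1 u "u * u"])
    ultimately have b: "0 \<le> b k" "u - 1 / u \<le> b k" "b k \<le> u" for k
      using gt(1)[of k] u order_trans by (auto simp: b_def)
    have Psi_b: "Psi (b k) \<le> 3 * Psi u" for k
      using Psi_antimono[OF b(2)] elim(3) by (rule order_trans)
    have b_mono: "b k \<le> b (Suc k)" for k
      unfolding b_def using g \<theta> u by (intro diff_left_mono divide_right_mono mult_left_mono power_decreasing) auto
    show "\<forall>x\<ge>0. measure M {\<omega> \<in> space M. X x \<omega> \<le> u - a powr \<beta> / u \<and> (\<exists>s\<in>{x..x + a * q u}. u < X s \<omega>)} \<le> chain_const * a\<^sup>2 * Psi u"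
    proof (intro allI impI)
      fix x :: real assume x: "0 \<le> x"
      define A where "A k j = {\<omega> \<in> space M. X (x + l * real j / 2 ^ k) \<omega> \<le> b k \<and> b (Suc k) < X (x + l * real j / 2 ^ k + l / 2 ^ Suc k) \<omega>}"
        for k j :: nat
      have pos: "0 \<le> x + l * real j / 2 ^ k" "0 \<le> x + l * real j / 2 ^ k + l / 2 ^ Suc k" for j k :: nat
        using x l by (auto intro!: add_nonneg_nonneg divide_nonneg_nonneg mult_nonneg_nonneg)
      note [measurable] = X.field_measurable[OF pos(1)] X.field_measurable[OF pos(2)]
      have A [measurable]: "A k j \<in> sets M" for k j unfolding A_def by measurable
      have A_le: "measure M (A k j) \<le> 3 * Psi u * (fact m / c ^ m * (a\<^sup>2 * (1 / 4) ^ k))" for k j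
      proof -
        define h where "h = l / 2 ^ Suc k"
        define p where "p = g * \<theta> ^ k"
        \<comment> \<open>Bounds the residual variance over a step h: C h^\<alpha> = w/4, and 1 -
          r^2 \<le> 2 (1 - r) \<le> 4 C h^\<alpha>.\<close>
        define w where "w = 4 * (p ^ 4 * \<theta> ^ 4) / u\<^sup>2"
        have p: "0 < p" "p \<le> g" using g \<theta> by (auto simp: p_def power_le_one mult_le_cancel_left1)
        have w: "0 < w" using p \<theta> u by (simp add: w_def)
        have "(1::real) \<le> 2 ^ Suc k" by (rule one_le_power) simp
        then have "h \<le> l" using l by (simp add: h_def divide_le_eq mult_le_cancel_left1 del: power_Suc)
        then have h: "0 < h" "h < d" using l by (auto simp: h_def)
        have "h powr \<alpha> = a powr \<alpha> * (q u) powr \<alpha> * (2 powr (- \<alpha>)) ^ Suc k"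
        proof -
          have 2: "(2 ^ Suc k) powr \<alpha> = (2 powr \<alpha>) ^ Suc k"
          proof -
            have "(2 ^ Suc k) powr \<alpha> = (2 powr real (Suc k)) powr \<alpha>" by (subst powr_realpow) auto
            also have "\<dots> = 2 powr (real (Suc k) * \<alpha>)" by (rule powr_powr)
            also have "\<dots> = (2 powr \<alpha>) ^ Suc k" by (rule powr_power[symmetric]) simp
            finally show ?thesis .
          qed
          have "h powr \<alpha> = (a * q u) powr \<alpha> / (2 ^ Suc k) powr \<alpha>"
            unfolding h_def l_def by (rule powr_divide)
          also have "(a * q u) powr \<alpha> = a powr \<alpha> * (q u) powr \<alpha>"
            by (rule powr_mult)
          finally show ?thesis
            unfolding 2 powr_minus power_inverse by (simp only: divide_inverse)
        qed
        also have "C * \<dots> = p ^ 4 * \<theta> ^ 4 / u\<^sup>2"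
        proof -
          have "C * (q u) powr \<alpha> = 1 / u\<^sup>2" using q_powr[OF u(2)] C u by (simp add: field_simps)
          moreover have "C * (a powr \<alpha> * (q u) powr \<alpha> * (2 powr (- \<alpha>)) ^ Suc k)
              = a powr \<alpha> * (2 powr (- \<alpha>)) ^ Suc k * (C * (q u) powr \<alpha>)" by (simp only: mult_ac)
          moreover have "p ^ 4 * \<theta> ^ 4 = g ^ 4 * (\<theta> ^ 4) ^ Suc k"
          proof -
            have "(\<theta> ^ k) ^ 4 = (\<theta> ^ 4) ^ k" by (simp only: power_mult[symmetric] mult.commute)
            then show ?thesis unfolding p_def power_mult_distrib by simp
          qed
          ultimately show ?thesis using \<theta>(1) unfolding g4[symmetric] \<theta>4[symmetric] by auto
        qed
        finally have Ch: "C * h powr \<alpha> = w / 4" by (simp add: w_def)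
        have r1: "1 - r h \<le> w / 2" using d(3)[OF h] Ch by simp
        have rh: "0 \<le> r h" "r h \<le> 1" using d(2)[OF h] r_le_1 h by auto
        have r2: "1 - (r h)\<^sup>2 \<le> w"
        proof -
          have "1 - (r h)\<^sup>2 = (1 - r h) * (1 + r h)" by (simp add: power2_eq_square algebra_simps)
          also have "\<dots> \<le> (1 - r h) * 2" using rh by (intro mult_left_mono) auto
          finally show ?thesis using r1 by simp
        qed
        \<comment> \<open>Half of the level increment. The drift (1 - r h) b consumes at most the
          other half, by the last condition in \<open>fine_mesh\<close>.\<close>
        define y where "y = p * (1 - \<theta>) / (2 * u)"
        have y: "0 < y" using p \<theta> u by (simp add: y_def)
        have "w / 2 * u \<le> y"
        proof -
          have "4 * p ^ 3 \<le> 4 * g ^ 3" using p by (intro mult_left_mono power_mono) auto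
          then have "4 * p ^ 3 \<le> 1 - \<theta>" using a(3) by (simp add: g_def)
          moreover have "4 * p ^ 3 * \<theta> ^ 4 \<le> 4 * p ^ 3 * 1" using p \<theta> by (intro mult_left_mono power_le_one) auto
          ultimately have "4 * p ^ 3 * \<theta> ^ 4 \<le> 1 - \<theta>" by linarith
          then have "p * (4 * p ^ 3 * \<theta> ^ 4) \<le> p * (1 - \<theta>)" using p by (intro mult_left_mono) auto
          then have "4 * (p ^ 4 * \<theta> ^ 4) \<le> p * (1 - \<theta>)" by (simp add: power4_eq_xxxx power3_eq_cube mult_ac)
          then have "4 * (p ^ 4 * \<theta> ^ 4) / (2 * u) \<le> p * (1 - \<theta>) / (2 * u)" using u by (intro divide_right_mono) auto
          moreover have eq: "w / 2 * u = 4 * (p ^ 4 * \<theta> ^ 4) / (2 * u)" using u by (simp add: w_def power2_eq_square)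
          ultimately show ?thesis unfolding y_def eq by simp
        qed
        moreover have "(1 - r h) * b (Suc k) \<le> w / 2 * u"
          using r1 b rh w by (intro mult_mono) auto
        moreover have "b (Suc k) - b k = 2 * y"
          using u by (simp add: b_def y_def p_def field_simps)
        ultimately have y_le: "y \<le> r h * b (Suc k) - b k"
          by (simp add: left_diff_distrib)
        have "measure M (A k j) \<le> Psi (b (Suc k)) * exp (- (r h * b (Suc k) - b k)\<^sup>2 / (2 * w))"
          unfolding A_def h_def[symmetric]
          by (rule prob_drop_le) (use pos(1) h rh y y_le r2 w in auto)
        also have "\<dots> \<le> 3 * Psi u * exp (- (c / p\<^sup>2))"
        proof (intro mult_mono)
          have "c / p\<^sup>2 \<le> y\<^sup>2 / (2 * w)"
          proof -
            have "y\<^sup>2 / (2 * w) = c / (p\<^sup>2 * \<theta> ^ 4)"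
              using p \<theta> u by (simp add: y_def w_def c_def field_simps power2_eq_square power4_eq_xxxx)
            moreover have "c / p\<^sup>2 \<le> c / (p\<^sup>2 * \<theta> ^ 4)"
              using p \<theta> c by (intro divide_left_mono) (auto simp: mult_le_cancel_left2 power_le_one)
            ultimately show ?thesis by simp
          qed
          also have "\<dots> \<le> (r h * b (Suc k) - b k)\<^sup>2 / (2 * w)"
            using y y_le w by (intro divide_right_mono power_mono) auto
          finally show "exp (- (r h * b (Suc k) - b k)\<^sup>2 / (2 * w)) \<le> exp (- (c / p\<^sup>2))" by simp
        qed (use Psi_b Psi_nonneg in auto)
        also have "exp (- (c / p\<^sup>2)) \<le> fact m / (c / p\<^sup>2) ^ m"
          by (rule exp_minus_le_fact_div) (use c p in simp)
        also have "fact m / (c / p\<^sup>2) ^ m = fact m / c ^ m * (g ^ (2 * m) * (\<theta> ^ (2 * m)) ^ k)"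
        proof -
          have "(p\<^sup>2) ^ m = p ^ (2 * m)" by (simp only: power_mult)
          also have "\<dots> = g ^ (2 * m) * (\<theta> ^ k) ^ (2 * m)" unfolding p_def by (rule power_mult_distrib)
          also have "(\<theta> ^ k) ^ (2 * m) = (\<theta> ^ (2 * m)) ^ k" by (simp only: power_mult[symmetric] mult.commute)
          finally have "(p\<^sup>2) ^ m = g ^ (2 * m) * (\<theta> ^ (2 * m)) ^ k" .
          moreover have "fact m / (c / p\<^sup>2) ^ m = fact m / c ^ m * (p\<^sup>2) ^ m" by (simp add: power_divide)
          ultimately show ?thesis by (simp only:)
        qed
        also have "\<dots> \<le> fact m / c ^ m * (a\<^sup>2 * (1 / 4) ^ k)"
          using g2m \<theta>2m \<theta> g c by (intro mult_left_mono mult_mono power_mono) auto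
        finally show ?thesis by (simp add: mult_left_mono Psi_nonneg)
      qed
      define b' where "b' k = 3 * Psi u * (fact m / c ^ m * a\<^sup>2) * (1 / 2) ^ k" for k :: nat
      have UA: "measure M (\<Union>j\<in>{..<2 ^ k}. A k j) \<le> b' k" for k
      proof -
        have "measure M (\<Union>j\<in>{..<2 ^ k}. A k j) \<le> (\<Sum>j<2 ^ k. measure M (A k j))"
          by (rule X.finite_measure_subadditive_finite) auto
        also have "\<dots> \<le> (\<Sum>j<(2::nat) ^ k. 3 * Psi u * (fact m / c ^ m * (a\<^sup>2 * (1 / 4) ^ k)))"
          by (intro sum_mono A_le)
        also have "\<dots> = 2 ^ k * (3 * Psi u * (fact m / c ^ m * (a\<^sup>2 * (1 / 4) ^ k)))" by simp
        also have "\<dots> = 3 * Psi u * (fact m / c ^ m * a\<^sup>2) * (2 ^ k * (1 / 4) ^ k)" by (simp only: mult_ac)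
        also have "(2::real) ^ k * (1 / 4) ^ k = (1 / 2) ^ k" by (simp add: power_mult_distrib[symmetric])
        also have "3 * Psi u * (fact m / c ^ m * a\<^sup>2) * (1 / 2) ^ k = b' k" by (simp only: b'_def)
        finally show ?thesis .
      qed
      have b': "summable b'" "suminf b' = chain_const * a\<^sup>2 * Psi u"
      proof -
        have "(\<lambda>k. (1 / 2 :: real) ^ k) sums 2" using geometric_sums[of "1 / 2 :: real"] by simp
        from sums_mult[OF this, of "3 * Psi u * (fact m / c ^ m * a\<^sup>2)"]
        have "b' sums (3 * Psi u * (fact m / c ^ m * a\<^sup>2) * 2)" unfolding b'_def .
        moreover have "3 * Psi u * (fact m / c ^ m * a\<^sup>2) * 2 = chain_const * a\<^sup>2 * Psi u"
          by (simp add: chain_const_def m_def c_def)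
        ultimately show "summable b'" "suminf b' = chain_const * a\<^sup>2 * Psi u"
          by (auto simp: sums_iff)
      qed
      have summ: "summable (\<lambda>k. measure M (\<Union>j\<in>{..<2 ^ k}. A k j))"
        by (rule summable_comparison_test[OF _ b'(1)]) (use UA in auto)
      have "{\<omega> \<in> space M. X x \<omega> \<le> u - a powr \<beta> / u \<and> (\<exists>s\<in>{x..x + a * q u}. u < X s \<omega>)} \<subseteq> (\<Union>k. \<Union>j\<in>{..<2 ^ k}. A k j)"
      proof
        fix \<omega> assume "\<omega> \<in> {\<omega> \<in> space M. X x \<omega> \<le> u - a powr \<beta> / u \<and> (\<exists>s\<in>{x..x + a * q u}. u < X s \<omega>)}"
        then have \<omega>: "\<omega> \<in> space M" and X0: "X x \<omega> \<le> b 0" and ex: "\<exists>s\<in>{x..x + l}. u < X s \<omega>"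
          by (auto simp: b_def g_def l_def)
        show "\<omega> \<in> (\<Union>k. \<Union>j\<in>{..<2 ^ k}. A k j)"
        proof (rule ccontr)
          assume "\<omega> \<notin> (\<Union>k. \<Union>j\<in>{..<2 ^ k}. A k j)"
          then have nc: "X (x + l * real j / 2 ^ k + l / 2 ^ Suc k) \<omega> \<le> b (Suc k)"
            if "j < 2 ^ k" "X (x + l * real j / 2 ^ k) \<omega> \<le> b k" for j k
            using that \<omega> by (force simp: A_def not_less)
          have le: "X (x + l * real j / 2 ^ k) \<omega> \<le> b k" if "j < 2 ^ k" for j k
            using dyadic_no_crossing[where f="\<lambda>t. X t \<omega>" and x=x and l=l and b=b, OF X0 b_mono nc that] by blast
          let ?D = "{x + l * real j / 2 ^ k |j k. j < (2::nat) ^ k}"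
          have D: "?D \<subseteq> {x..x + l}"
          proof safe
            fix j k :: nat assume "j < 2 ^ k"
            then have "real j \<le> 2 ^ k" by (metis less_imp_le of_nat_le_iff of_nat_numeral of_nat_power)
            then have "l * real j / 2 ^ k \<le> l" using l by (simp add: divide_le_eq)
            then show "x + l * real j / 2 ^ k \<in> {x..x + l}" using l by simp
          qed
          have "continuous_on {x..x + l} (\<lambda>t. X t \<omega>)"
            by (rule continuous_on_subset[OF X_cont[OF \<omega>]]) (use x in auto)
          then obtain s where "s \<in> ?D" "u < X s \<omega>"
            using ex ex_greater_dense_iff[OF _ D dyadic_dense] by blast
          then show False using le b(3) by (fastforce dest: order.strict_trans1 simp: not_less[symmetric])
        qed
      qed
      then have "measure M {\<omega> \<in> space M. X x \<omega> \<le> u - a powr \<beta> / u \<and> (\<exists>s\<in>{x..x + a * q u}. u < X s \<omega>)}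
          \<le> measure M (\<Union>k. \<Union>j\<in>{..<2 ^ k}. A k j)"
        by (rule X.finite_measure_mono) auto
      also have "\<dots> \<le> (\<Sum>k. measure M (\<Union>j\<in>{..<2 ^ k}. A k j))"
        by (rule X.finite_measure_subadditive_countably[OF _ summ]) auto
      also have "\<dots> \<le> suminf b'" by (rule suminf_le[OF UA summ b'(1)])
      finally show "measure M {\<omega> \<in> space M. X x \<omega> \<le> u - a powr \<beta> / u \<and> (\<exists>s\<in>{x..x + a * q u}. u < X s \<omega>)} \<le> chain_const * a\<^sup>2 * Psi u"
        using b'(2) by simp
    qed
  qed
qed

end

section \<open>Upper bound and finiteness of the Pickands functional\<close>

context pickands_setting
begin

definition exceed_prob :: "real \<Rightarrow> real \<Rightarrow> real" where
  "exceed_prob t u = measure M {\<omega> \<in> space M. \<exists>s\<in>{0..t}. u < X s \<omega>}"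

definition grid_const :: "real \<Rightarrow> nat \<Rightarrow> real" where
  "grid_const a n = (\<integral>\<omega>. exp (Max ((\<lambda>i. Z (a * real i) \<omega>) ` {..<n})) \<partial>N)"

definition sup_const :: "real \<Rightarrow> real" where
  "sup_const S = (\<integral>\<omega>. exp (Sup ((\<lambda>t. Z t \<omega>) ` {0..S})) \<partial>N)"

lemma grid_const_tendsto:
  assumes "0 \<le> a" "0 < n"
  shows "((\<lambda>u. measure M {\<omega> \<in> space M. \<exists>i<n. u - \<gamma> / u < X (q u * (a * real i)) \<omega>} / gauss_tail u)
    \<longlongrightarrow> exp \<gamma> * grid_const a n) at_top"
  using grid_probability_tendsto(2)[of "\<lambda>i. a * real i" n \<gamma>] assms
  by (simp add: gauss_tail_def grid_const_def)

text \<open>A time of exceedance lies in some grid cell. Either the left end of that cell is already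
  above the lowered level, or the chaining bound applies to the cell.\<close>

lemma exceed_prob_le_grid:
  assumes a: "fine_mesh a" and n: "0 < n"
  shows "\<forall>\<^sub>F u in at_top. exceed_prob (real n * a * q u) u \<le>
    measure M {\<omega> \<in> space M. \<exists>i<n. u - a powr \<beta> / u < X (q u * (a * real i)) \<omega>} + real n * (chain_const * a\<^sup>2 * Psi u)"
  using prob_exceed_from_below[OF a] eventually_gt_at_top[of 0]
proof eventually_elim
  case (elim u)
  have a0: "0 < a" using a by (simp add: fine_mesh_def)
  let ?x = "\<lambda>i::nat. q u * (a * real i)"
  define l where "l = a * q u"
  have l: "0 < l" using a0 q_pos[OF elim(2)] by (simp add: l_def)
  have x: "?x i = l * real i" for i by (simp add: l_def)
  have x0: "0 \<le> ?x i" for i using l unfolding x by simp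
  define A where "A = {\<omega> \<in> space M. \<exists>i<n. u - a powr \<beta> / u < X (?x i) \<omega>}"
  define F where "F i = {\<omega> \<in> space M. X (?x i) \<omega> \<le> u - a powr \<beta> / u \<and> (\<exists>s\<in>{?x i..?x i + a * q u}. u < X s \<omega>)}" for i
  note [measurable] = X.field_measurable[OF x0]
  have [measurable]: "A \<in> sets M" unfolding A_def by measurable
  have [measurable]: "F i \<in> sets M" for i
    unfolding F_def
  proof (rule sets.sets_Collect_conj)
    show "{\<omega> \<in> space M. \<exists>s\<in>{?x i..?x i + a * q u}. u < X s \<omega>} \<in> sets M"
      by (rule X_sets_ex) (use x0[of i] in auto)
  qed measurable
  have "{\<omega> \<in> space M. \<exists>s\<in>{0..real n * a * q u}. u < X s \<omega>} \<subseteq> A \<union> (\<Union>i\<in>{..<n}. F i)"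
  proof safe
    fix \<omega> s assume \<omega>: "\<omega> \<in> space M" and s: "s \<in> {0..real n * a * q u}" and u: "u < X s \<omega>" and nA: "\<omega> \<notin> (\<Union>i\<in>{..<n}. F i)"
    have sn: "s / l \<le> real n" "0 \<le> s / l" using s l by (auto simp: l_def field_simps)
    \<comment> \<open>The right end of the interval is assigned to the last cell n - 1, which is why
      the upper inequality is not strict.\<close>
    obtain i where i: "i < n" "real i \<le> s / l" "s / l \<le> real i + 1"
    proof (cases "s / l = real n")
      case True
      then show ?thesis using n by (intro that[of "n - 1"]) auto
    next
      case False
      have "real (nat \<lfloor>s / l\<rfloor>) = of_int \<lfloor>s / l\<rfloor>" using sn by simp
      then have "real (nat \<lfloor>s / l\<rfloor>) \<le> s / l" "s / l < real (nat \<lfloor>s / l\<rfloor>) + 1" by linarith+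
      moreover have "nat \<lfloor>s / l\<rfloor> < n" using calculation sn False by linarith
      ultimately show ?thesis by (intro that[of "nat \<lfloor>s / l\<rfloor>"]) auto
    qed
    have "?x i \<le> s" "s \<le> ?x i + a * q u"
      using i l unfolding x l_def[symmetric] by (auto simp: field_simps)
    then have "\<exists>s\<in>{?x i..?x i + a * q u}. u < X s \<omega>" using u by auto
    then have "\<not> X (?x i) \<omega> \<le> u - a powr \<beta> / u" using nA i(1) \<omega> by (auto simp: F_def)
    then show "\<omega> \<in> A" using i(1) \<omega> by (auto simp: A_def not_le)
  qed
  then have "exceed_prob (real n * a * q u) u \<le> measure M (A \<union> (\<Union>i\<in>{..<n}. F i))"
    unfolding exceed_prob_def by (rule X.finite_measure_mono) auto
  also have "\<dots> \<le> measure M A + measure M (\<Union>i\<in>{..<n}. F i)"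
    by (rule measure_Un_le) auto
  also have "measure M (\<Union>i\<in>{..<n}. F i) \<le> (\<Sum>i<n. measure M (F i))"
    by (rule X.finite_measure_subadditive_finite) auto
  also have "\<dots> \<le> (\<Sum>i<n. chain_const * a\<^sup>2 * Psi u)"
    using elim(1) x0 by (intro sum_mono) (simp add: F_def)
  also have "\<dots> = real n * (chain_const * a\<^sup>2 * Psi u)" by simp
  finally show ?case by (simp add: A_def)
qed

text \<open>A bound on \<open>Z\<close> proved through \<open>X\<close>: both sides are limits of
  quantities divided by \<open>gauss_tail u\<close>, and before the limit the inequality is clear
  because the points q u * s i lie in the interval that the grid covers.\<close>

lemma finite_points_le_grid:
  fixes s :: "nat \<Rightarrow> real"
  assumes a: "fine_mesh a" and n: "0 < n" and s: "\<And>i. 0 \<le> s i" "s 0 = 0" "\<And>i. s i \<le> real n * a" and k: "0 < k"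
  shows "(\<integral>\<omega>. exp (Max ((\<lambda>i. Z (s i) \<omega>) ` {..<k})) \<partial>N) \<le> exp (a powr \<beta>) * grid_const a n + real n * (chain_const * a\<^sup>2)"
proof (rule tendsto_le)
  have a0: "0 < a" using a by (simp add: fine_mesh_def)
  show "((\<lambda>u. measure M {\<omega> \<in> space M. \<exists>i<k. u - 0 / u < X (q u * s i) \<omega>} / gauss_tail u)
      \<longlongrightarrow> (\<integral>\<omega>. exp (Max ((\<lambda>i. Z (s i) \<omega>) ` {..<k})) \<partial>N)) at_top"
    using grid_probability_tendsto(2)[where s=s and n=k and \<gamma>=0, OF s(1,2) k] by (simp add: gauss_tail_def)
  let ?A = "\<lambda>u. measure M {\<omega> \<in> space M. \<exists>i<n. u - a powr \<beta> / u < X (q u * (a * real i)) \<omega>}"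
  have "((\<lambda>u. ?A u / gauss_tail u + real n * (chain_const * a\<^sup>2) * (Psi u / gauss_tail u))
      \<longlongrightarrow> exp (a powr \<beta>) * grid_const a n + real n * (chain_const * a\<^sup>2) * 1) at_top"
    by (intro tendsto_intros Psi_tendsto grid_const_tendsto) (use a0 n in auto)
  then show "((\<lambda>u. ?A u / gauss_tail u + real n * (chain_const * a\<^sup>2) * (Psi u / gauss_tail u))
      \<longlongrightarrow> exp (a powr \<beta>) * grid_const a n + real n * (chain_const * a\<^sup>2)) at_top" by simp
  show "\<forall>\<^sub>F u in at_top. measure M {\<omega> \<in> space M. \<exists>i<k. u - 0 / u < X (q u * s i) \<omega>} / gauss_tail u
      \<le> ?A u / gauss_tail u + real n * (chain_const * a\<^sup>2) * (Psi u / gauss_tail u)"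
    using exceed_prob_le_grid[OF a n] eventually_gt_at_top[of 0]
  proof eventually_elim
    case (elim u)
    have "measure M {\<omega> \<in> space M. \<exists>i<k. u - 0 / u < X (q u * s i) \<omega>} \<le> exceed_prob (real n * a * q u) u"
      unfolding exceed_prob_def
    proof (rule X.finite_measure_mono)
      have "q u * s i \<in> {0..real n * a * q u}" for i
        using mult_left_mono[OF s(3)[of i] q_nonneg[of u]] s(1)[of i] q_nonneg[of u] by (simp add: mult_ac)
      then show "{\<omega> \<in> space M. \<exists>i<k. u - 0 / u < X (q u * s i) \<omega>} \<subseteq> {\<omega> \<in> space M. \<exists>s\<in>{0..real n * a * q u}. u < X s \<omega>}"
        by auto
    qed (rule X_sets_ex, auto)
    also note elim(1)
    finally have "measure M {\<omega> \<in> space M. \<exists>i<k. u - 0 / u < X (q u * s i) \<omega>} / gauss_tail u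
        \<le> (?A u + real n * (chain_const * a\<^sup>2 * Psi u)) / gauss_tail u"
      by (intro divide_right_mono) (use gauss_tail_pos[OF elim(2)] in auto)
    then show ?case by (simp add: add_divide_distrib mult_ac)
  qed
qed simp

section \<open>Exponential moment of the supremum of the limit process\<close>

lemma Z_cont: "\<omega> \<in> space N \<Longrightarrow> A \<subseteq> {0..} \<Longrightarrow> continuous_on A (\<lambda>t. Z t \<omega>)"
  unfolding Z_def using \<alpha>
  by (intro continuous_intros continuous_on_subset[OF B_cont] continuous_on_powr') (auto simp: subset_iff)

lemma Z_bdd_above: "\<omega> \<in> space N \<Longrightarrow> bdd_above ((\<lambda>t. Z t \<omega>) ` {0..S})"
  by (intro bounded_imp_bdd_above compact_imp_bounded compact_continuous_image Z_cont) auto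

lemma Sup_Z_measurable [measurable]:
  assumes S: "0 \<le> S"
  shows "(\<lambda>\<omega>. Sup ((\<lambda>t. Z t \<omega>) ` {0..S})) \<in> borel_measurable N"
proof (rule borel_measurableI_greater)
  fix w
  have "{\<omega> \<in> space N. w < Sup ((\<lambda>t. Z t \<omega>) ` {0..S})} = {\<omega> \<in> space N. \<exists>s\<in>{0..S}. w < Z s \<omega>}"
    using less_Sup_image_iff[OF Z_cont S] by (auto cong: conj_cong)
  also have "\<dots> \<in> sets N"
    by (rule sets_ex_greater) (auto intro: Z_measurable Z_cont)
  finally show "{\<omega> \<in> space N. w < Sup ((\<lambda>t. Z t \<omega>) ` {0..S})} \<in> sets N" .
qed

text \<open>Monotone convergence along an enumeration of a dense set of times. The bound for
  finitely many points does not depend on their number, so it delivers integrability and the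
  estimate together.\<close>

lemma sup_const_le_grid:
  assumes a: "fine_mesh a" and n: "0 < n"
  shows "integrable N (\<lambda>\<omega>. exp (Sup ((\<lambda>t. Z t \<omega>) ` {0..real n * a})))"
    and "sup_const (real n * a) \<le> exp (a powr \<beta>) * grid_const a n + real n * (chain_const * a\<^sup>2)"
proof -
  let ?S = "real n * a"
  have S: "0 \<le> ?S" using a by (simp add: fine_mesh_def)
  obtain D where D: "countable D" "D \<subseteq> {0..?S}" "{0..?S} \<subseteq> closure D" using separable by blast
  have "D \<noteq> {}" using D(3) S by auto
  \<comment> \<open>Time 0 is put in front because the grid limit conditions on it.\<close>
  define s where "s i = (case i of 0 \<Rightarrow> 0 | Suc j \<Rightarrow> from_nat_into D j)" for i
  have "from_nat_into D j \<in> {0..?S}" for j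
    using from_nat_into[OF \<open>D \<noteq> {}\<close>] D(2) by blast
  then have s: "s i \<in> {0..?S}" for i
    using S by (cases i) (auto simp: s_def)
  then have s': "0 \<le> s i" "s i \<le> ?S" for i by auto
  have s0: "s 0 = 0" by (simp add: s_def)
  define m where "m k \<omega> = Max ((\<lambda>i. Z (s i) \<omega>) ` {..<Suc k})" for k \<omega>
  have int: "integrable N (\<lambda>\<omega>. exp (m k \<omega>))" for k
    unfolding m_def by (rule grid_probability_tendsto(1)) (simp_all add: s0 s')
  have le: "(\<integral>\<omega>. exp (m k \<omega>) \<partial>N) \<le> exp (a powr \<beta>) * grid_const a n + real n * (chain_const * a\<^sup>2)" for k
    unfolding m_def by (rule finite_points_le_grid[OF a n]) (simp_all add: s0 s')
  have mono: "m i \<omega> \<le> m j \<omega>" if "i \<le> j" for i j \<omega>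
    unfolding m_def using that by (intro Max_mono) auto
  have m_le: "m k \<omega> \<le> Sup ((\<lambda>t. Z t \<omega>) ` {0..?S})" if "\<omega> \<in> space N" for k \<omega>
    unfolding m_def using s Z_bdd_above[OF that] by (intro Max.boundedI) (auto intro!: cSup_upper)
  have lim: "(\<lambda>k. m k \<omega>) \<longlonglongrightarrow> Sup ((\<lambda>t. Z t \<omega>) ` {0..?S})" if \<omega>: "\<omega> \<in> space N" for \<omega>
  proof (rule order_tendstoI)
    fix w assume "w < Sup ((\<lambda>t. Z t \<omega>) ` {0..?S})"
    then have "\<exists>t\<in>{0..?S}. w < Z t \<omega>" using less_Sup_image_iff[OF Z_cont[OF \<omega>] S] by auto
    then have "\<exists>t\<in>D. w < Z t \<omega>" using ex_greater_dense_iff[OF Z_cont[OF \<omega>] D(2,3)] by auto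
    then obtain j where j: "w < Z (from_nat_into D j) \<omega>"
      using from_nat_into_surj[OF D(1)] by metis
    have "Z (s (Suc j)) \<omega> \<le> m (Suc j) \<omega>" unfolding m_def by (rule Max_ge) auto
    then have "w < m (Suc j) \<omega>" using j by (simp add: s_def)
    then show "\<forall>\<^sub>F k in sequentially. w < m k \<omega>"
      using mono[of "Suc j" _ \<omega>] by (intro eventually_sequentiallyI[of "Suc j"]) (rule less_le_trans)
  next
    fix w assume "Sup ((\<lambda>t. Z t \<omega>) ` {0..?S}) < w"
    then show "\<forall>\<^sub>F k in sequentially. m k \<omega> < w"
      using m_le[OF \<omega>] by (intro always_eventually allI) (rule le_less_trans)
  qed
  have inc: "incseq (\<lambda>k. \<integral>\<omega>. exp (m k \<omega>) \<partial>N)"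
    by (intro monoI integral_mono int) (simp add: mono)
  obtain L where L: "(\<lambda>k. \<integral>\<omega>. exp (m k \<omega>) \<partial>N) \<longlonglongrightarrow> L"
    using incseq_convergent[OF inc] le by blast
  have *: "AE \<omega> in N. mono (\<lambda>k. exp (m k \<omega>))" "AE \<omega> in N. (\<lambda>k. exp (m k \<omega>)) \<longlonglongrightarrow> exp (Sup ((\<lambda>t. Z t \<omega>) ` {0..?S}))"
    by (auto intro!: AE_I2 monoI tendsto_exp lim mono)
  have meas: "(\<lambda>\<omega>. exp (Sup ((\<lambda>t. Z t \<omega>) ` {0..?S}))) \<in> borel_measurable N"
    using Sup_Z_measurable[OF S] by measurable
  show "integrable N (\<lambda>\<omega>. exp (Sup ((\<lambda>t. Z t \<omega>) ` {0..?S})))"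
    by (rule integrable_monotone_convergence[OF int * L meas])
  have "sup_const ?S = L"
    unfolding sup_const_def by (rule integral_monotone_convergence[OF int * L meas])
  also have "L \<le> exp (a powr \<beta>) * grid_const a n + real n * (chain_const * a\<^sup>2)"
    by (rule LIMSEQ_le_const2[OF L]) (use le in auto)
  finally show "sup_const ?S \<le> exp (a powr \<beta>) * grid_const a n + real n * (chain_const * a\<^sup>2)" .
qed

lemma Sup_Z_mono: "\<omega> \<in> space N \<Longrightarrow> 0 \<le> S \<Longrightarrow> S \<le> S' \<Longrightarrow> Sup ((\<lambda>t. Z t \<omega>) ` {0..S}) \<le> Sup ((\<lambda>t. Z t \<omega>) ` {0..S'})"
  by (intro cSup_subset_mono Z_bdd_above) auto

lemma integrable_exp_Sup_Z:
  assumes S: "0 \<le> S"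
  shows "integrable N (\<lambda>\<omega>. exp (Sup ((\<lambda>t. Z t \<omega>) ` {0..S})))"
proof -
  obtain a where a: "fine_mesh a"
    using eventually_happens'[OF _ eventually_fine_mesh] by auto
  then have a0: "0 < a" by (simp add: fine_mesh_def)
  obtain n where n: "S / a < real n" using reals_Archimedean2 by blast
  then have n': "0 < n" "S \<le> real n * a" using S a0
    by (auto simp: field_simps intro!: Nat.gr0I)
  show ?thesis
  proof (rule Bochner_Integration.integrable_bound[OF sup_const_le_grid(1)[OF a n'(1)]])
    show "(\<lambda>\<omega>. exp (Sup ((\<lambda>t. Z t \<omega>) ` {0..S}))) \<in> borel_measurable N"
      using Sup_Z_measurable[OF S] by measurable
    show "AE \<omega> in N. norm (exp (Sup ((\<lambda>t. Z t \<omega>) ` {0..S}))) \<le> norm (exp (Sup ((\<lambda>t. Z t \<omega>) ` {0..real n * a})))"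
      by (intro AE_I2) (simp add: Sup_Z_mono[OF _ S n'(2)])
  qed
qed

lemma sup_const_mono: "0 \<le> S \<Longrightarrow> S \<le> S' \<Longrightarrow> sup_const S \<le> sup_const S'"
  unfolding sup_const_def by (intro integral_mono integrable_exp_Sup_Z) (auto simp: Sup_Z_mono)

lemma sup_const_nonneg: "0 \<le> sup_const S"
  unfolding sup_const_def by (rule Bochner_Integration.integral_nonneg) simp

lemma grid_const_le_sup_const:
  assumes "0 \<le> a" "0 < n" "a * real (n - 1) \<le> S"
  shows "grid_const a n \<le> sup_const S"
proof -
  have S: "0 \<le> S" using assms by (meson mult_nonneg_nonneg of_nat_0_le_iff order_trans)
  have i: "a * real i \<in> {0..S}" if "i < n" for i
  proof -
    have "a * real i \<le> a * real (n - 1)" using that assms by (intro mult_left_mono) auto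
    then show ?thesis using assms by auto
  qed
  show ?thesis
    unfolding grid_const_def sup_const_def
  proof (rule integral_mono)
    show "integrable N (\<lambda>\<omega>. exp (Max ((\<lambda>i. Z (a * real i) \<omega>) ` {..<n})))"
      by (rule grid_probability_tendsto(1)) (use assms in auto)
    show "integrable N (\<lambda>\<omega>. exp (Sup ((\<lambda>t. Z t \<omega>) ` {0..S})))" by (rule integrable_exp_Sup_Z[OF S])
    fix \<omega> assume \<omega>: "\<omega> \<in> space N"
    have "Max ((\<lambda>i. Z (a * real i) \<omega>) ` {..<n}) \<le> Sup ((\<lambda>t. Z t \<omega>) ` {0..S})"
      using i Z_bdd_above[OF \<omega>] assms(2) by (intro Max.boundedI) (auto intro!: cSup_upper)
    then show "exp (Max ((\<lambda>i. Z (a * real i) \<omega>) ` {..<n})) \<le> exp (Sup ((\<lambda>t. Z t \<omega>) ` {0..S}))" by simp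
  qed
qed

section \<open>From short intervals to a fixed interval: upper bound\<close>

lemma exceed_prob_nonneg: "0 \<le> exceed_prob t u"
  by (simp add: exceed_prob_def)

lemma exceed_prob_subadditive:
  assumes l: "0 < l" and t: "0 \<le> t"
  shows "exceed_prob t u \<le> (t / l + 1) * exceed_prob l u"
proof -
  define n where "n = nat \<lfloor>t / l\<rfloor> + 1"
  have tl: "0 \<le> t / l" using l t by simp
  define F where "F i = {\<omega> \<in> space M. \<exists>s\<in>(\<lambda>s. s + l * real i) ` {0..l}. u < X s \<omega>}" for i :: nat
  have F [measurable]: "F i \<in> sets M" for i unfolding F_def by (rule X_sets_ex) (use l in auto)
  have F_eq: "measure M (F i) = exceed_prob l u" for i
    unfolding F_def exceed_prob_def by (rule X_stationary_ex) (use l in auto)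
  have "{\<omega> \<in> space M. \<exists>s\<in>{0..t}. u < X s \<omega>} \<subseteq> (\<Union>i\<in>{..<n}. F i)"
  proof safe
    fix \<omega> s assume \<omega>: "\<omega> \<in> space M" and s: "s \<in> {0..t}" and u: "u < X s \<omega>"
    define i where "i = nat \<lfloor>s / l\<rfloor>"
    have "0 \<le> s / l" using s l by simp
    then have "real i = of_int \<lfloor>s / l\<rfloor>" by (simp add: i_def)
    then have i: "real i \<le> s / l" "s / l \<le> real i + 1" by linarith+
    have "s / l \<le> t / l" using s l by (simp add: divide_right_mono)
    then have "i < n" unfolding i_def n_def by (simp add: nat_mono floor_mono less_Suc_eq_le)
    moreover have "s - l * real i \<in> {0..l}" using i l by (auto simp: field_simps)
    then have "s \<in> (\<lambda>s. s + l * real i) ` {0..l}" by (rule rev_image_eqI) simp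
    then have "\<omega> \<in> F i" using \<omega> u unfolding F_def by blast
    ultimately show "\<omega> \<in> (\<Union>i\<in>{..<n}. F i)" by blast
  qed
  then have "exceed_prob t u \<le> measure M (\<Union>i\<in>{..<n}. F i)"
    unfolding exceed_prob_def by (rule X.finite_measure_mono) auto
  also have "\<dots> \<le> (\<Sum>i<n. measure M (F i))"
    by (rule X.finite_measure_subadditive_finite) auto
  also have "\<dots> = real n * exceed_prob l u" by (simp add: F_eq)
  also have "real n \<le> t / l + 1" using tl by (simp add: n_def of_nat_nat)
  finally show ?thesis by (simp add: mult_right_mono exceed_prob_nonneg)
qed

text \<open>The mesh a = S / n is fixed beforehand, so fine that the factor exp(a^\<beta>) and the
  total chaining error S * chain_const * a together cost less than e; only then does u grow.\<close>

lemma exceed_prob_small_interval: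
  assumes S: "0 < S" and e: "0 < e"
  shows "\<forall>\<^sub>F u in at_top. exceed_prob (S * q u) u / Psi u \<le> sup_const S + e"
proof -
  have aS: "filterlim (\<lambda>n. S / real n) (at_right 0) sequentially"
    using S by real_asymp
  have "((\<lambda>a. exp (a powr \<beta>) * sup_const S + S * (chain_const * a)) \<longlongrightarrow> exp 0 * sup_const S + S * (chain_const * 0)) (at_right 0)"
    by (intro tendsto_intros powr_\<beta>_tendsto_0)
  then have "\<forall>\<^sub>F a in at_right 0. exp (a powr \<beta>) * sup_const S + S * (chain_const * a) < sup_const S + e"
    by (rule order_tendstoD) (use e in simp)
  then have "\<forall>\<^sub>F a in at_right 0. fine_mesh a \<and> exp (a powr \<beta>) * sup_const S + S * (chain_const * a) < sup_const S + e"
    using eventually_fine_mesh by eventually_elim simp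
  then have "\<forall>\<^sub>F n in sequentially. fine_mesh (S / real n) \<and> exp ((S / real n) powr \<beta>) * sup_const S + S * (chain_const * (S / real n)) < sup_const S + e"
    using aS by (rule eventually_compose_filterlim)
  then have "\<forall>\<^sub>F n in sequentially. 0 < n \<and> fine_mesh (S / real n) \<and> exp ((S / real n) powr \<beta>) * sup_const S + S * (chain_const * (S / real n)) < sup_const S + e"
    using eventually_gt_at_top[of 0] by eventually_elim simp
  then obtain n where n: "0 < n" and fine: "fine_mesh (S / real n)"
    and lt: "exp ((S / real n) powr \<beta>) * sup_const S + S * (chain_const * (S / real n)) < sup_const S + e"
    using eventually_happens'[OF sequentially_bot] by blast
  define a where "a = S / real n"
  have a: "0 < a" "real n * a = S" using S n by (auto simp: a_def)
  let ?A = "\<lambda>u. measure M {\<omega> \<in> space M. \<exists>i<n. u - a powr \<beta> / u < X (q u * (a * real i)) \<omega>}"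
  have "((\<lambda>u. (?A u / gauss_tail u) / (Psi u / gauss_tail u) + real n * (chain_const * a\<^sup>2))
      \<longlongrightarrow> exp (a powr \<beta>) * grid_const a n / 1 + real n * (chain_const * a\<^sup>2)) at_top"
    by (intro tendsto_intros Psi_tendsto grid_const_tendsto) (use a n in auto)
  moreover have "exp (a powr \<beta>) * grid_const a n / 1 + real n * (chain_const * a\<^sup>2) < sup_const S + e"
  proof -
    have "a * real (n - 1) \<le> a * real n" using a by (intro mult_left_mono) auto
    then have "grid_const a n \<le> sup_const S"
      using a n by (intro grid_const_le_sup_const) (auto simp: mult.commute)
    then have "exp (a powr \<beta>) * grid_const a n \<le> exp (a powr \<beta>) * sup_const S" by simp
    moreover have "real n * (chain_const * a\<^sup>2) = S * (chain_const * a)"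
      using a(2) by (simp add: power2_eq_square mult_ac flip: a(2))
    ultimately show ?thesis using lt[folded a_def] by linarith
  qed
  ultimately have "\<forall>\<^sub>F u in at_top. (?A u / gauss_tail u) / (Psi u / gauss_tail u) + real n * (chain_const * a\<^sup>2) < sup_const S + e"
    by (rule order_tendstoD)
  then show ?thesis
    using exceed_prob_le_grid[OF fine n] Psi_eventually_pos eventually_gt_at_top[of 0]
  proof eventually_elim
    case (elim u)
    have g: "0 < gauss_tail u" using gauss_tail_pos elim by simp
    have "exceed_prob (S * q u) u \<le> ?A u + real n * (chain_const * a\<^sup>2 * Psi u)"
      using elim(2) a(2) n by (simp add: a_def)
    then have "exceed_prob (S * q u) u / Psi u \<le> (?A u + real n * (chain_const * a\<^sup>2 * Psi u)) / Psi u"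
      using elim by (intro divide_right_mono) auto
    also have "\<dots> = (?A u / gauss_tail u) / (Psi u / gauss_tail u) + real n * (chain_const * a\<^sup>2)"
      using elim g by (simp add: field_simps)
    finally show ?case using elim(1) by linarith
  qed
qed

lemma exceed_prob_upper:
  assumes S: "0 < S" and t: "0 \<le> t" and e: "0 < e"
  shows "\<forall>\<^sub>F u in at_top. q u * exceed_prob t u / Psi u \<le> t * (sup_const S / S) + e"
proof -
  \<comment> \<open>Gives t / S * e' \<le> e / 2; the summand 1 keeps the denominator positive at t
    = 0.\<close>
  define e' where "e' = e * S / (2 * (t + 1))"
  have e': "0 < e'" using e S t by (simp add: e'_def)
  have "t / S * e' < e"
  proof -
    have "t / S * e' = (t / (t + 1)) * (e / 2)" using S t by (simp add: e'_def field_simps)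
    also have "\<dots> \<le> 1 * (e / 2)" using t e by (intro mult_right_mono) auto
    finally show ?thesis using e by linarith
  qed
  moreover have "((\<lambda>u. (t / S + q u) * (sup_const S + e')) \<longlongrightarrow> (t / S + 0) * (sup_const S + e')) at_top"
    by (intro tendsto_intros q_tendsto_0)
  moreover have "(t / S + 0) * (sup_const S + e') = t * (sup_const S / S) + t / S * e'"
    by (simp add: distrib_left)
  ultimately have "\<forall>\<^sub>F u in at_top. (t / S + q u) * (sup_const S + e') < t * (sup_const S / S) + e"
    by (intro order_tendstoD(2)) auto
  then show ?thesis
    using exceed_prob_small_interval[OF S e'] Psi_eventually_pos eventually_gt_at_top[of 0]
  proof eventually_elim
    case (elim u)
    have q: "0 < q u" using q_pos elim by simp
    have "q u * exceed_prob t u / Psi u \<le> q u * ((t / (S * q u) + 1) * exceed_prob (S * q u) u) / Psi u"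
      using exceed_prob_subadditive[of "S * q u" t u] S q t elim by (intro divide_right_mono mult_left_mono) auto
    also have "\<dots> = (q u * (t / (S * q u) + 1)) * (exceed_prob (S * q u) u / Psi u)"
      by simp
    also have "q u * (t / (S * q u) + 1) = t / S + q u"
      using q S by (simp add: field_simps)
    also have "(t / S + q u) * (exceed_prob (S * q u) u / Psi u) \<le> (t / S + q u) * (sup_const S + e')"
      using elim q t S by (intro mult_left_mono) auto
    finally show ?case using elim by linarith
  qed
qed

end

section \<open>Double sums and the lower bound\<close>

context pickands_setting
begin

lemma prob_pair_le:
  assumes x: "0 \<le> x" and s: "0 \<le> s" and u: "0 < u"
  shows "measure M {\<omega> \<in> space M. u < X x \<omega> \<and> u < X (x + s) \<omega>} \<le> exp (- u\<^sup>2 * (1 - r s) / 4) * Psi u"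
proof -
  have xs: "0 \<le> x + s" using x s by simp
  let ?Y = "\<lambda>\<omega>. (1 / 2) * X x \<omega> + (1 / 2) * X (x + s) \<omega>"
  have Y: "centered_gaussian M ?Y ((1 + r s) / 2)"
    using X.gaussian_pair[OF x xs, of "1 / 2" "1 / 2"] s by (simp add: r_0 power2_eq_square add_divide_distrib)
  note [measurable] = X.field_measurable[OF x] X.field_measurable[OF xs]
  have "measure M {\<omega> \<in> space M. u < X x \<omega> \<and> u < X (x + s) \<omega>} \<le> measure M {\<omega> \<in> space M. u < ?Y \<omega>}"
    by (rule X.finite_measure_mono) auto
  also have "\<dots> \<le> exp (- u\<^sup>2 * (1 - (1 + r s) / 2) / 2) * Psi u"
    by (rule centered_gaussian_tail_le[OF Y _ u]) (use r_le_1[OF s] in simp)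
  also have "- u\<^sup>2 * (1 - (1 + r s) / 2) / 2 = - u\<^sup>2 * (1 - r s) / 4"
    by (simp add: field_simps)
  finally show ?thesis .
qed

text \<open>Positive semidefiniteness at the times 0, s, t with coefficients c, 1, - 1. The
  resulting quadratic in c is minimal at c = r t - r s.\<close>

lemma r_diff_square_le:
  assumes "0 \<le> s" "0 \<le> t"
  shows "(r s - r t)\<^sup>2 \<le> 2 * (1 - r \<bar>s - t\<bar>)"
proof -
  define c where "c = r t - r s"
  have "0 \<le> (\<Sum>i<3. \<Sum>j<3. [c, 1, - 1] ! i * [c, 1, - 1] ! j * r \<bar>[0, s, t] ! i - [0, s, t] ! j\<bar>)"
    by (rule centered_gaussian_nonneg, rule X.gaussian_sum) (use assms in \<open>auto simp: less_Suc_eq numeral_3_eq_3\<close>)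
  also have "\<dots> = c\<^sup>2 + 2 * c * (r s - r t) + 2 * (1 - r \<bar>s - t\<bar>)"
    using assms by (simp add: numeral_3_eq_3 r_0 abs_minus_commute[of t s] power2_eq_square algebra_simps)
  also have "\<dots> = 2 * (1 - r \<bar>s - t\<bar>) - (r s - r t)\<^sup>2"
    by (simp add: c_def power2_eq_square algebra_simps)
  finally show ?thesis by simp
qed

text \<open>The local behaviour at 0 spreads to all times through \<open>r_diff_square_le\<close>.
  Continuity then upgrades the pointwise inequality (A2) to a uniform gap on compact sets away from
  0.\<close>

lemma r_continuous: "continuous_on {0..} r"
  unfolding continuous_on_def
proof
  fix x :: real assume x: "x \<in> {0..}"
  obtain d where d: "0 < d" "\<And>h. 0 < h \<Longrightarrow> h < d \<Longrightarrow> 1 - r h \<le> 2 * C * h powr \<alpha>"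
    using r_local_bound by metis
  have "((\<lambda>s. \<bar>s - x\<bar>) \<longlongrightarrow> \<bar>x - x\<bar>) (at x within {0..})"
    by (intro tendsto_intros)
  then have "((\<lambda>s. \<bar>s - x\<bar>) \<longlongrightarrow> 0) (at x within {0..})"
    by simp
  from tendsto_powr'[OF this tendsto_const] have "((\<lambda>s. \<bar>s - x\<bar> powr \<alpha>) \<longlongrightarrow> 0 powr \<alpha>) (at x within {0..})"
    using \<alpha> by simp
  from tendsto_real_sqrt[OF tendsto_mult[OF tendsto_const this]]
  have "((\<lambda>s. sqrt (4 * C * \<bar>s - x\<bar> powr \<alpha>)) \<longlongrightarrow> 0) (at x within {0..})"
    by simp
  then have "((\<lambda>s. r s - r x) \<longlongrightarrow> 0) (at x within {0..})"
  proof (rule Lim_null_comparison[rotated])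
    show "\<forall>\<^sub>F s in at x within {0..}. norm (r s - r x) \<le> sqrt (4 * C * \<bar>s - x\<bar> powr \<alpha>)"
      unfolding eventually_at
    proof (intro exI[of _ d] conjI ballI impI)
      fix s assume s: "s \<in> {0..}" "s \<noteq> x \<and> dist s x < d"
      then have "1 - r \<bar>s - x\<bar> \<le> 2 * C * \<bar>s - x\<bar> powr \<alpha>"
        by (intro d(2)) (auto simp: dist_real_def)
      then have "(r s - r x)\<^sup>2 \<le> 4 * C * \<bar>s - x\<bar> powr \<alpha>"
        using r_diff_square_le[of s x] s x by simp
      then have "sqrt ((r s - r x)\<^sup>2) \<le> sqrt (4 * C * \<bar>s - x\<bar> powr \<alpha>)" by (rule real_sqrt_le_mono)
      then show "norm (r s - r x) \<le> sqrt (4 * C * \<bar>s - x\<bar> powr \<alpha>)" by simp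
    qed (rule d(1))
  qed
  then show "(r \<longlongrightarrow> r x) (at x within {0..})" by (simp add: LIM_zero_iff)
qed

lemma r_away_from_1:
  assumes "0 < d"
  obtains \<delta> where "0 < \<delta>" "\<And>s. d \<le> s \<Longrightarrow> s \<le> t \<Longrightarrow> \<delta> \<le> 1 - r s"
proof (cases "d \<le> t")
  case True
  have "continuous_on {d..t} r" by (rule continuous_on_subset[OF r_continuous]) (use assms in auto)
  then obtain x where x: "x \<in> {d..t}" "\<And>s. s \<in> {d..t} \<Longrightarrow> r s \<le> r x"
    using continuous_attains_sup[of "{d..t}" r] True by auto
  show ?thesis
    by (rule that[of "1 - r x"]) (use x A2[of x] assms in auto)
next
  case False
  then show ?thesis using that[of 1] by auto
qed

text \<open>At short distance h, 1 - r \<ge> C h^\<alpha> / 2 and \<open>q_powr\<close> give the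
  exponent (a m)^\<alpha> / 8; at long distance the uniform gap \<delta> applies. Adding both bounds
  avoids a case distinction in the double sum, and \<delta> depends on neither u nor the
  mesh.\<close>

lemma prob_pair_grid_le:
  assumes t: "0 < t"
  shows "\<exists>\<delta>>0. \<forall>u a x. \<forall>m::nat. 0 < u \<longrightarrow> 0 < a \<longrightarrow> 0 \<le> x \<longrightarrow> 0 < m \<longrightarrow> q u * (a * real m) \<le> t \<longrightarrow>
    measure M {\<omega> \<in> space M. u < X x \<omega> \<and> u < X (x + q u * (a * real m)) \<omega>}
      \<le> (exp (- ((a * real m) powr \<alpha> / 8)) + exp (- u\<^sup>2 * \<delta> / 4)) * Psi u"
proof -
  obtain d where d: "0 < d" "\<And>h. 0 < h \<Longrightarrow> h < d \<Longrightarrow> C / 2 * h powr \<alpha> \<le> 1 - r h"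
    using r_local_bound by metis
  obtain \<delta> where \<delta>: "0 < \<delta>" "\<And>s. d \<le> s \<Longrightarrow> s \<le> t \<Longrightarrow> \<delta> \<le> 1 - r s"
    using r_away_from_1[OF d(1), of t] by metis
  show ?thesis
  proof (intro exI[of _ \<delta>] conjI allI impI)
    fix u a x :: real and m :: nat
    assume u: "0 < u" and a: "0 < a" and x: "0 \<le> x" and m: "0 < m" and le: "q u * (a * real m) \<le> t"
    let ?s = "q u * (a * real m)"
    have s: "0 < ?s" using q_pos[OF u] a m by simp
    have "measure M {\<omega> \<in> space M. u < X x \<omega> \<and> u < X (x + ?s) \<omega>} \<le> exp (- u\<^sup>2 * (1 - r ?s) / 4) * Psi u"
      by (rule prob_pair_le[OF x less_imp_le[OF s] u])
    also have "\<dots> \<le> (exp (- ((a * real m) powr \<alpha> / 8)) + exp (- u\<^sup>2 * \<delta> / 4)) * Psi u"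
    proof (intro mult_right_mono Psi_nonneg)
      show "exp (- u\<^sup>2 * (1 - r ?s) / 4) \<le> exp (- ((a * real m) powr \<alpha> / 8)) + exp (- u\<^sup>2 * \<delta> / 4)"
      proof (cases "?s < d")
        case True
        have "C / 2 * ?s powr \<alpha> \<le> 1 - r ?s" using d(2) s True by blast
        then have "u\<^sup>2 * (C / 2 * ?s powr \<alpha>) \<le> u\<^sup>2 * (1 - r ?s)" by (rule mult_left_mono) simp
        moreover have "u\<^sup>2 * (C / 2 * ?s powr \<alpha>) = (C * (u\<^sup>2 * (q u) powr \<alpha>)) / 2 * (a * real m) powr \<alpha>"
          by (simp add: powr_mult)
        moreover have "C * (u\<^sup>2 * (q u) powr \<alpha>) = 1" using q_powr[OF u] C by simp
        ultimately have "(a * real m) powr \<alpha> / 8 \<le> u\<^sup>2 * (1 - r ?s) / 4" by simp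
        then have "exp (- u\<^sup>2 * (1 - r ?s) / 4) \<le> exp (- ((a * real m) powr \<alpha> / 8))" by simp
        then show ?thesis by (rule order_trans) simp
      next
        case False
        then have "\<delta> \<le> 1 - r ?s" using \<delta>(2) le by simp
        then have "u\<^sup>2 * \<delta> \<le> u\<^sup>2 * (1 - r ?s)" by (rule mult_left_mono) simp
        then have "exp (- u\<^sup>2 * (1 - r ?s) / 4) \<le> exp (- u\<^sup>2 * \<delta> / 4)" by simp
        then show ?thesis by (rule order_trans) simp
      qed
    qed
    finally show "measure M {\<omega> \<in> space M. u < X x \<omega> \<and> u < X (x + ?s) \<omega>}
      \<le> (exp (- ((a * real m) powr \<alpha> / 8)) + exp (- u\<^sup>2 * \<delta> / 4)) * Psi u" .
  qed (rule \<delta>(1))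
qed

text \<open>The closed form left by \<open>overlap_sum_le\<close>: the factorial and the powers come
  from exp(-x) \<le> p! / x^p, the squared series from the separated double sum. What matters is
  that n does not occur and that it tends to 0 for wide meshes.\<close>

definition overlap_const :: "real \<Rightarrow> real" where
  "overlap_const a = fact (nat \<lceil>4 / \<alpha>\<rceil>) * 8 ^ nat \<lceil>4 / \<alpha>\<rceil> * a powr (- (\<alpha> * real (nat \<lceil>4 / \<alpha>\<rceil>)))
    * (\<Sum>i. 1 / (real i + 1)\<^sup>2)\<^sup>2"

lemma summable_inverse_squares: "summable (\<lambda>i. 1 / (real i + 1)\<^sup>2)"
proof -
  have "summable (\<lambda>n. inverse (real n ^ 2))" by (rule inverse_power_summable) simp
  then have "summable (\<lambda>n. inverse (real (Suc n) ^ 2))" by (subst summable_Suc_iff)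
  then show ?thesis by (simp add: inverse_eq_divide add.commute)
qed

text \<open>Since \<open>(i + j + 1)\<^sup>2 \<ge> (i + 1) (j + 1)\<close>, the bound \<open>exp (- x) \<le> p! / x ^ p\<close> with \<open>\<alpha> p \<ge> 4\<close>
  separates the double sum.\<close>
lemma overlap_sum_le:
  assumes a: "0 < a"
  shows "(\<Sum>i<n. \<Sum>j<m. exp (- ((a * real (i + j + 1)) powr \<alpha> / 8))) \<le> overlap_const a"
proof -
  define p where "p = nat \<lceil>4 / \<alpha>\<rceil>"
  define K where "K = fact p * 8 ^ p * a powr (- (\<alpha> * real p))"
  define \<zeta> where "\<zeta> = (\<Sum>i. 1 / (real i + 1)\<^sup>2)"
  have K: "0 \<le> K" by (simp add: K_def)
  have "4 / \<alpha> \<le> real p" using \<alpha> by (simp add: p_def real_nat_ceiling_ge)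
  then have p: "4 \<le> \<alpha> * real p" using \<alpha> by (simp add: field_simps)
  have term_le: "exp (- ((a * real (i + j + 1)) powr \<alpha> / 8)) \<le> K * (1 / (real i + 1)\<^sup>2 * (1 / (real j + 1)\<^sup>2))" for i j :: nat
  proof -
    define m where "m = real (i + j + 1)"
    have m: "1 \<le> m" by (simp add: m_def)
    have "exp (- ((a * m) powr \<alpha> / 8)) \<le> fact p / ((a * m) powr \<alpha> / 8) ^ p"
      by (rule exp_minus_le_fact_div) (use a m in simp)
    also have "((a * m) powr \<alpha> / 8) ^ p = a powr (\<alpha> * real p) * m powr (\<alpha> * real p) / 8 ^ p"
      using a m by (simp add: power_divide powr_power powr_mult power_mult_distrib mult.commute)
    also have "fact p / (a powr (\<alpha> * real p) * m powr (\<alpha> * real p) / 8 ^ p) = K * (1 / m powr (\<alpha> * real p))"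
      by (simp add: K_def powr_minus_divide)
    also have "\<dots> \<le> K * (1 / (real i + 1)\<^sup>2 * (1 / (real j + 1)\<^sup>2))"
    proof (rule mult_left_mono[OF _ K])
      have "(real i + 1)\<^sup>2 * (real j + 1)\<^sup>2 = ((real i + 1) * (real j + 1))\<^sup>2" by (simp add: power_mult_distrib)
      also have "\<dots> \<le> (m\<^sup>2)\<^sup>2"
      proof (rule power_mono)
        have "(real i + 1) * (real j + 1) \<le> m * m" by (rule mult_mono) (auto simp: m_def)
        then show "(real i + 1) * (real j + 1) \<le> m\<^sup>2" by (simp add: power2_eq_square)
      qed simp
      also have "(m\<^sup>2)\<^sup>2 = m powr 4" using m by (simp add: powr_numeral flip: power_mult)
      also have "\<dots> \<le> m powr (\<alpha> * real p)" using p m by (rule powr_mono)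
      finally have "(real i + 1)\<^sup>2 * (real j + 1)\<^sup>2 \<le> m powr (\<alpha> * real p)" .
      then have "1 / m powr (\<alpha> * real p) \<le> 1 / ((real i + 1)\<^sup>2 * (real j + 1)\<^sup>2)"
        by (intro divide_left_mono) (use m in auto)
      then show "1 / m powr (\<alpha> * real p) \<le> 1 / (real i + 1)\<^sup>2 * (1 / (real j + 1)\<^sup>2)" by simp
    qed
    finally show ?thesis by (simp add: m_def)
  qed
  have partial: "(\<Sum>i<n. 1 / (real i + 1)\<^sup>2) \<le> \<zeta>" for n
    unfolding \<zeta>_def by (rule sum_le_suminf[OF summable_inverse_squares]) auto
  have "(\<Sum>i<n. \<Sum>j<m. exp (- ((a * real (i + j + 1)) powr \<alpha> / 8)))
      \<le> (\<Sum>i<n. \<Sum>j<m. K * (1 / (real i + 1)\<^sup>2 * (1 / (real j + 1)\<^sup>2)))"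
    by (intro sum_mono term_le)
  also have "\<dots> = K * ((\<Sum>i<n. 1 / (real i + 1)\<^sup>2) * (\<Sum>j<m. 1 / (real j + 1)\<^sup>2))"
    by (subst sum_product) (simp only: sum_distrib_left)
  also have "\<dots> \<le> K * (\<zeta> * \<zeta>)"
    by (intro mult_left_mono mult_mono partial K order_trans[OF _ partial[of 0]] sum_nonneg) auto
  finally show ?thesis by (simp add: overlap_const_def K_def p_def \<zeta>_def power2_eq_square)
qed

lemma overlap_const_tendsto_0: "(overlap_const \<longlongrightarrow> 0) at_top"
proof -
  define p where "p = nat \<lceil>4 / \<alpha>\<rceil>"
  have "4 / \<alpha> \<le> real p" using \<alpha> by (simp add: p_def real_nat_ceiling_ge)
  then have "0 < \<alpha> * real p" using \<alpha> by (simp add: field_simps)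
  then have "((\<lambda>a. a powr (- (\<alpha> * real p))) \<longlongrightarrow> 0) at_top"
    by (intro tendsto_neg_powr filterlim_ident) auto
  then have "((\<lambda>a. fact p * 8 ^ p * a powr (- (\<alpha> * real p)) * (\<Sum>i. 1 / (real i + 1)\<^sup>2)\<^sup>2)
      \<longlongrightarrow> fact p * 8 ^ p * 0 * (\<Sum>i. 1 / (real i + 1)\<^sup>2)\<^sup>2) at_top"
    by (intro tendsto_intros)
  then show ?thesis by (simp add: overlap_const_def[abs_def] p_def)
qed

text \<open>At most \<open>m\<close> pairs of grid points at distance \<open>m\<close> straddle a given block boundary, so the
  error per block in Bonferroni's inequality does not grow with the block length \<open>n\<close>.\<close>
lemma prob_blocks_lower:
  fixes J n :: nat
  assumes u: "0 < u" and a: "0 < a" and n: "0 < n" and J: "q u * (a * real (J * n)) \<le> t"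
    and pair: "\<And>x m. 0 \<le> x \<Longrightarrow> 0 < m \<Longrightarrow> q u * (a * real m) \<le> t \<Longrightarrow>
      measure M {\<omega> \<in> space M. u < X x \<omega> \<and> u < X (x + q u * (a * real m)) \<omega>}
      \<le> (exp (- ((a * real m) powr \<alpha> / 8)) + \<epsilon>) * Psi u" and e: "0 \<le> \<epsilon>"
  shows "real J * (measure M {\<omega> \<in> space M. \<exists>i<n. u < X (q u * (a * real i)) \<omega>}
      - (overlap_const a + real n * real (J * n) * \<epsilon>) * Psi u) \<le> measure M {\<omega> \<in> space M. \<exists>k<J * n. u < X (q u * (a * real k)) \<omega>}"
proof -
  define x where "x k = q u * (a * real k)" for k :: nat
  have x0: "0 \<le> x k" for k using q_nonneg[of u] a by (simp add: x_def)
  have x_add: "x (k + m) = x k + x m" for k m by (simp add: x_def algebra_simps)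
  note [measurable] = X.field_measurable[OF x0]
  define P0 where "P0 = measure M {\<omega> \<in> space M. \<exists>i<n. u < X (x i) \<omega>}"
  define c where "c = (overlap_const a + real n * real (J * n) * \<epsilon>) * Psi u"
  \<comment> \<open>Bonferroni one block at a time: each new block meets the union of all earlier
    ones with probability at most c.\<close>
  have "real I * (P0 - c) \<le> measure M {\<omega> \<in> space M. \<exists>k<I * n. u < X (x k) \<omega>}" if "I \<le> J" for I
    using that
  proof (induction I)
    case 0
    then show ?case by simp
  next
    case (Suc I)
    define E where "E = {\<omega> \<in> space M. \<exists>k<I * n. u < X (x k) \<omega>}"
    define A where "A = {\<omega> \<in> space M. \<exists>i<n. u < X (x (I * n + i)) \<omega>}"
    have [measurable]: "E \<in> sets M" "A \<in> sets M" unfolding E_def A_def by measurable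
    have PA: "measure M A = P0"
    proof -
      have "A = {\<omega> \<in> space M. \<exists>s\<in>x ` {..<n}. u < X (s + x (I * n)) \<omega>}"
        by (auto simp: A_def x_add add.commute)
      then have "measure M A = measure M {\<omega> \<in> space M. \<exists>s\<in>x ` {..<n}. u < X s \<omega>}"
        using X_stationary[of "x ` {..<n}" "x (I * n)" u] x0 by auto
      also have "{\<omega> \<in> space M. \<exists>s\<in>x ` {..<n}. u < X s \<omega>} = {\<omega> \<in> space M. \<exists>i<n. u < X (x i) \<omega>}"
        by auto
      finally show ?thesis by (simp only: P0_def)
    qed
    have split: "{\<omega> \<in> space M. \<exists>k<Suc I * n. u < X (x k) \<omega>} = E \<union> A"
    proof -
      have "(\<exists>k<Suc I * n. Q k) \<longleftrightarrow> (\<exists>k<I * n. Q k) \<or> (\<exists>i<n. Q (I * n + i))" for Q :: "nat \<Rightarrow> bool"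
      proof safe
        fix k assume k: "k < Suc I * n" "Q k" and no: "\<not> (\<exists>i<n. Q (I * n + i))"
        have "k < I * n"
        proof (rule ccontr)
          assume "\<not> k < I * n"
          then have "k = I * n + (k - I * n)" "k - I * n < n" using k by auto
          then show False using no k(2) by metis
        qed
        then show "\<exists>k<I * n. Q k" using k by blast
      next
        fix k assume "k < I * n" "Q k" then show "\<exists>k<Suc I * n. Q k" by (intro exI[of _ k]) auto
      next
        fix i assume "i < n" "Q (I * n + i)" then show "\<exists>k<Suc I * n. Q k" by (intro exI[of _ "I * n + i"]) auto
      qed
      then show ?thesis by (auto simp: E_def A_def)
    qed
    have overlap: "measure M (E \<inter> A) \<le> c"
    proof -
      \<comment> \<open>i counts forward from the block boundary and l backward from the last
        earlier point, so the pair is i + l + 1 grid steps apart.\<close>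
      define F where "F i l = {\<omega> \<in> space M. u < X (x (I * n - 1 - l)) \<omega> \<and> u < X (x (I * n - 1 - l) + x (i + l + 1)) \<omega>}"
        for i l :: nat
      have xx: "0 \<le> x k + x m" for k m using x0[of k] x0[of m] by simp
      note [measurable] = X.field_measurable[OF xx]
      have [measurable]: "F i l \<in> sets M" for i l unfolding F_def by measurable
      have "E \<inter> A \<subseteq> (\<Union>i\<in>{..<n}. \<Union>l\<in>{..<I * n}. F i l)"
      proof
        fix \<omega> assume "\<omega> \<in> E \<inter> A"
        then obtain k i where k: "k < I * n" "u < X (x k) \<omega>" and i: "i < n" "u < X (x (I * n + i)) \<omega>" and \<omega>: "\<omega> \<in> space M"
          by (auto simp: E_def A_def)
        define l where "l = I * n - 1 - k"
        have l: "l < I * n" "I * n - 1 - l = k" "k + (i + l + 1) = I * n + i" using k(1) by (auto simp: l_def)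
        have "x k + x (i + l + 1) = x (I * n + i)" by (simp only: x_add[symmetric] l(3))
        then have "\<omega> \<in> F i l" using k i \<omega> by (simp only: F_def l(2) mem_Collect_eq)
        then show "\<omega> \<in> (\<Union>i\<in>{..<n}. \<Union>l\<in>{..<I * n}. F i l)" using i(1) l(1) by blast
      qed
      then have "measure M (E \<inter> A) \<le> measure M (\<Union>i\<in>{..<n}. \<Union>l\<in>{..<I * n}. F i l)"
        by (rule X.finite_measure_mono) measurable
      also have "\<dots> \<le> (\<Sum>i<n. measure M (\<Union>l\<in>{..<I * n}. F i l))"
        by (rule X.finite_measure_subadditive_finite) auto
      also have "\<dots> \<le> (\<Sum>i<n. \<Sum>l<I * n. measure M (F i l))"
        by (intro sum_mono X.finite_measure_subadditive_finite) auto
      also have "\<dots> \<le> (\<Sum>i<n. \<Sum>l<I * n. (exp (- ((a * real (i + l + 1)) powr \<alpha> / 8)) + \<epsilon>) * Psi u)"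
      proof (intro sum_mono)
        fix i l assume i: "i \<in> {..<n}" and l: "l \<in> {..<I * n}"
        have "i + l + 1 \<le> Suc I * n" using i l by auto
        also have "Suc I * n \<le> J * n" using Suc.prems by (intro mult_right_mono) auto
        finally have "real (i + l + 1) \<le> real (J * n)" by (simp only: of_nat_le_iff)
        then have "q u * (a * real (i + l + 1)) \<le> q u * (a * real (J * n))"
          using q_nonneg[of u] a by (intro mult_left_mono) auto
        then have "q u * (a * real (i + l + 1)) \<le> t" using J by (rule order_trans)
        then show "measure M (F i l) \<le> (exp (- ((a * real (i + l + 1)) powr \<alpha> / 8)) + \<epsilon>) * Psi u"
          unfolding F_def x_def[of "i + l + 1"] using pair[of "x (I * n - 1 - l)" "i + l + 1"] x0 by simp
      qed
      also have "\<dots> = ((\<Sum>i<n. \<Sum>l<I * n. exp (- ((a * real (i + l + 1)) powr \<alpha> / 8))) + real n * real (I * n) * \<epsilon>) * Psi u"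
        unfolding sum_distrib_right[symmetric] sum.distrib by simp
      also have "\<dots> \<le> c"
        unfolding c_def
      proof (intro mult_right_mono add_mono overlap_sum_le[OF a] Psi_nonneg e mult_left_mono)
        have "I * n \<le> J * n" using Suc.prems by simp
        then show "real (I * n) \<le> real (J * n)" by (simp only: of_nat_le_iff)
      qed auto
      finally show ?thesis .
    qed
    have "measure M (E \<union> A) = measure M E + measure M A - measure M (E \<inter> A)"
      by (rule measure_Un3) (auto simp: X.fmeasurable_eq_sets)
    moreover have "real I * (P0 - c) \<le> measure M E" unfolding E_def using Suc by simp
    ultimately have "real (Suc I) * (P0 - c) \<le> measure M (E \<union> A)"
      using overlap PA by (simp add: algebra_simps)
    then show ?case by (simp only: split)
  qed
  from this[OF order_refl] show ?thesis by (simp add: P0_def c_def x_def)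
qed

lemma exceed_prob_lower:
  assumes a: "0 < a" and n: "0 < n" and t: "0 < t" and e: "0 < e"
  shows "\<forall>\<^sub>F u in at_top. t * ((grid_const a n - overlap_const a) / (a * real n)) - e \<le> q u * exceed_prob t u / Psi u"
proof -
  obtain \<delta> where \<delta>: "0 < \<delta>" and pair: "\<And>u a x m. 0 < u \<Longrightarrow> 0 < a \<Longrightarrow> 0 \<le> x \<Longrightarrow> 0 < m \<Longrightarrow> q u * (a * real m) \<le> t \<Longrightarrow>
    measure M {\<omega> \<in> space M. u < X x \<omega> \<and> u < X (x + q u * (a * real m)) \<omega>}
      \<le> (exp (- ((a * real m) powr \<alpha> / 8)) + exp (- u\<^sup>2 * \<delta> / 4)) * Psi u"
    using prob_pair_grid_le[OF t] by blast
  \<comment> \<open>The number of whole blocks, each of length q u * a * n, that fit into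
    [0, t].\<close>
  define J where "J u = nat \<lfloor>t / (q u * a * real n)\<rfloor>" for u
  have J_real: "real (J u) = of_int \<lfloor>t / (q u * a * real n)\<rfloor>" if "0 < u" for u
    using q_pos[OF that] a n t by (simp add: J_def)
  have J_upper: "q u * (a * real (J u * n)) \<le> t" if "0 < u" for u
  proof -
    have "real (J u) \<le> t / (q u * a * real n)" unfolding J_real[OF that] by linarith
    then show ?thesis using q_pos[OF that] a n by (simp add: field_simps)
  qed
  have J_lower: "t / (a * real n) - q u \<le> q u * real (J u)" if "0 < u" for u
  proof -
    have "t / (q u * a * real n) - 1 \<le> real (J u)" unfolding J_real[OF that] by linarith
    then have "q u * (t / (q u * a * real n) - 1) \<le> q u * real (J u)" using q_nonneg by (rule mult_left_mono)
    then show ?thesis using q_pos[OF that] by (simp add: right_diff_distrib)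
  qed
  have J_lim: "((\<lambda>u. q u * real (J u)) \<longlongrightarrow> t / (a * real n)) at_top"
  proof (rule tendsto_sandwich)
    have "((\<lambda>u. t / (a * real n) - q u) \<longlongrightarrow> t / (a * real n) - 0) at_top"
      by (intro tendsto_intros q_tendsto_0)
    then show "((\<lambda>u. t / (a * real n) - q u) \<longlongrightarrow> t / (a * real n)) at_top" by simp
    show "((\<lambda>u. t / (a * real n)) \<longlongrightarrow> t / (a * real n)) at_top" by simp
    show "\<forall>\<^sub>F u in at_top. t / (a * real n) - q u \<le> q u * real (J u)"
      using eventually_gt_at_top[of 0] by eventually_elim (rule J_lower)
    show "\<forall>\<^sub>F u in at_top. q u * real (J u) \<le> t / (a * real n)"
      using eventually_gt_at_top[of 0]
      by eventually_elim (use J_upper a n in \<open>simp add: field_simps\<close>)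
  qed
  \<comment> \<open>The long-distance term is multiplied by the number of grid points, of order
    u^(2/\<alpha>); the Gaussian factor still wins.\<close>
  have err: "((\<lambda>u. real n * real (J u * n) * exp (- u\<^sup>2 * \<delta> / 4)) \<longlongrightarrow> 0) at_top"
  proof -
    have "((\<lambda>u::real. u powr (2 / \<alpha>) * exp (- u\<^sup>2 * \<delta> / 4)) \<longlongrightarrow> 0) at_top"
      using \<delta> \<alpha> by real_asymp
    then have "((\<lambda>u. (real n * real n * C powr (1 / \<alpha>)) * (q u * real (J u)) * (u powr (2 / \<alpha>) * exp (- u\<^sup>2 * \<delta> / 4)))
        \<longlongrightarrow> (real n * real n * C powr (1 / \<alpha>)) * (t / (a * real n)) * 0) at_top"
      by (intro tendsto_intros J_lim)
    moreover have "\<forall>\<^sub>F u in at_top. (real n * real n * C powr (1 / \<alpha>)) * (q u * real (J u)) * (u powr (2 / \<alpha>) * exp (- u\<^sup>2 * \<delta> / 4))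
        = real n * real (J u * n) * exp (- u\<^sup>2 * \<delta> / 4)"
      using eventually_gt_at_top[of 0]
    proof eventually_elim
      case (elim u)
      have "C powr (1 / \<alpha>) * u powr (2 / \<alpha>) * q u = 1"
        using elim C by (simp add: q_def powr_minus field_simps flip: powr_add)
      moreover have "(real n * real n * C powr (1 / \<alpha>)) * (q u * real (J u)) * (u powr (2 / \<alpha>) * exp (- u\<^sup>2 * \<delta> / 4))
          = (C powr (1 / \<alpha>) * u powr (2 / \<alpha>) * q u) * (real n * real (J u * n) * exp (- u\<^sup>2 * \<delta> / 4))"
        by (simp add: mult_ac)
      ultimately show ?case by simp
    qed
    ultimately have "((\<lambda>u. real n * real (J u * n) * exp (- u\<^sup>2 * \<delta> / 4))
        \<longlongrightarrow> (real n * real n * C powr (1 / \<alpha>)) * (t / (a * real n)) * 0) at_top"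
      by (rule Lim_transform_eventually)
    then show ?thesis by simp
  qed
  let ?P = "\<lambda>u. measure M {\<omega> \<in> space M. \<exists>i<n. u < X (q u * (a * real i)) \<omega>}"
  have P: "((\<lambda>u. ?P u / gauss_tail u) \<longlongrightarrow> grid_const a n) at_top"
    using grid_const_tendsto[of a n 0] a n by simp
  have "((\<lambda>u. q u * real (J u) * ((?P u / gauss_tail u) / (Psi u / gauss_tail u) - (overlap_const a + real n * real (J u * n) * exp (- u\<^sup>2 * \<delta> / 4))))
      \<longlongrightarrow> t / (a * real n) * (grid_const a n / 1 - (overlap_const a + 0))) at_top"
    by (intro tendsto_intros J_lim P Psi_tendsto err) simp
  moreover have "t * ((grid_const a n - overlap_const a) / (a * real n)) - e < t / (a * real n) * (grid_const a n / 1 - (overlap_const a + 0))"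
    using e by simp
  ultimately have "\<forall>\<^sub>F u in at_top. t * ((grid_const a n - overlap_const a) / (a * real n)) - e
      < q u * real (J u) * ((?P u / gauss_tail u) / (Psi u / gauss_tail u) - (overlap_const a + real n * real (J u * n) * exp (- u\<^sup>2 * \<delta> / 4)))"
    by (rule order_tendstoD)
  then show ?thesis
    using Psi_eventually_pos eventually_gt_at_top[of 0]
  proof eventually_elim
    case (elim u)
    have g: "0 < gauss_tail u" using gauss_tail_pos elim by simp
    let ?c = "overlap_const a + real n * real (J u * n) * exp (- u\<^sup>2 * \<delta> / 4)"
    have "real (J u) * (?P u - ?c * Psi u) \<le> measure M {\<omega> \<in> space M. \<exists>k<J u * n. u < X (q u * (a * real k)) \<omega>}"
      by (rule prob_blocks_lower[OF elim(3) a n J_upper[OF elim(3)]]) (use pair[OF elim(3) a] in auto)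
    also have "\<dots> \<le> exceed_prob t u"
      unfolding exceed_prob_def
    proof (rule X.finite_measure_mono)
      have "q u * (a * real k) \<in> {0..t}" if "k < J u * n" for k
      proof -
        have "q u * (a * real k) \<le> q u * (a * real (J u * n))"
          using q_nonneg[of u] a less_imp_le[OF that] by (intro mult_left_mono) (simp_all only: of_nat_le_iff less_imp_le)
        then show ?thesis using J_upper[OF elim(3)] q_nonneg[of u] a by auto
      qed
      then show "{\<omega> \<in> space M. \<exists>k<J u * n. u < X (q u * (a * real k)) \<omega>} \<subseteq> {\<omega> \<in> space M. \<exists>s\<in>{0..t}. u < X s \<omega>}"
        by blast
    qed (rule X_sets_ex, auto)
    finally have "q u * (real (J u) * (?P u - ?c * Psi u)) / Psi u \<le> q u * exceed_prob t u / Psi u"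
      using elim q_nonneg[of u] by (intro divide_right_mono mult_left_mono) auto
    moreover have "q u * (real (J u) * (?P u - ?c * Psi u)) / Psi u = q u * real (J u) * ((?P u / gauss_tail u) / (Psi u / gauss_tail u) - ?c)"
    proof -
      have "(?P u / gauss_tail u) / (Psi u / gauss_tail u) - ?c = (?P u - ?c * Psi u) / Psi u"
        using g elim(2) by (simp add: diff_divide_distrib)
      then show ?thesis by (simp only: mult.assoc times_divide_eq_right)
    qed
    ultimately show ?case using elim(1) by linarith
  qed
qed

end

section \<open>Pickands constant\<close>

context pickands_setting
begin

text \<open>An infimum, so that the number is available before convergence is known;
  \<open>sup_const_tendsto\<close> identifies it with the limit.\<close>

definition pickands_const :: real where
  "pickands_const = Inf ((\<lambda>S. sup_const S / S) ` {0<..})"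

lemma H_le: "0 < S \<Longrightarrow> pickands_const \<le> sup_const S / S"
  unfolding pickands_const_def
  by (intro cInf_lower bdd_belowI[of _ 0]) (auto simp: sup_const_nonneg intro!: divide_nonneg_nonneg)

lemma H_nonneg: "0 \<le> pickands_const"
  unfolding pickands_const_def by (intro cInf_greatest) (auto simp: sup_const_nonneg intro!: divide_nonneg_nonneg)

text \<open>The lower and the upper estimate of the same normalised exceedance probability on
  [0, 1], with unrelated parameters: a and n on one side, S on the other. Once compared, u
  disappears and an inequality about \<open>Z\<close> alone remains.\<close>

lemma grid_const_le_H:
  assumes a: "0 < a" and n: "0 < n"
  shows "(grid_const a n - overlap_const a) / (a * real n) \<le> pickands_const"
  unfolding pickands_const_def
proof (rule cInf_greatest)
  fix y assume "y \<in> (\<lambda>S. sup_const S / S) ` {0<..}"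
  then obtain S where S: "0 < S" and y: "y = sup_const S / S" by auto
  show "(grid_const a n - overlap_const a) / (a * real n) \<le> y"
  proof (rule field_le_epsilon)
    fix e :: real assume e: "0 < e"
    have "\<forall>\<^sub>F u::real in at_top. (grid_const a n - overlap_const a) / (a * real n) \<le> sup_const S / S + e / 2 + e / 2"
      using exceed_prob_lower[OF a n zero_less_one half_gt_zero[OF e]] exceed_prob_upper[OF S zero_le_one half_gt_zero[OF e]]
      by eventually_elim linarith
    then show "(grid_const a n - overlap_const a) / (a * real n) \<le> y + e"
      by (simp add: y eventually_const_iff)
  qed
qed auto

text \<open>Blocks of a single point, n = 1, for which \<open>grid_const\<close> equals 1, on a mesh
  so wide that the overlap stays below 1.\<close>

lemma H_pos: "0 < pickands_const"
proof -
  have "\<forall>\<^sub>F a in at_top. overlap_const a < 1"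
    by (rule order_tendstoD(2)[OF overlap_const_tendsto_0]) simp
  then have "\<forall>\<^sub>F a in at_top. overlap_const a < 1 \<and> 0 < a"
    using eventually_gt_at_top[of 0] by eventually_elim simp
  then obtain a where a: "overlap_const a < 1" "0 < a"
    using eventually_happens'[OF trivial_limit_at_top_linorder] by blast
  have B0: "centered_gaussian N (B 0) 0"
    using B.gaussian_single[of 0] \<alpha> by simp
  have "grid_const a 1 = (\<integral>\<omega>. exp (sqrt 2 * B 0 \<omega>) \<partial>N)"
    unfolding grid_const_def using \<alpha> by (intro Bochner_Integration.integral_cong) (auto simp: Z_def lessThan_Suc)
  also have "\<dots> = 1" using centered_gaussian_mgf(2)[OF B0, of "sqrt 2"] by simp
  finally have "0 < (grid_const a 1 - overlap_const a) / (a * real 1)" using a by simp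
  also have "\<dots> \<le> pickands_const" by (rule grid_const_le_H) (use a in auto)
  finally show ?thesis .
qed

text \<open>At a fixed fine mesh, \<open>sup_const_le_grid\<close> followed by
  \<open>grid_const_le_H\<close> bounds \<open>sup_const S\<close> by an affine function of S with
  slope exp(a^\<beta>) pickands_const + chain_const a. The constant term dies on division by S, and
  a small mesh brings the slope close to the infimum.\<close>

lemma sup_const_tendsto: "((\<lambda>S. sup_const S / S) \<longlongrightarrow> pickands_const) at_top"
proof (rule order_tendstoI)
  fix y assume y: "y < pickands_const"
  show "\<forall>\<^sub>F S in at_top. y < sup_const S / S"
    using eventually_gt_at_top[of 0] by eventually_elim (rule less_le_trans[OF y H_le])
next
  fix y assume y: "pickands_const < y"
  have "((\<lambda>a. exp (a powr \<beta>) * pickands_const + chain_const * a) \<longlongrightarrow> exp 0 * pickands_const + chain_const * 0) (at_right 0)"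
    by (intro tendsto_intros powr_\<beta>_tendsto_0)
  then have "\<forall>\<^sub>F a in at_right 0. exp (a powr \<beta>) * pickands_const + chain_const * a < y"
    by (rule order_tendstoD) (use y in simp)
  then have "\<forall>\<^sub>F a in at_right 0. fine_mesh a \<and> exp (a powr \<beta>) * pickands_const + chain_const * a < y"
    using eventually_fine_mesh by eventually_elim simp
  then obtain a where fine: "fine_mesh a" and lt: "exp (a powr \<beta>) * pickands_const + chain_const * a < y"
    using eventually_happens'[of "at_right (0::real)"] by auto
  have a: "0 < a" using fine by (simp add: fine_mesh_def)
  let ?g = "exp (a powr \<beta>)"
  have bound: "sup_const S \<le> ?g * ((S + a) * pickands_const + overlap_const a) + (S + a) * (chain_const * a)" if S: "0 < S" for S
  proof -
    define n where "n = nat \<lceil>S / a\<rceil>"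
    have "0 < S / a" using S a by simp
    then have nr: "real n = of_int \<lceil>S / a\<rceil>" and n0: "0 < n" by (auto simp: n_def)
    have "S / a \<le> real n" "real n \<le> S / a + 1" unfolding nr by linarith+
    then have n: "S \<le> real n * a" "real n * a \<le> S + a" using a by (auto simp: field_simps)
    have "grid_const a n \<le> (real n * a) * pickands_const + overlap_const a"
      using grid_const_le_H[OF a n0] a n0 by (simp add: field_simps)
    also have "\<dots> \<le> (S + a) * pickands_const + overlap_const a"
      using n H_nonneg by (intro add_right_mono mult_right_mono) auto
    finally have g: "?g * grid_const a n \<le> ?g * ((S + a) * pickands_const + overlap_const a)" by simp
    have "sup_const S \<le> sup_const (real n * a)" by (rule sup_const_mono) (use S n in auto)
    also have "\<dots> \<le> ?g * grid_const a n + real n * (chain_const * a\<^sup>2)"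
      by (rule sup_const_le_grid(2)[OF fine n0])
    also have "real n * (chain_const * a\<^sup>2) = (real n * a) * (chain_const * a)"
      by (simp add: power2_eq_square mult_ac)
    also have "\<dots> \<le> (S + a) * (chain_const * a)"
      using n chain_const_nonneg a by (intro mult_right_mono) auto
    finally show ?thesis using g by linarith
  qed
  have inv: "((\<lambda>S::real. a / S) \<longlongrightarrow> 0) at_top" "((\<lambda>S::real. overlap_const a / S) \<longlongrightarrow> 0) at_top"
    by real_asymp+
  have "((\<lambda>S. ?g * ((1 + a / S) * pickands_const + overlap_const a / S) + (1 + a / S) * (chain_const * a))
      \<longlongrightarrow> ?g * ((1 + 0) * pickands_const + 0) + (1 + 0) * (chain_const * a)) at_top"
    by (intro tendsto_intros inv)
  then have "\<forall>\<^sub>F S in at_top. ?g * ((1 + a / S) * pickands_const + overlap_const a / S) + (1 + a / S) * (chain_const * a) < y"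
    by (rule order_tendstoD) (use lt in simp)
  then show "\<forall>\<^sub>F S in at_top. sup_const S / S < y"
    using eventually_gt_at_top[of 0]
  proof eventually_elim
    case (elim S)
    have "sup_const S / S \<le> (?g * ((S + a) * pickands_const + overlap_const a) + (S + a) * (chain_const * a)) / S"
      using bound[OF elim(2)] elim(2) by (intro divide_right_mono) auto
    also have "\<dots> = ?g * ((1 + a / S) * pickands_const + overlap_const a / S) + (1 + a / S) * (chain_const * a)"
      using elim(2) by (simp add: field_simps)
    finally show ?case using elim(1) by linarith
  qed
qed

text \<open>First a is chosen, which settles the chaining loss; then n, which makes overlap_const a
  / (a n) negligible. In this order the growth of \<open>overlap_const a\<close> for fine meshes
  does no harm.\<close>

lemma exceed_prob_eventually_ge:
  assumes t: "0 < t" and e: "0 < e"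
  shows "\<forall>\<^sub>F u in at_top. t * pickands_const - e \<le> q u * exceed_prob t u / Psi u"
proof -
  have "((\<lambda>a. t * (exp (- (a powr \<beta>)) * (pickands_const - chain_const * a))) \<longlongrightarrow> t * (exp (- 0) * (pickands_const - chain_const * 0))) (at_right 0)"
    by (intro tendsto_intros powr_\<beta>_tendsto_0)
  then have "\<forall>\<^sub>F a in at_right 0. t * pickands_const - e / 2 < t * (exp (- (a powr \<beta>)) * (pickands_const - chain_const * a))"
    by (rule order_tendstoD) (use e in simp)
  then have "\<forall>\<^sub>F a in at_right 0. fine_mesh a \<and> t * pickands_const - e / 2 < t * (exp (- (a powr \<beta>)) * (pickands_const - chain_const * a))"
    using eventually_fine_mesh by eventually_elim simp
  then obtain a where fine: "fine_mesh a" and lt: "t * pickands_const - e / 2 < t * (exp (- (a powr \<beta>)) * (pickands_const - chain_const * a))"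
    using eventually_happens'[of "at_right (0::real)"] by auto
  have a: "0 < a" using fine by (simp add: fine_mesh_def)
  let ?L = "exp (- (a powr \<beta>)) * (pickands_const - chain_const * a)"
  have "((\<lambda>n. t * (?L - overlap_const a / (a * real n))) \<longlongrightarrow> t * (?L - 0)) sequentially"
  proof (intro tendsto_intros)
    show "((\<lambda>n. overlap_const a / (a * real n)) \<longlongrightarrow> 0) sequentially" using a by real_asymp
  qed
  then have "\<forall>\<^sub>F n in sequentially. t * pickands_const - e / 2 < t * (?L - overlap_const a / (a * real n))"
    by (rule order_tendstoD) (use lt in simp)
  then have "\<forall>\<^sub>F n in sequentially. t * pickands_const - e / 2 < t * (?L - overlap_const a / (a * real n)) \<and> 0 < n"
    using eventually_gt_at_top[of 0] by eventually_elim simp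
  then obtain n where n: "0 < n" and ltn: "t * pickands_const - e / 2 < t * (?L - overlap_const a / (a * real n))"
    using eventually_happens'[OF sequentially_bot] by blast
  have an: "0 < a * real n" using a n by simp
  have "pickands_const * (a * real n) \<le> sup_const (real n * a)"
    using H_le[of "real n * a"] an by (simp add: field_simps)
  also have "\<dots> \<le> exp (a powr \<beta>) * grid_const a n + real n * (chain_const * a\<^sup>2)"
    by (rule sup_const_le_grid(2)[OF fine n])
  finally have "(pickands_const - chain_const * a) * (a * real n) \<le> exp (a powr \<beta>) * grid_const a n"
    by (simp add: power2_eq_square algebra_simps)
  then have "exp (- (a powr \<beta>)) * ((pickands_const - chain_const * a) * (a * real n)) \<le> exp (- (a powr \<beta>)) * (exp (a powr \<beta>) * grid_const a n)"
    by (rule mult_left_mono) simp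
  also have "\<dots> = grid_const a n" by (simp add: mult_exp_exp flip: mult.assoc)
  finally have "?L * (a * real n) \<le> grid_const a n" by (simp only: mult.assoc)
  then have "?L \<le> grid_const a n / (a * real n)" using an by (simp add: pos_le_divide_eq)
  then have "?L - overlap_const a / (a * real n) \<le> (grid_const a n - overlap_const a) / (a * real n)"
    by (simp add: diff_divide_distrib)
  then have "t * (?L - overlap_const a / (a * real n)) \<le> t * ((grid_const a n - overlap_const a) / (a * real n))"
    using t by (intro mult_left_mono) auto
  then have le: "t * pickands_const - e \<le> t * ((grid_const a n - overlap_const a) / (a * real n)) - e / 2"
    using ltn by linarith
  have "\<forall>\<^sub>F u in at_top. t * ((grid_const a n - overlap_const a) / (a * real n)) - e / 2 \<le> q u * exceed_prob t u / Psi u"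
    by (rule exceed_prob_lower[OF a n t]) (use e in simp)
  then show ?thesis by eventually_elim (use le in linarith)
qed

lemma exceed_prob_tendsto:
  assumes t: "0 \<le> t"
  shows "((\<lambda>u. q u * exceed_prob t u / Psi u) \<longlongrightarrow> t * pickands_const) at_top"
proof (rule order_tendstoI)
  fix y assume y: "t * pickands_const < y"
  have "((\<lambda>S. t * (sup_const S / S)) \<longlongrightarrow> t * pickands_const) at_top"
    by (intro tendsto_intros sup_const_tendsto)
  then have "\<forall>\<^sub>F S in at_top. t * (sup_const S / S) < y"
    using y by (rule order_tendstoD)
  then have "\<forall>\<^sub>F S in at_top. t * (sup_const S / S) < y \<and> 0 < S"
    using eventually_gt_at_top[of 0] by eventually_elim simp
  then obtain S where S: "t * (sup_const S / S) < y" "0 < S"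
    using eventually_happens'[OF trivial_limit_at_top_linorder] by blast
  obtain e where e: "0 < e" "t * (sup_const S / S) + e < y"
    using dense[OF S(1)] by (metis add_diff_cancel_left' add.commute diff_add_cancel diff_gt_0_iff_gt)
  show "\<forall>\<^sub>F u in at_top. q u * exceed_prob t u / Psi u < y"
    using exceed_prob_upper[OF S(2) t e(1)] by eventually_elim (use e(2) in linarith)
next
  fix y assume y: "y < t * pickands_const"
  show "\<forall>\<^sub>F u in at_top. y < q u * exceed_prob t u / Psi u"
  \<comment> \<open>The block argument requires t > 0; at t = 0 the claim is just
    nonnegativity.\<close>
  proof (cases "t = 0")
    case True
    have "0 \<le> q u * exceed_prob t u / Psi u" for u
      using q_nonneg exceed_prob_nonneg Psi_nonneg by (intro divide_nonneg_nonneg mult_nonneg_nonneg)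
    then show ?thesis using y True by (auto intro!: always_eventually intro: less_le_trans)
  next
    case False
    then have t: "0 < t" using t by simp
    show ?thesis
      using exceed_prob_eventually_ge[OF t, of "(t * pickands_const - y) / 2"] y
      by (auto elim!: eventually_mono simp: field_simps)
  qed
qed

end

section \<open>Modifications, null sets and random horizons\<close>

text \<open>In the completion any change on a null set is harmless. This is what gives meaning to
  suprema over paths that are only almost surely continuous.\<close>

lemma measurable_completion_AE:
  fixes f g :: "'a \<Rightarrow> real"
  assumes f: "f \<in> borel_measurable M" and eq: "AE \<omega> in M. f \<omega> = g \<omega>"
  shows "g \<in> borel_measurable (completion M)"
proof (rule measurableI)
  obtain Z where Z: "Z \<in> null_sets M" "{\<omega> \<in> space M. f \<omega> \<noteq> g \<omega>} \<subseteq> Z"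
    using AE_E[OF eq] by (auto simp: null_sets_def)
  fix A :: "real set" assume A: "A \<in> sets borel"
  have "g -` A \<inter> space (completion M) = (f -` A \<inter> space M - Z) \<union> (g -` A \<inter> space M \<inter> Z)"
    using Z(2) by auto
  also have "\<dots> \<in> sets (completion M)"
  proof (rule sets.Un)
    show "f -` A \<inter> space M - Z \<in> sets (completion M)"
      using measurable_sets[OF f A] Z(1) by (intro sets_completionI_sets sets.Diff) auto
    show "g -` A \<inter> space M \<inter> Z \<in> sets (completion M)"
      by (rule sets_completionI_sub[OF Z(1)]) auto
  qed
  finally show "g -` A \<inter> space (completion M) \<in> sets (completion M)" .
qed simp

lemma integral_completion_cong_AE:
  fixes f g :: "'a \<Rightarrow> real"
  assumes f: "f \<in> borel_measurable M" and eq: "AE \<omega> in M. f \<omega> = g \<omega>"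
  shows "integral\<^sup>L (completion M) g = integral\<^sup>L M f"
proof -
  have "integral\<^sup>L (completion M) g = integral\<^sup>L (completion M) f"
    by (rule integral_cong_AE[OF measurable_completion_AE[OF f eq] measurable_completion[OF f]])
       (use eq in \<open>auto intro!: AE_completion elim: eventually_mono\<close>)
  then show ?thesis by (simp only: integral_completion[OF f])
qed

lemma measure_completion_cong_AE:
  assumes A: "A \<in> sets M" and eq: "AE \<omega> in M. \<omega> \<in> A \<longleftrightarrow> P \<omega>"
  shows "measure (completion M) {\<omega> \<in> space M. P \<omega>} = measure M A"
proof -
  have "AE \<omega> in M. indicator A \<omega> = (indicator {\<omega> \<in> space M. P \<omega>} \<omega> :: real)"
    using eq AE_space by eventually_elim (auto simp: indicator_def)
  from integral_completion_cong_AE[OF _ this] have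
    "integral\<^sup>L (completion M) (indicator {\<omega> \<in> space M. P \<omega>}) = integral\<^sup>L M (indicator A :: _ \<Rightarrow> real)"
    using A by simp
  moreover have "{\<omega> \<in> space M. P \<omega>} \<inter> space M = {\<omega> \<in> space M. P \<omega>}" by blast
  ultimately show ?thesis
    using sets.sets_into_space[OF A] by (simp add: Int_absorb2)
qed

text \<open>On a measurable null set covering the discontinuous paths, the path is replaced by zero.
  All times are changed on the same set, so suprema over uncountably many times agree almost
  surely.\<close>

lemma continuous_modification:
  assumes X: "\<And>t. 0 \<le> t \<Longrightarrow> X t \<in> borel_measurable M" and cont: "as_continuous_paths M X"
  obtains X' where "\<And>t. 0 \<le> t \<Longrightarrow> X' t \<in> borel_measurable M"
    and "\<And>\<omega>. \<omega> \<in> space M \<Longrightarrow> continuous_on {0..} (\<lambda>t. X' t \<omega>)"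
    and "AE \<omega> in M. \<forall>t. X' t \<omega> = X t \<omega>"
proof -
  obtain Z where Z: "Z \<in> null_sets M" "{\<omega> \<in> space M. \<not> continuous_on {0..} (\<lambda>t. X t \<omega>)} \<subseteq> Z"
    using AE_E[OF cont[unfolded as_continuous_paths_def]] by (auto simp: null_sets_def)
  define X' where "X' t \<omega> = (if \<omega> \<in> Z then 0 else X t \<omega>)" for t \<omega>
  show thesis
  proof (rule that)
    show "X' t \<in> borel_measurable M" if "0 \<le> t" for t
      unfolding X'_def using X[OF that] Z(1)
      by (intro measurable_If_set) auto
    show "continuous_on {0..} (\<lambda>t. X' t \<omega>)" if "\<omega> \<in> space M" for \<omega>
      using Z(2) that by (cases "\<omega> \<in> Z") (auto simp: X'_def)
    show "AE \<omega> in M. \<forall>t. X' t \<omega> = X t \<omega>"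
      using AE_not_in[OF Z(1)] by eventually_elim (simp add: X'_def)
  qed
qed

lemma centered_gaussian_cong_AE:
  assumes Y: "centered_gaussian M Y v" and [measurable]: "Y' \<in> borel_measurable M" and eq: "AE \<omega> in M. Y \<omega> = Y' \<omega>"
  shows "centered_gaussian M Y' v"
proof -
  have "distr M borel Y = distr M borel Y'"
    by (rule distr_cong_AE[OF refl refl eq centered_gaussian_measurable[OF Y]]) measurable
  then show ?thesis using Y by (simp add: centered_gaussian_def)
qed

lemma gaussian_field_modification:
  assumes "prob_space M" and X: "gaussian_process M {0..} X" "centered_process M {0..} X"
    and X': "\<And>t. 0 \<le> t \<Longrightarrow> X' t \<in> borel_measurable M" "AE \<omega> in M. \<forall>t. X' t \<omega> = X t \<omega>"
    and R: "\<And>s t. 0 \<le> s \<Longrightarrow> 0 \<le> t \<Longrightarrow> covariance M (X s) (X t) = R s t" "\<And>s t. R s t = R t s"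
  shows "gaussian_field M X' R"
proof -
  interpret prob_space M by fact
  show ?thesis
  proof
    fix n :: nat and t c :: "nat \<Rightarrow> real"
    assume t: "\<And>i. i < n \<Longrightarrow> 0 \<le> t i"
    have "centered_gaussian M (\<lambda>\<omega>. \<Sum>i<n. c i * X (t i) \<omega>) (\<Sum>i<n. \<Sum>j<n. c i * c j * covariance M (X (t i)) (X (t j)))"
      by (rule centered_gaussian_sum_process[OF assms(1) X]) (use t in simp)
    also have "(\<Sum>i<n. \<Sum>j<n. c i * c j * covariance M (X (t i)) (X (t j))) = (\<Sum>i<n. \<Sum>j<n. c i * c j * R (t i) (t j))"
      using t by (intro sum.cong refl) (simp add: R)
    finally show "centered_gaussian M (\<lambda>\<omega>. \<Sum>i<n. c i * X' (t i) \<omega>) (\<Sum>i<n. \<Sum>j<n. c i * c j * R (t i) (t j))"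
    proof (rule centered_gaussian_cong_AE)
      show "(\<lambda>\<omega>. \<Sum>i<n. c i * X' (t i) \<omega>) \<in> borel_measurable M"
        using t by (intro borel_measurable_sum borel_measurable_times borel_measurable_const X') auto
      show "AE \<omega> in M. (\<Sum>i<n. c i * X (t i) \<omega>) = (\<Sum>i<n. c i * X' (t i) \<omega>)"
        using X'(2) by eventually_elim simp
    qed
  qed (use X'(1) R(2) in auto)
qed

text \<open>(A1) speaks of t > 0 only, so the variance at 0 must come from path continuity: the
  characteristic function of X t - X 0 at 1 is exp(- (r 0 - r t)). By dominated convergence it tends
  to 1 as t decreases to 0, and by \<open>lim\<close> to exp(- (r 0 - 1)).\<close>

lemma (in gaussian_field) correlation_at_0:
  assumes R: "R = (\<lambda>s t. r \<bar>s - t\<bar>)" and cont: "\<And>\<omega>. \<omega> \<in> space M \<Longrightarrow> continuous_on {0..} (\<lambda>t. X t \<omega>)"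
    and lim: "(r \<longlongrightarrow> 1) (at_right 0)"
  shows "r 0 = 1"
proof -
  define t :: "nat \<Rightarrow> real" where "t n = 1 / Suc n" for n
  have t: "0 < t n" for n by (simp add: t_def)
  have t0: "t \<longlonglongrightarrow> 0" unfolding t_def by real_asymp
  note [measurable] = field_measurable[OF order_refl] field_measurable[OF less_imp_le[OF t]]
  have "(\<integral>\<omega>. iexp (X (t n) \<omega> - X 0 \<omega>) \<partial>M) = of_real (exp (- (r 0 - r (t n))))" for n
  proof -
    have "centered_gaussian M (\<lambda>\<omega>. 1 * X (t n) \<omega> + (- 1) * X 0 \<omega>) (2 * (r 0 - r (t n)))"
      using gaussian_pair[OF less_imp_le[OF t[of n]] order_refl, where c=1 and d="- 1"] t[of n] by (simp add: R)
    from centered_gaussian_char[OF this] show ?thesis by simp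
  qed
  moreover have "(\<lambda>n. \<integral>\<omega>. iexp (X (t n) \<omega> - X 0 \<omega>) \<partial>M) \<longlonglongrightarrow> (\<integral>\<omega>. 1 \<partial>M)"
  proof (rule integral_dominated_convergence[where w="\<lambda>_. 1"])
    show "AE \<omega> in M. (\<lambda>n. iexp (X (t n) \<omega> - X 0 \<omega>)) \<longlonglongrightarrow> 1"
    proof (rule AE_I2)
      fix \<omega> assume "\<omega> \<in> space M"
      then have "(\<lambda>n. X (t n) \<omega>) \<longlonglongrightarrow> X 0 \<omega>"
        using cont[of \<omega>] t t0 by (auto simp: continuous_on_sequentially o_def less_imp_le)
      then have "(\<lambda>n. iexp (X (t n) \<omega> - X 0 \<omega>)) \<longlonglongrightarrow> iexp (X 0 \<omega> - X 0 \<omega>)"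
        by (intro tendsto_intros)
      then show "(\<lambda>n. iexp (X (t n) \<omega> - X 0 \<omega>)) \<longlonglongrightarrow> 1" by simp
    qed
  qed (auto simp: norm_exp_i_times[of "x - y" for x y, simplified])
  ultimately have "(\<lambda>n. complex_of_real (exp (- (r 0 - r (t n))))) \<longlonglongrightarrow> of_real 1"
    by (simp add: prob_space)
  then have 1: "(\<lambda>n. exp (- (r 0 - r (t n)))) \<longlonglongrightarrow> 1" by (simp only: tendsto_of_real_iff)
  have "filterlim t (at_right 0) sequentially"
    using t0 t by (auto simp: filterlim_at less_imp_neq[OF t, symmetric])
  from filterlim_compose[OF lim this] have "(\<lambda>n. r (t n)) \<longlonglongrightarrow> 1" .
  then have "(\<lambda>n. exp (- (r 0 - r (t n)))) \<longlonglongrightarrow> exp (- (r 0 - 1))" by (intro tendsto_intros)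
  with 1 have "exp (- (r 0 - 1)) = 1" by (rule LIMSEQ_unique[symmetric])
  then show ?thesis by simp
qed

section \<open>Path laws and stationarity\<close>

lemma path_map_measurable:
  assumes "\<And>t. 0 \<le> t \<Longrightarrow> X t \<in> borel_measurable M"
  shows "path_map X \<in> measurable M path_space"
  unfolding path_map_def path_space_def using assms by (intro measurable_restrict) auto

text \<open>The product sigma-algebra decides only events determined by countably many times, hence
  the restriction to countable \<open>A\<close>.\<close>

lemma path_space_ex_sets:
  assumes "countable A" "A \<subseteq> {0..}"
  shows "{x \<in> space path_space. \<exists>s\<in>A. u < x s} \<in> sets path_space"
proof -
  have "{x \<in> space path_space. \<exists>s\<in>A. u < x s} = (\<Union>s\<in>A. {x \<in> space path_space. u < x s})" by blast
  also have "\<dots> \<in> sets path_space"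
  proof (rule sets.countable_UN''[OF assms(1)])
    fix s assume "s \<in> A"
    then have "(\<lambda>x. x s) \<in> borel_measurable path_space"
      unfolding path_space_def using assms(2) by (intro measurable_component_singleton) auto
    then show "{x \<in> space path_space. u < x s} \<in> sets path_space" by measurable
  qed
  finally show ?thesis .
qed

lemma measure_distr_path_map:
  assumes X: "\<And>t. 0 \<le> t \<Longrightarrow> X t \<in> borel_measurable M" and A: "countable A" "A \<subseteq> {0..}"
  shows "measure (distr M path_space (path_map X)) {x \<in> space path_space. \<exists>s\<in>A. u < x s}
    = measure M {\<omega> \<in> space M. \<exists>s\<in>A. u < X s \<omega>}"
proof -
  note m = path_map_measurable[OF X]
  have eq: "path_map X \<omega> s = X s \<omega>" if "s \<in> A" for s \<omega>
    using A(2) that by (auto simp: path_map_def)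
  have "path_map X -` {x \<in> space path_space. \<exists>s\<in>A. u < x s} \<inter> space M = {\<omega> \<in> space M. \<exists>s\<in>A. u < X s \<omega>}"
    using measurable_space[OF m] eq by auto
  then show ?thesis
    by (simp add: measure_distr[OF m path_space_ex_sets[OF A]])
qed

lemma stationary_ex:
  assumes X: "\<And>t. 0 \<le> t \<Longrightarrow> X t \<in> borel_measurable M" and stat: "stationary_process M X"
    and A: "countable A" "A \<subseteq> {0..}" and h: "0 \<le> h"
  shows "measure M {\<omega> \<in> space M. \<exists>s\<in>A. u < X (s + h) \<omega>} = measure M {\<omega> \<in> space M. \<exists>s\<in>A. u < X s \<omega>}"
proof -
  have "measure M {\<omega> \<in> space M. \<exists>s\<in>A. u < X (s + h) \<omega>}
      = measure (distr M path_space (path_map (\<lambda>t. X (t + h)))) {x \<in> space path_space. \<exists>s\<in>A. u < x s}"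
    by (rule measure_distr_path_map[OF _ A, symmetric]) (use X h in simp)
  also have "\<dots> = measure M {\<omega> \<in> space M. \<exists>s\<in>A. u < X s \<omega>}"
    using stat h by (simp add: stationary_process_def measure_distr_path_map[OF X A])
  finally show ?thesis .
qed

section \<open>Independent random horizon\<close>

lemma interval_subset_closure_rational: "{0..T} \<subseteq> closure (\<rat> \<inter> {0..T::real})"
proof (cases "0 < T")
  case True
  have "{0<..<T} \<subseteq> closure ({0<..<T} \<inter> \<rat>)"
    using open_Int_closure_subset[of "{0<..<T}" \<rat>] by (simp add: Rats_closure_real)
  also have "\<dots> \<subseteq> closure (\<rat> \<inter> {0..T})" by (rule closure_mono) auto
  finally have "closure {0<..<T} \<subseteq> closure (\<rat> \<inter> {0..T})" by (rule closure_minimal) simp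
  then show ?thesis using True by simp
next
  case False
  then have "{0..T} \<subseteq> {0} \<inter> {0..T}" by auto
  also have "\<dots> \<subseteq> \<rat> \<inter> {0..T}" by auto
  finally have "{0..T} \<subseteq> \<rat> \<inter> {0..T}" .
  then show ?thesis using closure_subset by (rule order_trans)
qed

text \<open>Independence makes the joint law of \<open>T\<close> and the path a product, and Fubini
  freezes \<open>T\<close>. Rational times make the event measurable in the product of the line with
  path space.\<close>

lemma (in prob_space) prob_random_horizon:
  assumes X: "\<And>t. 0 \<le> t \<Longrightarrow> X t \<in> borel_measurable M" and T [measurable]: "T \<in> borel_measurable M"
    and indep: "indep_set (sets (vimage_algebra (space M) T borel)) (sets (vimage_algebra (space M) (path_map X) path_space))"
  shows "{\<omega> \<in> space M. \<exists>s\<in>\<rat> \<inter> {0..}. s \<le> T \<omega> \<and> u < X s \<omega>} \<in> events"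
    and "prob {\<omega> \<in> space M. \<exists>s\<in>\<rat> \<inter> {0..}. s \<le> T \<omega> \<and> u < X s \<omega>}
      = (\<integral>\<omega>. prob {\<omega>' \<in> space M. \<exists>s\<in>\<rat> \<inter> {0..T \<omega>}. u < X s \<omega>'} \<partial>M)"
proof -
  let ?D = "\<rat> \<inter> {0..} :: real set"
  have D: "countable ?D" by (simp add: countable_rat)
  note P [measurable] = path_map_measurable[OF X]
  let ?E = "{\<omega> \<in> space M. \<exists>s\<in>?D. s \<le> T \<omega> \<and> u < X s \<omega>}"
  let ?S = "{z \<in> space (borel \<Otimes>\<^sub>M path_space). \<exists>s\<in>?D. s \<le> fst z \<and> u < snd z s}"
  have comp: "(\<lambda>x. x s) \<in> borel_measurable path_space" if "s \<in> ?D" for s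
    unfolding path_space_def using that by (intro measurable_component_singleton) auto
  have S [measurable]: "?S \<in> sets (borel \<Otimes>\<^sub>M path_space)"
  proof -
    have "?S = (\<Union>s\<in>?D. {z \<in> space (borel \<Otimes>\<^sub>M path_space). s \<le> fst z \<and> u < snd z s})" by blast
    also have "\<dots> \<in> sets (borel \<Otimes>\<^sub>M path_space)"
    proof (rule sets.countable_UN''[OF D])
      fix s assume "s \<in> ?D"
      note [measurable] = comp[OF this]
      show "{z \<in> space (borel \<Otimes>\<^sub>M path_space). s \<le> fst z \<and> u < snd z s} \<in> sets (borel \<Otimes>\<^sub>M path_space)"
        by measurable
    qed
    finally show ?thesis .
  qed
  have pair [measurable]: "(\<lambda>\<omega>. (T \<omega>, path_map X \<omega>)) \<in> measurable M (borel \<Otimes>\<^sub>M path_space)" by measurable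
  have "(\<lambda>\<omega>. (T \<omega>, path_map X \<omega>)) -` ?S \<inter> space M = ?E"
    using measurable_space[OF pair] by (auto simp: path_map_def)
  then have E: "?E \<in> events" "prob ?E = measure (distr M (borel \<Otimes>\<^sub>M path_space) (\<lambda>\<omega>. (T \<omega>, path_map X \<omega>))) ?S"
    using measurable_sets[OF pair S] measure_distr[OF pair S] by auto
  show "?E \<in> events" by (rule E(1))
  let ?PX = "distr M path_space (path_map X)"
  interpret PX: prob_space ?PX by (rule prob_space_distr[OF P])
  interpret PT: prob_space "distr M borel T" by (rule prob_space_distr[OF T])
  \<comment> \<open>Measurable rectangles suffice, and on them the claim is the product rule for the
    two generated sigma-algebras.\<close>
  have joint: "distr M borel T \<Otimes>\<^sub>M ?PX = distr M (borel \<Otimes>\<^sub>M path_space) (\<lambda>\<omega>. (T \<omega>, path_map X \<omega>))"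
  proof (rule pair_measure_eqI)
    fix A B assume "A \<in> sets (distr M borel T)" "B \<in> sets ?PX"
    then have A: "A \<in> sets borel" and B: "B \<in> sets path_space" by auto
    have "prob ((T -` A \<inter> space M) \<inter> (path_map X -` B \<inter> space M)) = prob (T -` A \<inter> space M) * prob (path_map X -` B \<inter> space M)"
      by (rule indep_setD[OF indep]) (use A B in \<open>auto intro!: in_vimage_algebra\<close>)
    moreover have "(\<lambda>\<omega>. (T \<omega>, path_map X \<omega>)) -` (A \<times> B) \<inter> space M = (T -` A \<inter> space M) \<inter> (path_map X -` B \<inter> space M)"
      by auto
    ultimately show "emeasure (distr M borel T) A * emeasure ?PX B = emeasure (distr M (borel \<Otimes>\<^sub>M path_space) (\<lambda>\<omega>. (T \<omega>, path_map X \<omega>))) (A \<times> B)"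
      using A B by (simp add: emeasure_distr[OF T] emeasure_distr[OF P] emeasure_distr[OF pair] emeasure_eq_measure ennreal_mult')
  qed (auto intro: PX.sigma_finite_measure_axioms PT.sigma_finite_measure_axioms cong: sets_pair_measure_cong)
  have S': "?S \<in> sets (distr M borel T \<Otimes>\<^sub>M ?PX)"
    using S by (simp cong: sets_pair_measure_cong)
  define f where "f t = prob {\<omega> \<in> space M. \<exists>s\<in>\<rat> \<inter> {0..t}. u < X s \<omega>}" for t
  have slice: "emeasure ?PX (Pair t -` ?S) = ennreal (f t)" for t
  proof -
    have "Pair t -` ?S = {x \<in> space path_space. \<exists>s\<in>\<rat> \<inter> {0..t}. u < x s}"
      by (auto simp: space_pair_measure)
    moreover have "countable (\<rat> \<inter> {0..t})" "\<rat> \<inter> {0..t} \<subseteq> {0..}" by (auto simp: countable_rat)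
    ultimately show ?thesis
      using measure_distr_path_map[where X=X and A="\<rat> \<inter> {0..t}" and u=u, OF X] by (auto simp: PX.emeasure_eq_measure f_def)
  qed
  have f_mono: "mono f"
    unfolding f_def
  proof (intro monoI finite_measure_mono)
    fix x y :: real assume "x \<le> y"
    then show "{\<omega> \<in> space M. \<exists>s\<in>\<rat> \<inter> {0..x}. u < X s \<omega>} \<subseteq> {\<omega> \<in> space M. \<exists>s\<in>\<rat> \<inter> {0..y}. u < X s \<omega>}" by auto
    have "{\<omega> \<in> space M. \<exists>s\<in>\<rat> \<inter> {0..y}. u < X s \<omega>} = (\<Union>s\<in>\<rat> \<inter> {0..y}. {\<omega> \<in> space M. u < X s \<omega>})" by blast
    also have "\<dots> \<in> events"
    proof (rule sets.countable_UN'')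
      show "countable (\<rat> \<inter> {0..y})" by (simp add: countable_rat)
      fix s assume "s \<in> \<rat> \<inter> {0..y}"
      then have "X s \<in> borel_measurable M" by (intro X) simp
      then show "{\<omega> \<in> space M. u < X s \<omega>} \<in> events" by measurable
    qed
    finally show "{\<omega> \<in> space M. \<exists>s\<in>\<rat> \<inter> {0..y}. u < X s \<omega>} \<in> events" .
  qed
  then have [measurable]: "f \<in> borel_measurable borel" by (rule borel_measurable_mono)
  have f01: "0 \<le> f t" "f t \<le> 1" for t by (auto simp: f_def)
  have "ennreal (prob ?E) = emeasure (distr M borel T \<Otimes>\<^sub>M ?PX) ?S"
    unfolding E(2) joint[symmetric]
  proof (rule finite_measure.emeasure_eq_measure[symmetric])
    show "finite_measure (distr M borel T \<Otimes>\<^sub>M ?PX)"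
      unfolding joint by (rule finite_measure_distr[OF pair])
  qed
  also have "\<dots> = (\<integral>\<^sup>+ t. emeasure ?PX (Pair t -` ?S) \<partial>distr M borel T)"
    by (rule PX.emeasure_pair_measure_alt[OF S'])
  also have "\<dots> = (\<integral>\<^sup>+ \<omega>. ennreal (f (T \<omega>)) \<partial>M)"
    unfolding slice by (rule nn_integral_distr[OF T]) measurable
  also have "\<dots> = ennreal (\<integral>\<omega>. f (T \<omega>) \<partial>M)"
    by (rule nn_integral_eq_integral, rule integrable_const_bound[where B=1]) (auto simp: f01)
  finally show "prob ?E = (\<integral>\<omega>. prob {\<omega>' \<in> space M. \<exists>s\<in>\<rat> \<inter> {0..T \<omega>}. u < X s \<omega>'} \<partial>M)"
    by (subst (asm) ennreal_inj) (auto simp: f_def f01 intro!: Bochner_Integration.integral_nonneg)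
qed

theorem theorem3p1:
  fixes M :: "'a measure" and X :: "real \<Rightarrow> 'a \<Rightarrow> real" and r :: "real \<Rightarrow> real"
    and T :: "'a \<Rightarrow> real" and \<alpha> C :: real
    and N :: "'b measure" and B :: "real \<Rightarrow> 'b \<Rightarrow> real"
  assumes "prob_space M"
    and "gaussian_process M {0..} X" and "centered_process M {0..} X"
    and "stationary_process M X"
    and "as_continuous_paths M X"
    and cov: "\<And>s t. s \<ge> 0 \<Longrightarrow> t \<ge> 0 \<Longrightarrow> covariance M (X s) (X (s + t)) = r t"
    and A1: "0 < \<alpha>" "\<alpha> \<le> 2" "0 < C"
      "((\<lambda>t. (r t - (1 - C * t powr \<alpha>)) / t powr \<alpha>) \<longlongrightarrow> 0) (at_right 0)"
    and A2: "\<And>t. t > 0 \<Longrightarrow> r t < 1"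
    and "T \<in> borel_measurable M" and "AE \<omega> in M. T \<omega> \<ge> 0"
    and "prob_space.indep_set M (sets (vimage_algebra (space M) T borel))
          (sets (vimage_algebra (space M) (path_map X) path_space))"
    and "integrable M T" and "(\<integral>\<omega>. T \<omega> \<partial>M) > 0"
    and "fBm N \<alpha> B"
  shows "(\<lambda>u. measure (completion M) {\<omega> \<in> space M. Sup ((\<lambda>s. X s \<omega>) ` {0..T \<omega>}) > u})
           \<sim>[at_top]
         (\<lambda>u. (\<integral>\<omega>. T \<omega> \<partial>M) * C powr (1 / \<alpha>) * pickands N B \<alpha> * u powr (2 / \<alpha>) * Psi u)"
proof -
  interpret M: prob_space M by fact
  have N: "prob_space N" and B_gauss: "gaussian_process N {0..} B" "centered_process N {0..} B"
    and B_cont: "as_continuous_paths N B"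
    and B_cov: "\<And>s t. s \<ge> 0 \<Longrightarrow> t \<ge> 0 \<Longrightarrow> covariance N (B s) (B t) = (s powr \<alpha> + t powr \<alpha> - \<bar>t - s\<bar> powr \<alpha>) / 2"
    using \<open>fBm N \<alpha> B\<close> by (auto simp: fBm_def)
  have X_meas: "\<And>t. 0 \<le> t \<Longrightarrow> X t \<in> borel_measurable M"
    using \<open>gaussian_process M {0..} X\<close> by (auto simp: gaussian_process_def)
  have B_meas: "\<And>t. 0 \<le> t \<Longrightarrow> B t \<in> borel_measurable N"
    using B_gauss(1) by (auto simp: gaussian_process_def)
  obtain X' where X': "\<And>t. 0 \<le> t \<Longrightarrow> X' t \<in> borel_measurable M"
    "\<And>\<omega>. \<omega> \<in> space M \<Longrightarrow> continuous_on {0..} (\<lambda>t. X' t \<omega>)" "AE \<omega> in M. \<forall>t. X' t \<omega> = X t \<omega>"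
    using continuous_modification[OF X_meas \<open>as_continuous_paths M X\<close>] by blast
  obtain B' where B': "\<And>t. 0 \<le> t \<Longrightarrow> B' t \<in> borel_measurable N"
    "\<And>\<omega>. \<omega> \<in> space N \<Longrightarrow> continuous_on {0..} (\<lambda>t. B' t \<omega>)" "AE \<omega> in N. \<forall>t. B' t \<omega> = B t \<omega>"
    using continuous_modification[OF B_meas B_cont] by blast
  \<comment> \<open>Only nonnegative lags are given; symmetry of the covariance covers the other
    order of the two times.\<close>
  have X_cov: "covariance M (X s) (X t) = r \<bar>s - t\<bar>" if "0 \<le> s" "0 \<le> t" for s t
  proof (cases "s \<le> t")
    case True
    then show ?thesis using cov[of s "t - s"] that by simp
  next
    case False
    have "covariance M (X s) (X t) = covariance M (X t) (X s)"
      by (simp add: covariance_def mult.commute)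
    then show ?thesis using False cov[of t "s - t"] that by simp
  qed
  interpret XF: gaussian_field M X' "\<lambda>s t. r \<bar>s - t\<bar>"
    by (rule gaussian_field_modification[OF assms(1-3) X'(1,3) X_cov]) (auto simp: abs_minus_commute)
  interpret BF: gaussian_field N B' "\<lambda>s t. (s powr \<alpha> + t powr \<alpha> - \<bar>t - s\<bar> powr \<alpha>) / 2"
    by (rule gaussian_field_modification[OF N B_gauss B'(1,3) B_cov]) (auto simp: abs_minus_commute add.commute)
  have r_lim: "(r \<longlongrightarrow> 1) (at_right 0)"
  proof -
    have "((\<lambda>t. t) \<longlongrightarrow> 0) (at_right (0::real))" by (rule tendsto_ident_at)
    moreover have "\<forall>\<^sub>F t::real in at_right 0. 0 \<le> t"
      using eventually_at_right_less[of "0::real"] by eventually_elim simp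
    ultimately have "((\<lambda>t. t powr \<alpha>) \<longlongrightarrow> 0 powr \<alpha>) (at_right 0)"
      using A1(1) by (intro tendsto_powr' tendsto_const) auto
    then have p: "((\<lambda>t. t powr \<alpha>) \<longlongrightarrow> 0) (at_right 0)" by simp
    have "((\<lambda>t. (r t - (1 - C * t powr \<alpha>)) / t powr \<alpha> * t powr \<alpha> + (1 - C * t powr \<alpha>)) \<longlongrightarrow> 0 * 0 + (1 - C * 0)) (at_right 0)"
      by (intro tendsto_intros A1(4) p)
    moreover have "\<forall>\<^sub>F t in at_right 0. (r t - (1 - C * t powr \<alpha>)) / t powr \<alpha> * t powr \<alpha> + (1 - C * t powr \<alpha>) = r t"
      using eventually_at_right_less[of "0::real"] by eventually_elim simp
    ultimately have "(r \<longlongrightarrow> 0 * 0 + (1 - C * 0)) (at_right 0)" by (rule Lim_transform_eventually)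
    then show ?thesis by simp
  qed
  have r0: "r 0 = 1" by (rule XF.correlation_at_0[OF refl X'(2) r_lim])
  have X'_ex: "measure M {\<omega> \<in> space M. \<exists>s\<in>A. u < X' (f s) \<omega>} = measure M {\<omega> \<in> space M. \<exists>s\<in>A. u < X (f s) \<omega>}"
    if A: "countable A" "\<And>s. s \<in> A \<Longrightarrow> 0 \<le> f s" for A :: "real set" and f u
  proof -
    have sets: "{\<omega> \<in> space M. \<exists>s\<in>A. u < Y (f s) \<omega>} \<in> sets M" if Y: "\<And>t. 0 \<le> t \<Longrightarrow> Y t \<in> borel_measurable M" for Y
    proof -
      have "{\<omega> \<in> space M. \<exists>s\<in>A. u < Y (f s) \<omega>} = (\<Union>s\<in>A. {\<omega> \<in> space M. u < Y (f s) \<omega>})" by blast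
      also have "\<dots> \<in> sets M"
      proof (rule sets.countable_UN''[OF A(1)])
        fix s assume "s \<in> A"
        note [measurable] = Y[OF A(2)[OF this]]
        show "{\<omega> \<in> space M. u < Y (f s) \<omega>} \<in> sets M" by measurable
      qed
      finally show ?thesis .
    qed
    show ?thesis
    proof (rule M.finite_measure_eq_AE)
      show "AE \<omega> in M. \<omega> \<in> {\<omega> \<in> space M. \<exists>s\<in>A. u < X' (f s) \<omega>} \<longleftrightarrow> \<omega> \<in> {\<omega> \<in> space M. \<exists>s\<in>A. u < X (f s) \<omega>}"
        using X'(3) by eventually_elim simp
    qed (use sets X'(1) X_meas in blast)+
  qed
  interpret pickands_setting M X' r N B' \<alpha> C
  proof
    fix A :: "real set" and h u :: real assume A: "countable A" "A \<subseteq> {0..}" and h: "0 \<le> h"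
    have "measure M {\<omega> \<in> space M. \<exists>s\<in>A. u < X' (s + h) \<omega>} = measure M {\<omega> \<in> space M. \<exists>s\<in>A. u < X (s + h) \<omega>}"
      by (rule X'_ex[OF A(1)]) (use A h in auto)
    also have "\<dots> = measure M {\<omega> \<in> space M. \<exists>s\<in>A. u < X s \<omega>}"
      by (rule stationary_ex[OF X_meas \<open>stationary_process M X\<close> A h])
    also have "\<dots> = measure M {\<omega> \<in> space M. \<exists>s\<in>A. u < X' s \<omega>}"
      by (rule X'_ex[OF A(1), symmetric]) (use A in auto)
    finally show "measure M {\<omega> \<in> space M. \<exists>s\<in>A. u < X' (s + h) \<omega>} = measure M {\<omega> \<in> space M. \<exists>s\<in>A. u < X' s \<omega>}" .
  qed (use r0 A1 A2 X'(2) B'(2) in auto)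

  have S_eq: "pickands_S N B \<alpha> S = sup_const S" if "0 \<le> S" for S
    unfolding pickands_S_def sup_const_def
  proof (rule integral_completion_cong_AE)
    show "(\<lambda>\<omega>. exp (Sup ((\<lambda>t. Z t \<omega>) ` {0..S}))) \<in> borel_measurable N"
      using Sup_Z_measurable[OF that] by measurable
    show "AE \<omega> in N. exp (Sup ((\<lambda>t. Z t \<omega>) ` {0..S})) = exp (Sup ((\<lambda>t. sqrt 2 * B t \<omega> - t powr \<alpha>) ` {0..S}))"
      using B'(3) by eventually_elim (simp add: Z_def)
  qed
  have "\<forall>\<^sub>F S in at_top. sup_const S / S = pickands_S N B \<alpha> S / S"
    using eventually_ge_at_top[of 0] by eventually_elim (simp add: S_eq)
  with sup_const_tendsto have "((\<lambda>S. pickands_S N B \<alpha> S / S) \<longlongrightarrow> pickands_const) at_top"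
    by (rule Lim_transform_eventually)
  then have pickands_eq: "pickands N B \<alpha> = pickands_const"
    unfolding pickands_def by (intro tendsto_Lim trivial_limit_at_top_linorder)

  \<comment> \<open>A measurable stand-in for the supremum event, from which it differs by a null
    set; the left-hand side of the theorem is therefore its ordinary probability.\<close>
  define E where "E u = {\<omega> \<in> space M. \<exists>s\<in>\<rat> \<inter> {0..}. s \<le> T \<omega> \<and> u < X s \<omega>}" for u
  note horizon = M.prob_random_horizon[OF X_meas \<open>T \<in> borel_measurable M\<close> assms(14)]
  have E_eq: "measure (completion M) {\<omega> \<in> space M. Sup ((\<lambda>s. X s \<omega>) ` {0..T \<omega>}) > u} = measure M (E u)" for u
  proof (rule measure_completion_cong_AE)
    show "E u \<in> sets M" unfolding E_def by (rule horizon(1))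
    show "AE \<omega> in M. \<omega> \<in> E u \<longleftrightarrow> u < Sup ((\<lambda>s. X s \<omega>) ` {0..T \<omega>})"
      using \<open>AE \<omega> in M. T \<omega> \<ge> 0\<close> X'(3) AE_space
    proof eventually_elim
      case (elim \<omega>)
      have c: "continuous_on {0..T \<omega>} (\<lambda>t. X' t \<omega>)"
        by (rule continuous_on_subset[OF X'(2)[OF elim(3)]]) auto
      have "u < Sup ((\<lambda>s. X s \<omega>) ` {0..T \<omega>}) \<longleftrightarrow> (\<exists>s\<in>{0..T \<omega>}. u < X' s \<omega>)"
        using less_Sup_image_iff[OF c elim(1)] elim(2) by simp
      also have "\<dots> \<longleftrightarrow> (\<exists>s\<in>\<rat> \<inter> {0..T \<omega>}. u < X' s \<omega>)"
        by (rule ex_greater_dense_iff[OF c _ interval_subset_closure_rational]) auto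
      finally show ?case using elim by (auto simp: E_def)
    qed
  qed
  have "measure M {\<omega> \<in> space M. \<exists>s\<in>\<rat> \<inter> {0..t}. u < X s \<omega>} = exceed_prob t u" for t u
  proof -
    have "measure M {\<omega> \<in> space M. \<exists>s\<in>\<rat> \<inter> {0..t}. u < X s \<omega>} = measure M {\<omega> \<in> space M. \<exists>s\<in>\<rat> \<inter> {0..t}. u < X' s \<omega>}"
      by (rule X'_ex[symmetric]) (auto simp: countable_rat)
    also have "{\<omega> \<in> space M. \<exists>s\<in>\<rat> \<inter> {0..t}. u < X' s \<omega>} = {\<omega> \<in> space M. \<exists>s\<in>{0..t}. u < X' s \<omega>}"
      using ex_greater_dense_iff[OF continuous_on_subset[OF X'(2)] _ interval_subset_closure_rational, of _ t]
      by (intro Collect_cong conj_cong refl) auto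
    finally show ?thesis by (simp add: exceed_prob_def)
  qed
  then have PE: "measure M (E u) = (\<integral>\<omega>. exceed_prob (T \<omega>) u \<partial>M)" for u
    using horizon(2)[of u] by (simp add: E_def)

  have exceed_mono: "mono (\<lambda>t. exceed_prob t u)" for u
    unfolding exceed_prob_def
    by (intro monoI M.finite_measure_mono X_sets_ex) auto
  have [measurable]: "(\<lambda>t. exceed_prob t u) \<in> borel_measurable borel" for u
    by (rule borel_measurable_mono[OF exceed_mono])
  note [measurable] = \<open>T \<in> borel_measurable M\<close>
  have lim: "((\<lambda>u. \<integral>\<omega>. q u * exceed_prob (T \<omega>) u / Psi u \<partial>M) \<longlongrightarrow> (\<integral>\<omega>. T \<omega> * pickands_const \<partial>M)) at_top"
  proof (rule integral_dominated_convergence_at_top[where w="\<lambda>\<omega>. (T \<omega> + 1) * (pickands_const + 1)"])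
    show "integrable M (\<lambda>\<omega>. (T \<omega> + 1) * (pickands_const + 1))"
      using \<open>integrable M T\<close> by auto
    show "AE \<omega> in M. ((\<lambda>u. q u * exceed_prob (T \<omega>) u / Psi u) \<longlongrightarrow> T \<omega> * pickands_const) at_top"
      using \<open>AE \<omega> in M. T \<omega> \<ge> 0\<close> by eventually_elim (rule exceed_prob_tendsto)
    have "\<forall>\<^sub>F u in at_top. q u * exceed_prob 1 u / Psi u < pickands_const + 1"
      by (rule order_tendstoD(2)[OF exceed_prob_tendsto[of 1]]) auto
    then show "\<forall>\<^sub>F u in at_top. AE \<omega> in M. norm (q u * exceed_prob (T \<omega>) u / Psi u) \<le> (T \<omega> + 1) * (pickands_const + 1)"
    proof eventually_elim
      case (elim u)
      show ?case
        using \<open>AE \<omega> in M. T \<omega> \<ge> 0\<close>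
      proof eventually_elim
        case (elim \<omega>)
        have "q u * exceed_prob (T \<omega>) u / Psi u \<le> q u * ((T \<omega> / 1 + 1) * exceed_prob 1 u) / Psi u"
          using exceed_prob_subadditive[OF zero_less_one elim, of u] q_nonneg[of u] Psi_nonneg[of u]
          by (intro divide_right_mono mult_left_mono) auto
        also have "\<dots> = (T \<omega> + 1) * (q u * exceed_prob 1 u / Psi u)" by simp
        also have "\<dots> \<le> (T \<omega> + 1) * (pickands_const + 1)"
          using elim \<open>q u * exceed_prob 1 u / Psi u < pickands_const + 1\<close> by (intro mult_left_mono) auto
        finally show ?case
          using q_nonneg[of u] Psi_nonneg[of u] exceed_prob_nonneg[of "T \<omega>" u] by (simp add: abs_mult)
      qed
    qed
  qed measurable
  have ET: "(\<integral>\<omega>. T \<omega> \<partial>M) * pickands_const \<noteq> 0" using assms(16) H_pos by simp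
  have "((\<lambda>u. (q u * measure M (E u) / Psi u) / ((\<integral>\<omega>. T \<omega> \<partial>M) * pickands_const)) \<longlongrightarrow> ((\<integral>\<omega>. T \<omega> \<partial>M) * pickands_const) / ((\<integral>\<omega>. T \<omega> \<partial>M) * pickands_const)) at_top"
    by (intro tendsto_divide tendsto_const) (use lim ET in \<open>auto simp: PE\<close>)
  \<comment> \<open>Since \<open>q u\<close> is the reciprocal of C^(1/\<alpha>) u^(2/\<alpha>), the
    normalised quotient is the ratio of the two sides of the claim.\<close>
  moreover have "\<forall>\<^sub>F u in at_top. (q u * measure M (E u) / Psi u) / ((\<integral>\<omega>. T \<omega> \<partial>M) * pickands_const)
      = measure M (E u) / ((\<integral>\<omega>. T \<omega> \<partial>M) * C powr (1 / \<alpha>) * pickands_const * u powr (2 / \<alpha>) * Psi u)"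
    using eventually_gt_at_top[of 0]
  proof eventually_elim
    case (elim u)
    have "q u = 1 / (C powr (1 / \<alpha>) * u powr (2 / \<alpha>))"
      by (simp add: q_def powr_minus divide_inverse)
    then show ?case by simp
  qed
  ultimately have "((\<lambda>u. measure M (E u) / ((\<integral>\<omega>. T \<omega> \<partial>M) * C powr (1 / \<alpha>) * pickands_const * u powr (2 / \<alpha>) * Psi u))
      \<longlongrightarrow> ((\<integral>\<omega>. T \<omega> \<partial>M) * pickands_const) / ((\<integral>\<omega>. T \<omega> \<partial>M) * pickands_const)) at_top"
    by (rule Lim_transform_eventually)
  moreover have "((\<integral>\<omega>. T \<omega> \<partial>M) * pickands_const) / ((\<integral>\<omega>. T \<omega> \<partial>M) * pickands_const) = 1" by (rule divide_self[OF ET])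
  ultimately show ?thesis
    unfolding E_eq pickands_eq by (intro asymp_equivI') simp
qed

end
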